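(* Let $\mathfrak{h}$ be a semisimple Lie algebra over $\mathbf{R}$ equipped with a stable $\mathbf{Z}/m\mathbf{Z}$-grading $\mathfrak{h} = \bigoplus_{i \in \mathbf{Z}/m\mathbf{Z}} \mathfrak{h}_i$, let $(G, V)$ be the associated pair, and let $H$ be the adjoint group of $\mathfrak{h}$. Then: (1) For any stable vector $T \in V^s(\mathbf{R})$, there exists a unique Cartan involution $\theta_T$ of $H$ such that $[T, \theta_T(T)] = 0$ and $\theta_T(\mathfrak{h}_i) \subset \mathfrak{h}_{-i}$ for each $i \in \mathbf{Z}/m\mathbf{Z}$ (here $\theta_T$ also denotes the induced automorphism of $\mathfrak{h}$). (2) The map $\mathcal{R} = \mathcal{R}_{\mathfrak{h}} : V^s(\mathbf{R}) \to X_G$ defined by $T \mapsto \theta_T|_G$ is $G(\mathbf{R})$-equivariant.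
   Context: A $\mathbf{Z}/m\mathbf{Z}$-grading of a Lie algebra $\mathfrak{h}$ is a direct sum decomposition $\mathfrak{h} = \bigoplus_{i\in \mathbf{Z}/m\mathbf{Z}} \mathfrak{h}_i$ with $[\mathfrak{h}_i,\mathfrak{h}_j]\subset \mathfrak{h}_{i+j}$. The associated pair $(G,V)$ consists of $G$, the identity component of the algebraic group of automorphisms of $\mathfrak{h}$ preserving the grading (a reductive group, contained in the adjoint group $H = \mathrm{Aut}(\mathfrak{h})^0$), and $V = \mathfrak{h}_1$, a representation of $G$. A vector $v \in V(\mathbf{C})$ is stable if its $G_{\mathbf{C}}$-orbit is closed and has finite stabilizer; the grading is stable if stable vectors exist; $V^s \subset V$ is the (open, $G$-invariant) locus of stable vectors, and $V^s(\mathbf{R})$ its real points. For a linear algebraic group $M$ over $\mathbf{R}$ with $M^0$ reductive, a Cartan involution of $M$ is an involution $\theta: M \to M$ (of algebraic groups over $\mathbf{R}$) such that $K_\theta = \{ h \in M(\mathbf{C}) : \theta(h) = \overline{h}\}$ is a compact subgroup of $M(\mathbf{C})$ meeting every connected component of $M(\mathbf{C})$. $X_M$ denotes the set of Cartan involutions of $M$; $M(\mathbf{R})$ acts on $X_M$ by $g\cdot\theta = \mathrm{Int}(g)\circ\theta\circ\mathrm{Int}(g)^{-1}$, and $G(\mathbf{R})$ acts on $V(\mathbf{R})$ via the adjoint action. *)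

theory Defs
  imports "HOL-Analysis.Analysis" "HOL-Number_Theory.Cong"
begin

section \<open>Lie algebras and gradings\<close>

definition lie_algebra :: "('a::real_vector \<Rightarrow> 'a \<Rightarrow> 'a) \<Rightarrow> bool" where
  "lie_algebra br \<longleftrightarrow> bilinear br \<and> (\<forall>x. br x x = 0) \<and>
     (\<forall>x y z. br x (br y z) + br y (br z x) + br z (br x y) = 0)"

definition lie_ideal :: "('a::real_vector \<Rightarrow> 'a \<Rightarrow> 'a) \<Rightarrow> 'a set \<Rightarrow> bool" where
  "lie_ideal br I \<longleftrightarrow> subspace I \<and> (\<forall>x. \<forall>y\<in>I. br x y \<in> I)"

primrec derived_series :: "('a::real_vector \<Rightarrow> 'a \<Rightarrow> 'a) \<Rightarrow> 'a set \<Rightarrow> nat \<Rightarrow> 'a set" where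
  "derived_series br I 0 = I"
| "derived_series br I (Suc k) =
     span {br x y | x y. x \<in> derived_series br I k \<and> y \<in> derived_series br I k}"

definition lie_solvable :: "('a::real_vector \<Rightarrow> 'a \<Rightarrow> 'a) \<Rightarrow> 'a set \<Rightarrow> bool" where
  "lie_solvable br I \<longleftrightarrow> (\<exists>k. derived_series br I k = {0})"

definition semisimple_lie_algebra :: "('a::real_vector \<Rightarrow> 'a \<Rightarrow> 'a) \<Rightarrow> bool" where
  "semisimple_lie_algebra br \<longleftrightarrow> lie_algebra br \<and>
     (\<forall>I. lie_ideal br I \<and> lie_solvable br I \<longrightarrow> I = {0})"

text \<open>A family indexed by \<open>\<int>/m\<int>\<close> is encoded as a family indexed by the integers that only
  depends on the index modulo \<open>m\<close>.\<close>

definition lie_grading ::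
    "('a::real_vector \<Rightarrow> 'a \<Rightarrow> 'a) \<Rightarrow> nat \<Rightarrow> (int \<Rightarrow> 'a set) \<Rightarrow> bool" where
  "lie_grading br m h \<longleftrightarrow>
     (\<forall>i j. [i = j] (mod int m) \<longrightarrow> h i = h j) \<and>
     (\<forall>i. subspace (h i)) \<and>
     (\<forall>x. \<exists>!f. f \<in> (\<Pi>\<^sub>E i\<in>{0..<int m}. h i) \<and> x = (\<Sum>i\<in>{0..<int m}. f i)) \<and>
     (\<forall>i j. \<forall>x\<in>h i. \<forall>y\<in>h j. br x y \<in> h (i + j))"


section \<open>Complexification\<close>

text \<open>The underlying real vector space of the Lie algebra is \<open>real^'n\<close>, so that its
  complexification is \<open>complex^'n\<close>.\<close>

definition vec_Re :: "complex^'n \<Rightarrow> real^'n" where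
  "vec_Re z = (\<chi> i. Re (z $ i))"

definition vec_Im :: "complex^'n \<Rightarrow> real^'n" where
  "vec_Im z = (\<chi> i. Im (z $ i))"

definition vec_complex :: "real^'n \<Rightarrow> complex^'n" where
  "vec_complex x = (\<chi> i. complex_of_real (x $ i))"

definition mat_complex :: "real^'n^'n \<Rightarrow> complex^'n^'n" where
  "mat_complex A = (\<chi> i j. complex_of_real (A $ i $ j))"

definition mat_cnj :: "complex^'n^'n \<Rightarrow> complex^'n^'n" where
  "mat_cnj A = (\<chi> i j. cnj (A $ i $ j))"

definition br_complex ::
    "(real^'n \<Rightarrow> real^'n \<Rightarrow> real^'n) \<Rightarrow> complex^'n \<Rightarrow> complex^'n \<Rightarrow> complex^'n" where
  "br_complex br z w =
     (\<chi> i. Complex ((br (vec_Re z) (vec_Re w) - br (vec_Im z) (vec_Im w)) $ i)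
                   ((br (vec_Re z) (vec_Im w) + br (vec_Im z) (vec_Re w)) $ i))"

definition complexify :: "(real^'n) set \<Rightarrow> (complex^'n) set" where
  "complexify U = {z. vec_Re z \<in> U \<and> vec_Im z \<in> U}"


section \<open>Linear algebraic groups over the reals\<close>

text \<open>\<open>poly_funs K X\<close> are the polynomial functions in the coordinate functions \<open>X\<close> with
  coefficients in the subring \<open>K\<close> of the complex numbers.\<close>

inductive_set poly_funs :: "complex set \<Rightarrow> ('a \<Rightarrow> complex) set \<Rightarrow> ('a \<Rightarrow> complex) set"
  for K :: "complex set" and X :: "('a \<Rightarrow> complex) set"
where
  const: "c \<in> K \<Longrightarrow> (\<lambda>_. c) \<in> poly_funs K X"
| coord: "f \<in> X \<Longrightarrow> f \<in> poly_funs K X"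
| add: "f \<in> poly_funs K X \<Longrightarrow> g \<in> poly_funs K X \<Longrightarrow> (\<lambda>a. f a + g a) \<in> poly_funs K X"
| mult: "f \<in> poly_funs K X \<Longrightarrow> g \<in> poly_funs K X \<Longrightarrow> (\<lambda>a. f a * g a) \<in> poly_funs K X"

definition vec_coords :: "(complex^'n \<Rightarrow> complex) set" where
  "vec_coords = {\<lambda>v. v $ i | i. True}"

definition mat_coords :: "(complex^'n^'n \<Rightarrow> complex) set" where
  "mat_coords = {\<lambda>A. A $ i $ j | i j. True}"

definition zariski :: "('a \<Rightarrow> complex) set \<Rightarrow> 'a topology" where
  "zariski X = topology_generated_by {{a. p a \<noteq> 0} | p. p \<in> poly_funs UNIV X}"

text \<open>A linear algebraic group \<open>M\<close> over the reals is represented by its group of complex points,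
  a Zariski closed subgroup of the invertible complex matrices stable under \<^const>\<open>mat_cnj\<close>.\<close>

definition identity_component :: "(complex^'n^'n) set \<Rightarrow> (complex^'n^'n) set" where
  "identity_component M = connected_component_of_set (subtopology (zariski mat_coords) M) (mat 1)"

definition real_points :: "(complex^'n^'n) set \<Rightarrow> (real^'n^'n) set" where
  "real_points M = {A. mat_complex A \<in> M}"

definition regular_over_reals ::
    "(complex^'n^'n) set \<Rightarrow> (complex^'n^'n \<Rightarrow> complex^'n^'n) \<Rightarrow> bool" where
  "regular_over_reals M \<theta> \<longleftrightarrow>
     (\<forall>i j. \<exists>p\<in>poly_funs \<real> mat_coords. \<exists>k::nat. \<forall>A\<in>M. \<theta> A $ i $ j = p A / det A ^ k)"

definition alg_involution ::
    "(complex^'n^'n) set \<Rightarrow> (complex^'n^'n \<Rightarrow> complex^'n^'n) \<Rightarrow> bool" where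
  "alg_involution M \<theta> \<longleftrightarrow>
     \<theta> \<in> M \<rightarrow>\<^sub>E M \<and> regular_over_reals M \<theta> \<and>
     (\<forall>A\<in>M. \<forall>B\<in>M. \<theta> (A ** B) = \<theta> A ** \<theta> B) \<and> (\<forall>A\<in>M. \<theta> (\<theta> A) = A)"

text \<open>Compactness and connected components of the group of complex points refer to the Euclidean
  topology.\<close>

definition cartan_involutions ::
    "(complex^'n^'n) set \<Rightarrow> (complex^'n^'n \<Rightarrow> complex^'n^'n) set" where
  "cartan_involutions M =
     {\<theta>. alg_involution M \<theta> \<and>
         compact {A\<in>M. \<theta> A = mat_cnj A} \<and>
         (\<forall>C\<in>components M. C \<inter> {A\<in>M. \<theta> A = mat_cnj A} \<noteq> {})}"

definition cartan_act ::
    "(complex^'n^'n) set \<Rightarrow> real^'n^'n \<Rightarrow> (complex^'n^'n \<Rightarrow> complex^'n^'n)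
       \<Rightarrow> (complex^'n^'n \<Rightarrow> complex^'n^'n)" where
  "cartan_act M g \<theta> =
     (let c = mat_complex g; c' = matrix_inv c
      in restrict (\<lambda>A. c ** \<theta> (c' ** A ** c) ** c') M)"


section \<open>The groups of a graded Lie algebra\<close>

definition lie_Aut :: "(real^'n \<Rightarrow> real^'n \<Rightarrow> real^'n) \<Rightarrow> (complex^'n^'n) set" where
  "lie_Aut br = {A. invertible A \<and>
     (\<forall>x y. A *v br_complex br x y = br_complex br (A *v x) (A *v y))}"

definition adjoint_group :: "(real^'n \<Rightarrow> real^'n \<Rightarrow> real^'n) \<Rightarrow> (complex^'n^'n) set" where
  "adjoint_group br = identity_component (lie_Aut br)"

definition graded_Aut ::
    "(real^'n \<Rightarrow> real^'n \<Rightarrow> real^'n) \<Rightarrow> (int \<Rightarrow> (real^'n) set) \<Rightarrow> (complex^'n^'n) set" where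
  "graded_Aut br h = {A \<in> lie_Aut br. \<forall>i. (\<lambda>x. A *v x) ` complexify (h i) = complexify (h i)}"

definition grading_group ::
    "(real^'n \<Rightarrow> real^'n \<Rightarrow> real^'n) \<Rightarrow> (int \<Rightarrow> (real^'n) set) \<Rightarrow> (complex^'n^'n) set" where
  "grading_group br h = identity_component (graded_Aut br h)"

definition stable_vector ::
    "(real^'n \<Rightarrow> real^'n \<Rightarrow> real^'n) \<Rightarrow> (int \<Rightarrow> (real^'n) set) \<Rightarrow> complex^'n \<Rightarrow> bool" where
  "stable_vector br h v \<longleftrightarrow>
     v \<in> complexify (h 1) \<and>
     closedin (subtopology (zariski vec_coords) (complexify (h 1)))
       {A *v v | A. A \<in> grading_group br h} \<and>
     finite {A \<in> grading_group br h. A *v v = v}"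

definition stable_grading ::
    "(real^'n \<Rightarrow> real^'n \<Rightarrow> real^'n) \<Rightarrow> (int \<Rightarrow> (real^'n) set) \<Rightarrow> bool" where
  "stable_grading br h \<longleftrightarrow> (\<exists>v. stable_vector br h v)"

definition real_stable_vectors ::
    "(real^'n \<Rightarrow> real^'n \<Rightarrow> real^'n) \<Rightarrow> (int \<Rightarrow> (real^'n) set) \<Rightarrow> (real^'n) set" where
  "real_stable_vectors br h = {T \<in> h 1. stable_vector br h (vec_complex T)}"


section \<open>The involution attached to a stable vector\<close>

definition ad_complex :: "(real^'n \<Rightarrow> real^'n \<Rightarrow> real^'n) \<Rightarrow> real^'n \<Rightarrow> complex^'n^'n" where
  "ad_complex br x = mat_complex (matrix (br x))"

text \<open>For a semisimple Lie algebra, \<open>x \<mapsto> ad x\<close> is an isomorphism onto the Lie algebra of its adjoint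
  group; \<open>induced_aut br \<theta>\<close> is the differential of \<open>\<theta>\<close> at the identity under this identification.
  A derivative within the adjoint group is only determined on the tangent vectors, that is, on
  the complex span of the matrices \<open>ad x\<close>, and it is only evaluated there.\<close>

definition induced_aut ::
    "(real^'n \<Rightarrow> real^'n \<Rightarrow> real^'n) \<Rightarrow> (complex^'n^'n \<Rightarrow> complex^'n^'n) \<Rightarrow> real^'n \<Rightarrow> real^'n" where
  "induced_aut br \<theta> x =
     (THE y. \<exists>D. (\<theta> has_derivative D) (at (mat 1) within adjoint_group br) \<and>
                 D (ad_complex br x) = ad_complex br y)"

definition adapted_involution ::
    "(real^'n \<Rightarrow> real^'n \<Rightarrow> real^'n) \<Rightarrow> (int \<Rightarrow> (real^'n) set) \<Rightarrow> real^'n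
       \<Rightarrow> (complex^'n^'n \<Rightarrow> complex^'n^'n) \<Rightarrow> bool" where
  "adapted_involution br h T \<theta> \<longleftrightarrow>
     \<theta> \<in> cartan_involutions (adjoint_group br) \<and>
     br T (induced_aut br \<theta> T) = 0 \<and>
     (\<forall>i. induced_aut br \<theta> ` h i \<subseteq> h (- i))"

definition reduction_map ::
    "(real^'n \<Rightarrow> real^'n \<Rightarrow> real^'n) \<Rightarrow> (int \<Rightarrow> (real^'n) set) \<Rightarrow> real^'n
       \<Rightarrow> (complex^'n^'n \<Rightarrow> complex^'n^'n)" where
  "reduction_map br h T = restrict (THE \<theta>. adapted_involution br h T \<theta>) (grading_group br h)"

end

theory Submission
  imports Defs
begin

text \<open>Fix frames \<open>u\<close> of the Lie algebra that respect the grading and minimise the norm of the bracket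
  pulled back along \<open>u\<close>, with a barrier at \<open>det u = 0\<close>. If minimising frames escaped to infinity, a
  rescaled limit would have an abelian ideal as its range; so a minimum exists, and there the
  first variation shows that the transpose of every \<open>ad y\<close> is again a derivation. This
  gives a Cartan involution reversing the grading, the nondegeneracy of the Killing form
  and the innerness of derivations, using only the absence of solvable ideals.

  Given such an involution, with compact real structure \<open>\<sigma>\<^sub>0\<close>, a vector \<open>g T\<close> of minimal norm in the
  closed orbit of \<open>T\<close> commutes with its conjugate (Kempf--Ness), so \<open>\<sigma> = g\<^sup>-\<^sup>1 \<sigma>\<^sub>0 g\<close> is adapted to \<open>T\<close>. Two adapted
  structures differ by \<open>P = \<sigma> \<sigma>'\<close>, positive definite, and convexity of the norm along \<open>P\<^sup>t\<close> forces all \<open>P\<^sup>t\<close> to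
  fix \<open>T\<close>; as its stabiliser is finite, \<open>P = 1\<close>. Uniqueness makes \<open>\<sigma>\<close> commute with complex
  conjugation, which yields the involution \<open>\<theta>\<^sub>T\<close> over the reals, and makes \<open>T \<mapsto> \<theta>\<^sub>T\<close> equivariant. Only
  exponentials of real-diagonalisable matrices are needed.\<close>

section \<open>Matrix algebra\<close>

text \<open>A frame is varied only in the direction
  \<open>X ** transpose X - transpose X ** X\<close>, where \<open>X\<close> is the matrix of
  \<open>ad y\<close> in the frame. This direction is trace-free, so the barrier does not contribute
  to the derivative; it has degree zero, so the frame stays graded; and as \<open>X\<close> is a
  derivation, its pairing with the bracket is a sum of squares. The auxiliary term
  \<open>e * (u \<bullet> u)\<close> gives compactness, and its own first variation is what makes
  the limiting range an ideal.

  Uniqueness is claimed among all Cartan involutions of the algebraic group, so these must be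
  converted into linear data. A regular involution over the reals has a complex linear differential
  commuting with conjugation; it is therefore conjugation by a real matrix \<open>t\<close> with
  \<open>t ** t = mat 1\<close>. Compactness of the fixed group then forces definiteness: a compact
  structure is moved until it commutes with the one given by \<open>t\<close>, and any remaining
  discrepancy would generate an unbounded one-parameter group of fixed points.\<close>

lemma matrix_add_rdistrib': "((A::'a::semiring_1^'n^'m) + B) ** C = A ** C + B ** C"
  by (vector matrix_matrix_mult_def sum.distrib[symmetric] algebra_simps)

lemma matrix_diff_ldistrib: "(A::'a::ring_1^'n^'m) ** (B - C) = A ** B - A ** C"
  by (vector matrix_matrix_mult_def sum_subtractf[symmetric] algebra_simps)

lemma matrix_diff_rdistrib: "((A::'a::ring_1^'n^'m) - B) ** C = A ** C - B ** C"
  by (vector matrix_matrix_mult_def sum_subtractf[symmetric] algebra_simps)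

lemma matrix_scaleR_left: "(k *\<^sub>R (A::'a::real_algebra_1^'n^'m)) ** B = k *\<^sub>R (A ** B)"
  by (vector matrix_matrix_mult_def scaleR_sum_right)

lemma matrix_scaleR_right: "(A::'a::real_algebra_1^'n^'m) ** (k *\<^sub>R B) = k *\<^sub>R (A ** B)"
  by (vector matrix_matrix_mult_def scaleR_sum_right)

lemma matrix_inv_right: "invertible A \<Longrightarrow> A ** matrix_inv A = mat 1"
  unfolding matrix_inv_def invertible_def by (rule someI2_ex) auto

lemma matrix_inv_left: "invertible A \<Longrightarrow> matrix_inv A ** A = mat 1"
  unfolding matrix_inv_def invertible_def by (rule someI2_ex) auto

lemma matrix_inv_unique:
  fixes A B :: "'a::field^'n^'n"
  assumes "A ** B = mat 1" shows "matrix_inv A = B" "invertible A"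
proof -
  show inv: "invertible A" using assms invertible_right_inverse by blast
  show "matrix_inv A = B"
    by (metis assms inv matrix_inv_left matrix_mul_assoc matrix_mul_lid matrix_mul_rid)
qed

lemma matrix_inv_mult:
  fixes A B :: "'a::field^'n^'n"
  assumes "invertible A" "invertible B"
  shows "matrix_inv (A ** B) = matrix_inv B ** matrix_inv A"
proof -
  have "(A ** B) ** (matrix_inv B ** matrix_inv A) = A ** (B ** matrix_inv B) ** matrix_inv A"
    by (simp only: matrix_mul_assoc)
  then show ?thesis
    by (intro matrix_inv_unique) (simp add: assms matrix_inv_right)
qed

lemma invertible_matrix_inv: "invertible (A::'a::field^'n^'n) \<Longrightarrow> invertible (matrix_inv A)"
  by (metis invertible_right_inverse matrix_inv_left)

lemma matrix_inv_inv: "invertible (A::'a::field^'n^'n) \<Longrightarrow> matrix_inv (matrix_inv A) = A"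
  by (simp add: matrix_inv_left matrix_inv_unique)

lemma matrix_vector_cancel:
  fixes A :: "'a::field^'n^'n"
  assumes "invertible A"
  shows "matrix_inv A *v (A *v x) = x" "A *v (matrix_inv A *v x) = x"
  by (simp_all add: assms matrix_vector_mul_assoc matrix_inv_left matrix_inv_right)

lemma tendsto_matrix_mult [tendsto_intros]:
  fixes f :: "'b \<Rightarrow> 'a::real_normed_field^'n^'m"
  assumes "(f \<longlongrightarrow> A) F" "(g \<longlongrightarrow> B) F"
  shows "((\<lambda>x. f x ** g x) \<longlongrightarrow> A ** B) F"
  unfolding matrix_matrix_mult_def by (intro tendsto_intros assms)

lemma tendsto_matrix_vector_mult [tendsto_intros]:
  fixes f :: "'b \<Rightarrow> 'a::real_normed_field^'n^'m"
  assumes "(f \<longlongrightarrow> A) F" "(g \<longlongrightarrow> B) F"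
  shows "((\<lambda>x. f x *v g x) \<longlongrightarrow> A *v B) F"
  unfolding matrix_vector_mult_def by (intro tendsto_intros assms)

lemma tendsto_transpose [tendsto_intros]:
  assumes "(f \<longlongrightarrow> A) F" shows "((\<lambda>x. transpose (f x)) \<longlongrightarrow> transpose A) F"
  unfolding transpose_def by (intro tendsto_intros assms)

lemma tendsto_det [tendsto_intros]:
  fixes f :: "'b \<Rightarrow> 'a::real_normed_field^'n^'n"
  assumes "(f \<longlongrightarrow> A) F"
  shows "((\<lambda>x. det (f x)) \<longlongrightarrow> det A) F"
  unfolding det_def by (intro tendsto_intros assms)

lemma tendsto_matrix_inv:
  fixes f :: "'b \<Rightarrow> 'a::real_normed_field^'n^'n"
  assumes f: "(f \<longlongrightarrow> A) F" and A: "det A \<noteq> 0"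
  shows "((\<lambda>x. matrix_inv (f x)) \<longlongrightarrow> matrix_inv A) F"
proof -
  \<comment> \<open>Cramer's rule: the entries of the inverse are quotients of determinants, hence
    visibly continuous where \<open>det\<close> does not vanish.\<close>
  define C where
    "C B = (\<chi> k j. det (\<chi> i l. if l = k then axis j 1 $ i else B $ i $ l) / det B)"
    for B :: "'a^'n^'n"
  have C: "matrix_inv B = C B" if "det B \<noteq> 0" for B
  proof -
    have inv: "invertible B" using that invertible_det_nz by blast
    have "column j (matrix_inv B) = (\<chi> k. C B $ k $ j)" for j
    proof -
      have "B *v column j (matrix_inv B) = axis j 1"
      proof -
        have "B *v column j (matrix_inv B) = column j (B ** matrix_inv B)"
          by (simp add: vec_eq_iff matrix_vector_mult_def matrix_matrix_mult_def column_def)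
        then show ?thesis
          by (simp add: matrix_inv_right[OF inv] vec_eq_iff column_def mat_def axis_def)
      qed
      then show ?thesis
        using cramer[OF that] unfolding C_def by simp
    qed
    then show ?thesis by (simp add: vec_eq_iff column_def)
  qed
  have ev: "\<forall>\<^sub>F x in F. det (f x) \<noteq> 0"
    using tendsto_imp_eventually_ne[OF tendsto_det[OF f] A] .
  have "((\<lambda>x. C (f x)) \<longlongrightarrow> C A) F"
    unfolding C_def
  proof (intro tendsto_vec_lambda tendsto_divide tendsto_det f A)
    show "((\<lambda>x. if l = k then axis j 1 $ i else f x $ i $ l) \<longlongrightarrow>
        (if l = k then axis j 1 $ i else A $ i $ l)) F" for k j i l
      by (cases "l = k") (auto intro!: tendsto_vec_nth f)
  qed
  then have "((\<lambda>x. C (f x)) \<longlongrightarrow> matrix_inv A) F"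
    using C[OF A] by simp
  then show ?thesis
    by (rule Lim_transform_eventually) (use ev C in \<open>auto elim: eventually_mono\<close>)
qed

section \<open>First-order behaviour of determinant and inverse at the identity\<close>

lemma DERIV_det_line:
  fixes M :: "real^'n^'n"
  shows "((\<lambda>t. det (mat 1 + t *\<^sub>R M)) has_real_derivative trace M) (at 0)"
proof -
  let ?I = "mat 1 :: real^'n^'n"
  let ?D = "\<lambda>p. (\<Sum>i\<in>UNIV. M $ i $ p i * (\<Prod>j\<in>UNIV - {i}. ?I $ j $ p j))"
  have 1: "((\<lambda>t. det (?I + t *\<^sub>R M)) has_real_derivative
      (\<Sum>p\<in>{p. p permutes UNIV}. of_int (sign p) * ?D p)) (at 0)"
    unfolding det_def
  proof (rule DERIV_sum)
    fix p :: "'n \<Rightarrow> 'n"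
    have "((\<lambda>t. \<Prod>i\<in>UNIV. (?I + t *\<^sub>R M) $ i $ p i) has_real_derivative ?D p) (at 0)"
      unfolding has_field_derivative_def
      by (rule derivative_eq_intros refl | simp add: sum_distrib_right sum_distrib_left mult_ac fun_eq_iff)+
    then show "((\<lambda>t. of_int (sign p) * (\<Prod>i\<in>UNIV. (?I + t *\<^sub>R M) $ i $ p i)) has_real_derivative
        of_int (sign p) * ?D p) (at 0)"
      by (rule DERIV_cmult)
  qed
  \<comment> \<open>A permutation that moves \<open>a\<close> also moves \<open>p a\<close>.
    Removing one factor from the product therefore leaves an off-diagonal entry of the identity,
    which is 0.\<close>
  have "?D p = 0" if pU: "p permutes UNIV" and pid: "p \<noteq> id" for p
  proof -
    obtain a where a: "p a \<noteq> a" using pid by (auto simp: fun_eq_iff)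
    have pp: "p (p a) \<noteq> p a" using a pU by (metis permutes_inverses(2))
    have z: "(\<Prod>j\<in>UNIV - {i}. ?I $ j $ p j) = 0" for i
    proof (cases "i = a")
      case True
      then show ?thesis using a pp by (intro prod_zero) (auto simp: mat_def intro!: bexI[of _ "p a"])
    next
      case False
      then show ?thesis using a by (intro prod_zero) (auto simp: mat_def intro!: bexI[of _ a])
    qed
    show ?thesis by (simp only: z mult_zero_right sum.neutral_const)
  qed
  then have "(\<Sum>p\<in>{p. p permutes UNIV}. of_int (sign p) * ?D p) = (\<Sum>p\<in>{id}. of_int (sign p) * ?D p)"
    by (intro sum.mono_neutral_right) (auto simp: permutes_id finite_permutations)
  also have "\<dots> = trace M"
    by (simp add: trace_def mat_def)
  finally show ?thesis using 1 by simp
qed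

text \<open>Only continuity of \<open>g\<close> at 0 is asked. This is how the derivative of the
  matrix inverse is obtained from its continuity.\<close>

lemma has_vector_derivative_scale_id:
  fixes g :: "real \<Rightarrow> 'a::real_normed_vector"
  assumes "(g \<longlongrightarrow> g 0) (at 0)"
  shows "((\<lambda>t. t *\<^sub>R g t) has_vector_derivative g 0) (at 0)"
proof -
  have "((\<lambda>t. norm (g t - g 0)) \<longlongrightarrow> 0) (at 0)"
    using assms by (simp add: LIM_zero tendsto_norm_zero)
  then have "((\<lambda>t. norm ((0 + t) *\<^sub>R g (0 + t) - 0 *\<^sub>R g 0 - t *\<^sub>R g 0) / norm t) \<longlongrightarrow> 0) (at 0)"
    by (rule Lim_transform_eventually)
      (auto simp: eventually_at_filter scaleR_diff_right[symmetric])
  then show ?thesis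
    unfolding has_vector_derivative_def has_derivative_at
    by (intro conjI bounded_linear_scaleR_left)
qed

lemma bounded_bilinear_matrix_vector:
  "bounded_bilinear (\<lambda>(A::real^'n^'m) x. A *v x)"
  by (intro bilinear_conv_bounded_bilinear[THEN iffD1])
    (auto simp: bilinear_def intro!: linearI simp: algebra_simps scaleR_matrix_vector_assoc)

text \<open>With \<open>R\<close> the inverse, \<open>(1 + t M) R = 1\<close> gives
  \<open>R = 1 - t M R\<close>, where the last term is \<open>t\<close> times a continuous
  function.\<close>

lemma has_vector_derivative_matrix_inv_line:
  fixes M :: "real^'n^'n"
  shows "((\<lambda>t. matrix_inv (mat 1 + t *\<^sub>R M)) has_vector_derivative - M) (at 0)"
proof -
  let ?R = "\<lambda>t. matrix_inv (mat 1 + t *\<^sub>R M)"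
  have R0: "?R 0 = mat 1" by (simp add: matrix_inv_unique)
  have lim1: "((\<lambda>t. mat 1 + t *\<^sub>R M) \<longlongrightarrow> mat 1 + 0 *\<^sub>R M) (at 0)"
    by (intro tendsto_intros)
  have limR: "(?R \<longlongrightarrow> ?R 0) (at 0)"
    by (rule tendsto_matrix_inv[OF lim1]) simp
  have ev: "\<forall>\<^sub>F t in at 0. det (mat 1 + t *\<^sub>R M) \<noteq> 0"
    using tendsto_imp_eventually_ne[OF tendsto_det[OF lim1]] by simp
  have "((\<lambda>t. - (M ** ?R t)) \<longlongrightarrow> - (M ** ?R 0)) (at 0)"
    by (intro tendsto_intros limR)
  then have "((\<lambda>t. t *\<^sub>R (- (M ** ?R t))) has_vector_derivative - (M ** ?R 0)) (at 0)"
    by (rule has_vector_derivative_scale_id)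
  then have "((\<lambda>t. mat 1 + t *\<^sub>R (- (M ** ?R t))) has_vector_derivative 0 + - (M ** ?R 0)) (at 0)"
    by (intro has_vector_derivative_add has_vector_derivative_const)
  then have d: "((\<lambda>t. mat 1 - t *\<^sub>R (M ** ?R t)) has_vector_derivative - M) (at 0)"
    using R0 by simp
  have ev2: "\<forall>\<^sub>F t in at 0. mat 1 - t *\<^sub>R (M ** ?R t) = ?R t"
    using ev
  proof eventually_elim
    case (elim t)
    then have "(mat 1 + t *\<^sub>R M) ** ?R t = mat 1"
      by (simp add: invertible_det_nz matrix_inv_right)
    then show ?case
      by (simp add: matrix_add_rdistrib' matrix_scaleR_left algebra_simps)
  qed
  show ?thesis
    using d ev2 unfolding has_vector_derivative_def
    by (rule has_derivative_transform_eventually) (use R0 in simp_all)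
qed

text \<open>A vector \<open>U a\<close> orthogonal to the smaller range is killed by the transpose
  of \<open>U\<close>; it is then orthogonal to everything in the range of \<open>U\<close>, itself
  included.\<close>

lemma range_matrix_mult_transpose:
  fixes U :: "real^'n^'m"
  shows "range ((*v) (U ** transpose U)) = range ((*v) U)"
proof (rule ccontr)
  assume neq: "\<not> ?thesis"
  have sub: "subspace (range ((*v) (U ** transpose U)))" "subspace (range ((*v) U))"
    by (auto intro!: linear_subspace_image subspace_UNIV)
  have "range ((*v) (U ** transpose U)) \<subseteq> range ((*v) U)"
    by (auto simp: matrix_vector_mul_assoc[symmetric] simp del: transpose_matrix_vector)
  then have "span (range ((*v) (U ** transpose U))) \<subset> span (range ((*v) U))"
    using neq sub by (metis psubset_eq span_eq_iff)
  then obtain x where x: "x \<noteq> 0" "x \<in> span (range ((*v) U))"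
      "\<And>y. y \<in> span (range ((*v) (U ** transpose U))) \<Longrightarrow> orthogonal x y"
    by (rule orthogonal_to_subspace_exists_gen) blast
  obtain a where a: "x = U *v a" using x(2) sub(2) by (metis image_iff span_eq_iff)
  have "orthogonal x ((U ** transpose U) *v x)"
    using x(3) by (simp add: span_base)
  then have "(x v* U) \<bullet> (x v* U) = 0"
    by (simp add: orthogonal_def matrix_vector_mul_assoc[symmetric] dot_lmul_matrix[symmetric])
  then have "x v* U = 0" by simp
  then have "x \<bullet> x = 0"
    using a dot_lmul_matrix[of x U a] by simp
  with x(1) show False by simp
qed

section \<open>The infinitesimal action on bilinear maps\<close>

text \<open>The action of the Lie algebra of all matrices on bilinear maps; it vanishes exactly when
  \<open>X\<close> is a derivation of \<open>w\<close>.\<close>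

definition deriv_act ::
    "real^'n^'n \<Rightarrow> (real^'n \<Rightarrow> real^'n \<Rightarrow> real^'n) \<Rightarrow> real^'n \<Rightarrow> real^'n \<Rightarrow> real^'n" where
  "deriv_act X w a b = X *v w a b - w (X *v a) b - w a (X *v b)"

text \<open>The Euclidean inner product of the arrays of structure constants.\<close>

definition tensor_inner ::
    "(real^'n \<Rightarrow> real^'n \<Rightarrow> real^'n) \<Rightarrow> (real^'n \<Rightarrow> real^'n \<Rightarrow> real^'n) \<Rightarrow> real" where
  "tensor_inner w w' = (\<Sum>i\<in>UNIV. \<Sum>j\<in>UNIV. w (axis i 1) (axis j 1) \<bullet> w' (axis i 1) (axis j 1))"

lemma bilinear_expand_left:
  fixes w :: "real^'n \<Rightarrow> real^'n \<Rightarrow> real^'n"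
  assumes "bilinear w"
  shows "w a b = (\<Sum>k\<in>UNIV. a $ k *\<^sub>R w (axis k 1) b)"
proof -
  have "w a b = w (\<Sum>k\<in>UNIV. a $ k *\<^sub>R axis k 1) b"
    using basis_expansion[of a] by (simp add: scalar_mult_eq_scaleR)
  also have "\<dots> = (\<Sum>k\<in>UNIV. w (a $ k *\<^sub>R axis k 1) b)"
    using assms unfolding bilinear_def by (intro linear_sum[of "\<lambda>a. w a b"]) blast
  finally show ?thesis using bilinear_lmul[OF assms] by simp
qed

lemma bilinear_expand_right:
  fixes w :: "real^'n \<Rightarrow> real^'n \<Rightarrow> real^'n"
  assumes "bilinear w"
  shows "w a b = (\<Sum>k\<in>UNIV. b $ k *\<^sub>R w a (axis k 1))"
proof -
  have "w a b = w a (\<Sum>k\<in>UNIV. b $ k *\<^sub>R axis k 1)"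
    using basis_expansion[of b] by (simp add: scalar_mult_eq_scaleR)
  also have "\<dots> = (\<Sum>k\<in>UNIV. w a (b $ k *\<^sub>R axis k 1))"
    using assms unfolding bilinear_def by (intro linear_sum) blast
  finally show ?thesis using bilinear_rmul[OF assms] by simp
qed

lemma bilinear_deriv_act: "bilinear w \<Longrightarrow> bilinear (deriv_act X w)"
  by (subst bilinear_def)
    (auto intro!: linearI simp: deriv_act_def algebra_simps bilinear_ladd bilinear_radd
      bilinear_lmul bilinear_rmul matrix_vector_mult_scaleR scaleR_diff_right)

text \<open>The matrix acts on one output and two inputs, and in each of the three slots the
  transpose is the adjoint; the three terms are moved across separately.\<close>

lemma tensor_inner_deriv_act:
  assumes w: "bilinear w" and w': "bilinear w'"
  shows "tensor_inner (deriv_act X w) w' = tensor_inner w (deriv_act (transpose X) w')"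
proof -
  let ?e = "\<lambda>i. axis i 1 :: real^'n"
  have col: "(M *v ?e i) $ k = M $ k $ i" for M :: "real^'n^'n" and i k
    by (simp add: matrix_vector_mult_basis column_def)
  have 1: "(X *v w (?e i) (?e j)) \<bullet> w' (?e i) (?e j)
      = w (?e i) (?e j) \<bullet> (transpose X *v w' (?e i) (?e j))" for i j
    by (metis dot_lmul_matrix inner_commute transpose_matrix_vector)
  have 2: "(\<Sum>i\<in>UNIV. w (X *v ?e i) (?e j) \<bullet> w' (?e i) (?e j))
      = (\<Sum>i\<in>UNIV. w (?e i) (?e j) \<bullet> w' (transpose X *v ?e i) (?e j))" for j
  proof -
    have "(\<Sum>i\<in>UNIV. w (X *v ?e i) (?e j) \<bullet> w' (?e i) (?e j))
      = (\<Sum>i\<in>UNIV. \<Sum>k\<in>UNIV. X $ k $ i * (w (?e k) (?e j) \<bullet> w' (?e i) (?e j)))"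
      by (subst bilinear_expand_left[OF w]) (simp add: inner_sum_left col)
    also have "\<dots> = (\<Sum>k\<in>UNIV. \<Sum>i\<in>UNIV. X $ k $ i * (w (?e k) (?e j) \<bullet> w' (?e i) (?e j)))"
      by (rule sum.swap)
    also have "\<dots> = (\<Sum>k\<in>UNIV. w (?e k) (?e j) \<bullet> w' (transpose X *v ?e k) (?e j))"
      by (subst (2) bilinear_expand_left[OF w'])
        (simp add: inner_sum_right col transpose_def del: transpose_matrix_vector)
    finally show ?thesis .
  qed
  have 3: "(\<Sum>j\<in>UNIV. w (?e i) (X *v ?e j) \<bullet> w' (?e i) (?e j))
      = (\<Sum>j\<in>UNIV. w (?e i) (?e j) \<bullet> w' (?e i) (transpose X *v ?e j))" for i
  proof -
    have "(\<Sum>j\<in>UNIV. w (?e i) (X *v ?e j) \<bullet> w' (?e i) (?e j))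
      = (\<Sum>j\<in>UNIV. \<Sum>k\<in>UNIV. X $ k $ j * (w (?e i) (?e k) \<bullet> w' (?e i) (?e j)))"
      by (subst bilinear_expand_right[OF w]) (simp add: inner_sum_left col)
    also have "\<dots> = (\<Sum>k\<in>UNIV. \<Sum>j\<in>UNIV. X $ k $ j * (w (?e i) (?e k) \<bullet> w' (?e i) (?e j)))"
      by (rule sum.swap)
    also have "\<dots> = (\<Sum>k\<in>UNIV. w (?e i) (?e k) \<bullet> w' (?e i) (transpose X *v ?e k))"
      by (subst (2) bilinear_expand_right[OF w'])
        (simp add: inner_sum_right col transpose_def del: transpose_matrix_vector)
    finally show ?thesis .
  qed
  have t2: "(\<Sum>i\<in>UNIV. \<Sum>j\<in>UNIV. w (X *v ?e i) (?e j) \<bullet> w' (?e i) (?e j))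
      = (\<Sum>i\<in>UNIV. \<Sum>j\<in>UNIV. w (?e i) (?e j) \<bullet> w' (transpose X *v ?e i) (?e j))"
    by (subst (1 2) sum.swap) (simp only: 2)
  show ?thesis
    unfolding tensor_inner_def deriv_act_def
    by (simp add: inner_diff_left inner_diff_right sum_subtractf 1 t2 3 del: transpose_matrix_vector)
qed

lemma deriv_act_commutator:
  assumes "bilinear w"
  shows "deriv_act (X ** Y - Y ** X) w a b
    = deriv_act X (deriv_act Y w) a b - deriv_act Y (deriv_act X w) a b"
  unfolding deriv_act_def
  by (simp add: algebra_simps matrix_vector_mul_assoc matrix_vector_mult_diff_rdistrib
      bilinear_lsub[OF assms] bilinear_rsub[OF assms])

text \<open>As \<open>X\<close> kills \<open>w\<close>, the commutator acts on \<open>w\<close> as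
  \<open>X\<close> after \<open>transpose X\<close>, and adjunction moves \<open>X\<close> to the
  other side. The commutator is thus the direction in which the first variation becomes a
  square.\<close>

lemma tensor_inner_commutator_transpose:
  assumes w: "bilinear w" and X: "\<And>a b. deriv_act X w a b = 0"
  shows "tensor_inner (deriv_act (X ** transpose X - transpose X ** X) w) w
    = tensor_inner (deriv_act (transpose X) w) (deriv_act (transpose X) w)"
proof -
  let ?Y = "transpose X"
  have "deriv_act X w = (\<lambda>_ _. 0)" using X by (simp add: fun_eq_iff)
  then have z: "deriv_act ?Y (deriv_act X w) = (\<lambda>_ _. 0)"
    by (simp add: deriv_act_def fun_eq_iff)
  have "deriv_act (X ** ?Y - ?Y ** X) w = deriv_act X (deriv_act ?Y w)"
    using z by (simp add: fun_eq_iff deriv_act_commutator[OF w] del: transpose_matrix_vector)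
  then show ?thesis
    by (simp add: tensor_inner_deriv_act[OF bilinear_deriv_act[OF w] w])
qed

lemma tensor_inner_self_nonneg: "tensor_inner w w \<ge> 0"
  unfolding tensor_inner_def by (intro sum_nonneg) auto

lemma norm_le_tensor_inner:
  "(norm (w (axis i 1) (axis j 1)))\<^sup>2 \<le> tensor_inner w w"
proof -
  have "w (axis i 1) (axis j 1) \<bullet> w (axis i 1) (axis j 1)
      \<le> (\<Sum>j\<in>UNIV. w (axis i 1) (axis j 1) \<bullet> w (axis i 1) (axis j 1))"
    by (rule member_le_sum) auto
  also have "\<dots> \<le> tensor_inner w w"
    unfolding tensor_inner_def
    by (rule member_le_sum[where f="\<lambda>i. \<Sum>j\<in>UNIV. w (axis i 1) (axis j 1) \<bullet> w (axis i 1) (axis j 1)"])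
      (auto intro!: sum_nonneg)
  finally show ?thesis by (simp add: dot_square_norm)
qed

lemma tensor_inner_self_eq_0:
  assumes "bilinear w" "tensor_inner w w = 0"
  shows "w a b = 0"
proof -
  have "w (axis i 1) (axis j 1) = 0" for i j
    using norm_le_tensor_inner[of w i j] assms(2) by simp
  then show ?thesis
    by (subst bilinear_expand_left[OF assms(1)], subst bilinear_expand_right[OF assms(1)]) simp
qed

lemma inner_matrix_eq_trace: "(A::real^'n^'n) \<bullet> B = trace (transpose A ** B)"
  unfolding inner_vec_def trace_def transpose_def matrix_matrix_mult_def
  by simp (rule sum.swap)

section \<open>Pulling back a bracket along a frame\<close>

text \<open>The bracket in the coordinates of the basis formed by the columns of \<open>u\<close>;
  changing \<open>u\<close> moves it through isomorphic Lie brackets.\<close>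

definition pull_bracket ::
    "(real^'n \<Rightarrow> real^'n \<Rightarrow> real^'n) \<Rightarrow> real^'n^'n \<Rightarrow> real^'n \<Rightarrow> real^'n \<Rightarrow> real^'n" where
  "pull_bracket br u a b = matrix_inv u *v br (u *v a) (u *v b)"

text \<open>The term with \<open>e\<close> makes sublevel sets bounded and is removed in the end by
  letting \<open>e\<close> tend to 0. The last term keeps the determinant away from 0.\<close>

definition frame_energy ::
    "(real^'n \<Rightarrow> real^'n \<Rightarrow> real^'n) \<Rightarrow> real \<Rightarrow> real^'n^'n \<Rightarrow> real" where
  "frame_energy br e u = tensor_inner (pull_bracket br u) (pull_bracket br u) + e * (u \<bullet> u)
     + inverse ((det u)\<^sup>2)"

lemma bilinear_pull_bracket: "bilinear br \<Longrightarrow> bilinear (pull_bracket br u)"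
  by (subst bilinear_def)
    (auto intro!: linearI simp: pull_bracket_def algebra_simps bilinear_ladd bilinear_radd
      bilinear_lmul bilinear_rmul matrix_vector_mult_scaleR)

lemma tendsto_pull_bracket:
  fixes f :: "'b \<Rightarrow> real^'n^'n"
  assumes br: "bilinear br" and f: "(f \<longlongrightarrow> u) F" and u: "det u \<noteq> 0"
  shows "((\<lambda>x. pull_bracket br (f x) a b) \<longlongrightarrow> pull_bracket br u a b) F"
proof -
  have "bounded_bilinear br" using br bilinear_conv_bounded_bilinear by blast
  then show ?thesis
    unfolding pull_bracket_def
    by (intro tendsto_matrix_vector_mult tendsto_matrix_inv f u bounded_bilinear.tendsto[of br]
        tendsto_const)
qed

lemma tendsto_frame_energy:
  fixes f :: "'b \<Rightarrow> real^'n^'n"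
  assumes br: "bilinear br" and f: "(f \<longlongrightarrow> u) F" and u: "det u \<noteq> 0"
  shows "((\<lambda>x. frame_energy br e (f x)) \<longlongrightarrow> frame_energy br e u) F"
  unfolding frame_energy_def tensor_inner_def
  by (intro tendsto_add tendsto_sum tendsto_inner tendsto_mult tendsto_const tendsto_inverse
      tendsto_power tendsto_det tendsto_pull_bracket br f u) (use u in auto)

text \<open>Along \<open>u (1 + t M)\<close> the pulled back bracket moves with velocity
  \<open>- deriv_act M\<close>, and the determinant is stationary since \<open>M\<close> has trace
  0. So the derivative of the energy consists of the two sides of the claim, with opposite signs and
  a factor 2.\<close>

lemma frame_energy_first_variation:
  fixes u M :: "real^'n^'n"
  assumes br: "bilinear br" and u: "det u \<noteq> 0" and M: "trace M = 0"
    and min: "\<And>t. det (u ** (mat 1 + t *\<^sub>R M)) \<noteq> 0 \<Longrightarrow>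
        frame_energy br e u \<le> frame_energy br e (u ** (mat 1 + t *\<^sub>R M))"
  shows "tensor_inner (deriv_act M (pull_bracket br u)) (pull_bracket br u) = e * (u \<bullet> (u ** M))"
proof -
  let ?m = "\<lambda>t. mat 1 + t *\<^sub>R M"
  let ?w = "pull_bracket br u"
  have w: "bilinear ?w" by (rule bilinear_pull_bracket[OF br])
  note bbw = w[unfolded bilinear_conv_bounded_bilinear]
  have iu: "invertible u" using u by (simp add: invertible_det_nz)
  have m0: "?m 0 = mat 1" by simp
  have dm: "(?m has_vector_derivative M) (at 0)"
    by (auto intro!: derivative_eq_intros)
  have dmv: "((\<lambda>t. ?m t *v a) has_vector_derivative M *v a) (at 0)" for a
    using bounded_linear.has_vector_derivative[OF
        bounded_bilinear.bounded_linear_left[OF bounded_bilinear_matrix_vector] dm] .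
  have dW: "((\<lambda>t. ?w (?m t *v a) (?m t *v b)) has_vector_derivative
      ?w a (M *v b) + ?w (M *v a) b) (at 0)" for a b
    using bounded_bilinear.has_vector_derivative[OF bbw dmv[of a] dmv[of b]] by simp
  have dw: "((\<lambda>t. pull_bracket br (u ** ?m t) a b) has_vector_derivative
      - deriv_act M ?w a b) (at 0)" for a b
  proof -
    have d: "((\<lambda>t. matrix_inv (?m t) *v ?w (?m t *v a) (?m t *v b)) has_vector_derivative
       matrix_inv (?m 0) *v (?w a (M *v b) + ?w (M *v a) b)
         + (- M) *v ?w (?m 0 *v a) (?m 0 *v b)) (at 0)"
      by (rule bounded_bilinear.has_vector_derivative[OF bounded_bilinear_matrix_vector
          has_vector_derivative_matrix_inv_line dW])
    have eq: "matrix_inv (?m 0) *v (?w a (M *v b) + ?w (M *v a) b)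
         + (- M) *v ?w (?m 0 *v a) (?m 0 *v b) = - deriv_act M ?w a b"
    proof -
      have "matrix_inv (?m 0) = mat 1" by (simp add: matrix_inv_unique)
      moreover have "(- M) *v x = - (M *v x)" for x
        by (simp add: vec_eq_iff matrix_vector_mult_def sum_negf)
      ultimately show ?thesis unfolding deriv_act_def m0 by simp
    qed
    have lim: "((\<lambda>t. ?m t) \<longlongrightarrow> ?m 0) (at 0)" by (intro tendsto_intros)
    have "\<forall>\<^sub>F t in at 0. det (?m t) \<noteq> 0"
      using tendsto_imp_eventually_ne[OF tendsto_det[OF lim]] by simp
    then have ev: "\<forall>\<^sub>F t in at 0. matrix_inv (?m t) *v ?w (?m t *v a) (?m t *v b)
        = pull_bracket br (u ** ?m t) a b"
    proof eventually_elim
      case (elim t)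
      then have "invertible (?m t)" by (simp add: invertible_det_nz)
      then show ?case
        unfolding pull_bracket_def
        by (simp add: matrix_inv_mult[OF iu] matrix_vector_mul_assoc matrix_mul_assoc)
    qed
    have "((\<lambda>t. pull_bracket br (u ** ?m t) a b) has_vector_derivative
       matrix_inv (?m 0) *v (?w a (M *v b) + ?w (M *v a) b)
         + (- M) *v ?w (?m 0 *v a) (?m 0 *v b)) (at 0)"
      using d ev unfolding has_vector_derivative_def
      by (rule has_derivative_transform_eventually)
        (simp_all add: pull_bracket_def matrix_inv_unique)
    then show ?thesis unfolding eq .
  qed
  have dT: "((\<lambda>t. tensor_inner (pull_bracket br (u ** ?m t)) (pull_bracket br (u ** ?m t)))
      has_real_derivative - 2 * tensor_inner (deriv_act M ?w) ?w) (at 0)"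
  proof -
    have "((\<lambda>t. pull_bracket br (u ** ?m t) a b \<bullet> pull_bracket br (u ** ?m t) a b)
      has_real_derivative - 2 * (deriv_act M ?w a b \<bullet> ?w a b)) (at 0)" for a b
    proof -
      have "((\<lambda>t. pull_bracket br (u ** ?m t) a b \<bullet> pull_bracket br (u ** ?m t) a b)
        has_vector_derivative
         pull_bracket br (u ** ?m 0) a b \<bullet> (- deriv_act M ?w a b)
          + (- deriv_act M ?w a b) \<bullet> pull_bracket br (u ** ?m 0) a b) (at 0)"
        by (rule bounded_bilinear.has_vector_derivative[OF bounded_bilinear_inner dw dw])
      then show ?thesis
        by (simp add: has_real_derivative_iff_has_vector_derivative inner_commute algebra_simps)
    qed
    then show ?thesis
      unfolding tensor_inner_def sum_distrib_left by (intro DERIV_sum)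
  qed
  have dU: "((\<lambda>t. e * ((u ** ?m t) \<bullet> (u ** ?m t))) has_real_derivative 2 * e * (u \<bullet> (u ** M))) (at 0)"
  proof -
    have "(u ** ?m t) = u + t *\<^sub>R (u ** M)" for t
      by (simp add: matrix_add_ldistrib matrix_scaleR_right)
    then have eq: "e * ((u ** ?m t) \<bullet> (u ** ?m t))
        = e * (u \<bullet> u + 2 * t * (u \<bullet> (u ** M)) + t^2 * ((u ** M) \<bullet> (u ** M)))" for t
      by (simp add: inner_add_left inner_add_right inner_commute power2_eq_square algebra_simps)
    show ?thesis unfolding eq by (auto intro!: derivative_eq_intros)
  qed
  have dD: "((\<lambda>t. inverse ((det (u ** ?m t))\<^sup>2)) has_real_derivative 0) (at 0)"
    unfolding det_mul
    by (rule derivative_eq_intros DERIV_det_line refl | simp add: u M)+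
  have dE: "((\<lambda>t. frame_energy br e (u ** ?m t)) has_real_derivative
      - 2 * tensor_inner (deriv_act M ?w) ?w + 2 * e * (u \<bullet> (u ** M)) + 0) (at 0)"
    unfolding frame_energy_def by (intro DERIV_add dT dU dD)
  have "((\<lambda>t. det (u ** ?m t)) \<longlongrightarrow> det (u ** ?m 0)) (at 0)"
    by (intro tendsto_intros)
  then have "\<forall>\<^sub>F t in at 0. det (u ** ?m t) \<noteq> 0"
    by (rule tendsto_imp_eventually_ne) (simp add: u)
  then obtain d where d: "d > 0" "\<And>t. t \<noteq> 0 \<Longrightarrow> dist t 0 < d \<Longrightarrow> det (u ** ?m t) \<noteq> 0"
    unfolding eventually_at by auto
  have "- 2 * tensor_inner (deriv_act M ?w) ?w + 2 * e * (u \<bullet> (u ** M)) + 0 = 0"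
  proof (rule DERIV_local_min[OF dE d(1)], safe)
    fix t :: real assume "\<bar>0 - t\<bar> < d"
    then show "frame_energy br e (u ** ?m 0) \<le> frame_energy br e (u ** ?m t)"
      using min[of t] d(2)[of t] by (cases "t = 0") (auto simp: dist_norm)
  qed
  then show ?thesis by simp
qed

section \<open>Graded semisimple Lie algebras\<close>

locale graded_lie =
  fixes br :: "real^'n \<Rightarrow> real^'n \<Rightarrow> real^'n"
    and m :: nat
    and h :: "int \<Rightarrow> (real^'n) set"
  assumes semisimple: "semisimple_lie_algebra br"
    and m_pos: "0 < m"
    and grading: "lie_grading br m h"
begin

lemma br_bilinear: "bilinear br"
  and br_self [simp]: "br x x = 0"
  and br_jacobi: "br x (br y z) + br y (br z x) + br z (br x y) = 0"
  using semisimple by (auto simp: semisimple_lie_algebra_def lie_algebra_def)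

lemmas br_simps =
  bilinear_ladd[OF br_bilinear] bilinear_radd[OF br_bilinear]
  bilinear_lmul[OF br_bilinear] bilinear_rmul[OF br_bilinear]
  bilinear_lzero[OF br_bilinear] bilinear_rzero[OF br_bilinear]
  bilinear_lneg[OF br_bilinear] bilinear_rneg[OF br_bilinear]
  bilinear_lsub[OF br_bilinear] bilinear_rsub[OF br_bilinear]

lemma br_skew: "br x y = - br y x"
proof -
  have "br (x + y) (x + y) = (br x x + br y y) + (br x y + br y x)"
    by (simp only: bilinear_ladd[OF br_bilinear] bilinear_radd[OF br_bilinear] add_ac)
  then have "br x y + br y x = 0" by simp
  then show ?thesis by (simp add: eq_neg_iff_add_eq_0)
qed

lemma br_leibniz: "br x (br y z) = br (br x y) z + br y (br x z)"
proof -
  have "br y (br z x) = - br y (br x z)" "br z (br x y) = - br (br x y) z"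
    using br_skew[of z x] br_skew[of z "br x y"] by (simp_all add: br_simps)
  then show ?thesis using br_jacobi[of x y z] by (simp add: algebra_simps)
qed

lemma h_cong: "[i = j] (mod int m) \<Longrightarrow> h i = h j"
  and h_subspace: "subspace (h i)"
  and h_decomp: "\<exists>!f. f \<in> (\<Pi>\<^sub>E i\<in>{0..<int m}. h i) \<and> x = (\<Sum>i\<in>{0..<int m}. f i)"
  and h_br: "x \<in> h i \<Longrightarrow> y \<in> h j \<Longrightarrow> br x y \<in> h (i + j)"
  using grading unfolding lie_grading_def by blast+

lemma h_mod: "h (i mod int m) = h i"
  by (rule h_cong) (simp add: cong_def)

lemma h_decompE:
  obtains f where "\<And>i. f i \<in> h i" "x = (\<Sum>i\<in>{0..<int m}. f i)"
proof -
  obtain f where f: "f \<in> (\<Pi>\<^sub>E i\<in>{0..<int m}. h i)" "x = (\<Sum>i\<in>{0..<int m}. f i)"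
    using h_decomp[of x] by blast
  show ?thesis
  proof (rule that[of "\<lambda>i. if i \<in> {0..<int m} then f i else 0"])
    show "(if i \<in> {0..<int m} then f i else 0) \<in> h i" for i
      using f(1) by (auto simp: PiE_def Pi_def subspace_0[OF h_subspace])
    show "x = (\<Sum>i\<in>{0..<int m}. if i \<in> {0..<int m} then f i else 0)"
      unfolding f(2) by (rule sum.cong) auto
  qed
qed

lemma h_decomp_unique:
  assumes "\<And>i. f i \<in> h i" "\<And>i. g i \<in> h i"
    and "(\<Sum>i\<in>{0..<int m}. f i) = (\<Sum>i\<in>{0..<int m}. g i)" and "i \<in> {0..<int m}"
  shows "f i = g i"
proof -
  let ?I = "{0..<int m}"
  have "restrict f ?I = restrict g ?I"
    using h_decomp[of "\<Sum>i\<in>?I. f i"] assms(1-3)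
    by (metis (no_types, lifting) restrict_PiE_iff restrict_apply' sum.cong)
  then show ?thesis using assms(4) by (metis restrict_apply')
qed

lemma h_induct [case_names add homogeneous]:
  assumes add: "\<And>x y. P x \<Longrightarrow> P y \<Longrightarrow> P (x + y)" and hom: "\<And>i x. x \<in> h i \<Longrightarrow> P x"
  shows "P x"
proof -
  obtain f where f: "\<And>i. f i \<in> h i" "x = (\<Sum>i\<in>{0..<int m}. f i)"
    by (rule h_decompE[of x]) blast
  have "P (\<Sum>i\<in>A. f i)" if "finite A" for A
    using that
  proof induction
    case empty
    show ?case using hom[OF subspace_0[OF h_subspace]] by simp
  next
    case (insert a A)
    then show ?case using add[OF hom[OF f(1)]] by simp
  qed
  then show ?thesis using f(2) by simp
qed

text \<open>The derived series of an abelian ideal stops after one step. The absence of solvable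
  ideals enters the proof through this lemma alone.\<close>

lemma abelian_ideal_trivial:
  assumes I: "lie_ideal br I" and ab: "\<And>x y. x \<in> I \<Longrightarrow> y \<in> I \<Longrightarrow> br x y = 0"
  shows "I = {0}"
proof -
  have "0 \<in> I" using I by (auto simp: lie_ideal_def subspace_0)
  then have "{br x y | x y. x \<in> I \<and> y \<in> I} = {0}" using ab by force
  then have "derived_series br I 1 = {0}" by (simp add: span_insert_0)
  then show ?thesis
    using semisimple I unfolding semisimple_lie_algebra_def lie_solvable_def by blast
qed

lemma center_trivial:
  assumes "\<And>y. br x y = 0" shows "x = 0"
proof -
  let ?Z = "{x. \<forall>y. br x y = 0}"
  have "lie_ideal br ?Z"
    unfolding lie_ideal_def
  proof (intro conjI allI ballI)
    show "subspace ?Z" by (auto simp: subspace_def br_simps)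
    fix x y assume "y \<in> ?Z"
    then have "br x y = 0" using br_skew[of x y] by simp
    then show "br x y \<in> ?Z" by (simp add: br_simps)
  qed
  then have "?Z = {0}" by (rule abelian_ideal_trivial) simp
  then show ?thesis using assms by auto
qed

definition adm :: "real^'n \<Rightarrow> real^'n^'n" where
  "adm y = matrix (br y)"

lemma adm_apply [simp]: "adm y *v x = br y x"
proof -
  have "linear (br y)" using br_bilinear by (simp add: bilinear_def)
  then show ?thesis unfolding adm_def by (metis matrix_vector_mul(2))
qed

subsection \<open>Homogeneous frames\<close>

text \<open>Homogeneous bases with prescribed degrees. With the degrees fixed this is an open subset
  of a linear space, so small variations that respect degrees stay inside.\<close>

definition frames :: "('n \<Rightarrow> int) \<Rightarrow> (real^'n^'n) set" where
  "frames d = {u. invertible u \<and> (\<forall>k. column k u \<in> h (d k))}"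

lemma frame_exists:
  obtains d u where "\<And>k. d k \<in> {0..<int m}" "u \<in> frames d"
proof -
  let ?S = "\<Union>i\<in>{0..<int m}. h i"
  obtain B where B: "B \<subseteq> ?S" "independent B" "?S \<subseteq> span B"
    by (rule maximal_independent_subset)
  have "x \<in> span B" for x
  proof -
    obtain f where f: "\<And>i. f i \<in> h i" "x = (\<Sum>i\<in>{0..<int m}. f i)"
      by (rule h_decompE[of x]) blast
    show ?thesis unfolding f(2) by (intro span_sum) (use f(1) B(3) in blast)
  qed
  then have sp: "span B = UNIV" by auto
  have fin: "finite B" using B(2) by (rule finiteI_independent)
  have "card B = CARD('n)"
    using dim_eq_card_independent[OF B(2)] sp by (metis DIM_cart DIM_real dim_UNIV dim_span mult.right_neutral)
  then obtain f where f: "bij_betw f (UNIV::'n set) B"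
    using finite_same_card_bij[of "UNIV::'n set" B] fin by auto
  let ?u = "(\<chi> i j. f j $ i) :: real^'n^'n"
  have col: "column j ?u = f j" for j by (simp add: column_def)
  have "columns ?u = B"
    unfolding columns_def using f by (auto simp: col bij_betw_def)
  then have inv: "invertible ?u"
    using matrix_right_invertible_span_columns[of ?u] sp
    by (metis invertible_right_inverse span_vec_eq)
  have "\<forall>k. \<exists>i\<in>{0..<int m}. f k \<in> h i" using f B(1) by (auto simp: bij_betw_def)
  then obtain d where d: "\<And>k. d k \<in> {0..<int m}" "\<And>k. f k \<in> h (d k)" by metis
  show ?thesis
    by (rule that[of d ?u]) (use d inv col in \<open>auto simp: frames_def\<close>)
qed

lemma frame_expand: "u *v z = (\<Sum>k\<in>UNIV. z $ k *\<^sub>R column k u)" for u :: "real^'n^'n"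
  by (simp add: matrix_mult_sum scalar_mult_eq_scaleR)

lemma frame_image:
  fixes u :: "real^'n^'n"
  assumes u: "\<And>k. column k u \<in> h (d k)" and z: "\<And>k. z $ k \<noteq> 0 \<Longrightarrow> [d k = j] (mod int m)"
  shows "u *v z \<in> h j"
  unfolding frame_expand
proof (intro subspace_sum h_subspace)
  fix k show "z $ k *\<^sub>R column k u \<in> h j"
    using u[of k] h_cong[OF z[of k]]
    by (cases "z $ k = 0") (auto simp: subspace_0[OF h_subspace] subspace_scale[OF h_subspace])
qed

text \<open>Grouping the coordinates \<open>z\<close> by degree yields the homogeneous components of
  \<open>u *v z\<close>. Uniqueness of the decomposition kills all groups but that of degree
  \<open>j\<close>, and \<open>u\<close> is injective.\<close>

lemma frame_coords:
  assumes d: "\<And>k. d k \<in> {0..<int m}" and u: "u \<in> frames d"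
    and uz: "u *v z \<in> h j" and k: "z $ k \<noteq> 0"
  shows "[d k = j] (mod int m)"
proof (rule ccontr)
  assume not: "\<not> [d k = j] (mod int m)"
  let ?I = "{0..<int m}"
  define zi where "zi i = (\<chi> k. if d k = i then z $ k else 0)" for i
  have 1: "u *v zi i \<in> h i" for i
    by (rule frame_image[of u d]) (use u in \<open>auto simp: frames_def zi_def split: if_splits\<close>)
  have "(\<Sum>i\<in>?I. zi i) = z"
    using d by (simp add: zi_def vec_eq_iff)
  then have "(\<Sum>i\<in>?I. u *v zi i) = u *v z"
    using linear_sum[OF matrix_vector_mul_linear[of u], of zi ?I] by simp
  also have "\<dots> = (\<Sum>i\<in>?I. if i = j mod int m then u *v z else 0)"
    using m_pos by simp
  finally have 3: "(\<Sum>i\<in>?I. u *v zi i) = (\<Sum>i\<in>?I. if i = j mod int m then u *v z else 0)" .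
  have 4: "(if i = j mod int m then u *v z else 0) \<in> h i" for i
    using uz h_mod[of j] by (auto simp: subspace_0[OF h_subspace])
  have "u *v zi (d k) = (if d k = j mod int m then u *v z else 0)"
    by (rule h_decomp_unique[OF 1 4 3 d])
  moreover have "d k \<noteq> j mod int m" using not by (auto simp: cong_def)
  ultimately have "u *v zi (d k) = 0" by simp
  then have "zi (d k) = 0"
    using u matrix_vector_cancel(1)[of u "zi (d k)"] by (simp add: frames_def)
  then have "zi (d k) $ k = 0" by simp
  then show False using k by (simp add: zi_def)
qed

definition frame_ad :: "real^'n^'n \<Rightarrow> real^'n \<Rightarrow> real^'n^'n" where
  "frame_ad u y = matrix_inv u ** adm y ** u"

lemma frame_ad_conj:
  assumes "invertible u"
  shows "u ** frame_ad u y = adm y ** u"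
  unfolding frame_ad_def
  by (metis assms matrix_inv_right matrix_mul_assoc matrix_mul_lid)

lemma frame_ad_degree:
  assumes d: "\<And>k. d k \<in> {0..<int m}" and u: "u \<in> frames d" and y: "y \<in> h i"
    and kl: "frame_ad u y $ k $ l \<noteq> 0"
  shows "[d k = d l + i] (mod int m)"
proof (rule frame_coords[OF d u])
  let ?z = "column l (frame_ad u y)"
  have "u *v ?z = (u ** frame_ad u y) *v axis l 1"
    by (metis matrix_vector_mul_assoc matrix_vector_mult_basis)
  also have "\<dots> = adm y *v (u *v axis l 1)"
    using u by (simp only: frame_ad_conj frames_def matrix_vector_mul_assoc mem_Collect_eq)
  also have "\<dots> = br y (column l u)"
    by (simp add: matrix_vector_mult_basis)
  finally show "u *v ?z \<in> h (d l + i)"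
    using h_br[OF y, of "column l u" "d l"] u by (simp add: frames_def add.commute)
  show "?z $ k \<noteq> 0" using kl by (simp add: column_def)
qed

lemma frame_ad_derivation:
  assumes "invertible u"
  shows "deriv_act (frame_ad u y) (pull_bracket br u) a b = 0"
proof -
  have 1: "u *v (frame_ad u y *v a) = br y (u *v a)" for a
    by (simp add: matrix_vector_mul_assoc frame_ad_conj[OF assms])
       (simp add: matrix_vector_mul_assoc[symmetric])
  have 2: "frame_ad u y *v (matrix_inv u *v c) = matrix_inv u *v br y c" for c
    unfolding frame_ad_def
    by (simp add: matrix_vector_mul_assoc[symmetric] matrix_vector_cancel[OF assms])
  show ?thesis
    unfolding deriv_act_def pull_bracket_def 1 2
    by (simp add: br_leibniz[of y "u *v a"] matrix_vector_right_distrib)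
qed

text \<open>The first variation is taken along \<open>X ** transpose X - transpose X ** X\<close>.
  If \<open>X\<close> raises degrees by \<open>i\<close>, its transpose lowers them by
  \<open>i\<close>, so this direction preserves degrees and the varied frames compete with
  \<open>u\<close>.\<close>

lemma frame_minimum_identity:
  assumes d: "\<And>k. d k \<in> {0..<int m}" and u: "u \<in> frames d"
    and min: "\<And>v. v \<in> frames d \<Longrightarrow> frame_energy br e u \<le> frame_energy br e v"
    and y: "y \<in> h i"
  defines "X \<equiv> frame_ad u y"
  shows "tensor_inner (deriv_act (transpose X) (pull_bracket br u)) (deriv_act (transpose X) (pull_bracket br u))
     = e * ((u ** X) \<bullet> (u ** X) - (u ** transpose X) \<bullet> (u ** transpose X))"
proof -
  have iu: "invertible u" and cu: "\<And>k. column k u \<in> h (d k)" using u by (auto simp: frames_def)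
  let ?M = "X ** transpose X - transpose X ** X"
  have X: "[d k = d l + i] (mod int m)" if "X $ k $ l \<noteq> 0" for k l
    using frame_ad_degree[OF d u y] that unfolding X_def by blast
  have M: "[d k = d l] (mod int m)" if nz: "?M $ k $ l \<noteq> 0" for k l
  proof -
    have "(X ** transpose X) $ k $ l \<noteq> 0 \<or> (transpose X ** X) $ k $ l \<noteq> 0"
      using nz by auto
    then show ?thesis
    proof
      assume "(X ** transpose X) $ k $ l \<noteq> 0"
      then obtain j where "X $ k $ j \<noteq> 0" "X $ l $ j \<noteq> 0"
        by (auto simp: matrix_matrix_mult_def transpose_def elim!: sum.not_neutral_contains_not_neutral)
      then show ?thesis using X by (meson cong_sym cong_trans)
    next
      assume "(transpose X ** X) $ k $ l \<noteq> 0"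
      then obtain j where "X $ j $ k \<noteq> 0" "X $ j $ l \<noteq> 0"
        by (auto simp: matrix_matrix_mult_def transpose_def elim!: sum.not_neutral_contains_not_neutral)
      then have "[d k + i = d l + i] (mod int m)" using X by (meson cong_sym cong_trans)
      then show ?thesis by (simp add: cong_add_rcancel)
    qed
  qed
  have tr: "trace ?M = 0"
    using trace_mul_sym[of X "transpose X"] by (simp add: trace_sub)
  have 1: "tensor_inner (deriv_act ?M (pull_bracket br u)) (pull_bracket br u) = e * (u \<bullet> (u ** ?M))"
  proof (rule frame_energy_first_variation[OF br_bilinear _ tr])
    show "det u \<noteq> 0" using iu invertible_det_nz by blast
    fix t assume nz: "det (u ** (mat 1 + t *\<^sub>R ?M)) \<noteq> 0"
    let ?N = "mat 1 + t *\<^sub>R ?M"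
    have "column l (u ** ?N) \<in> h (d l)" for l
    proof -
      have "column l (u ** ?N) = u *v column l ?N"
        by (simp add: vec_eq_iff column_def matrix_matrix_mult_def matrix_vector_mult_def)
      also have "\<dots> \<in> h (d l)"
      proof (rule frame_image[OF cu])
        fix k assume nz: "column l ?N $ k \<noteq> 0"
        show "[d k = d l] (mod int m)"
        proof (cases "k = l")
          case False
          then have "?M $ k $ l \<noteq> 0" using nz by (auto simp: column_def mat_def)
          then show ?thesis by (rule M)
        qed simp
      qed
      finally show ?thesis .
    qed
    then show "frame_energy br e u \<le> frame_energy br e (u ** ?N)"
      using nz by (intro min) (auto simp: frames_def invertible_det_nz)
  qed
  have 2: "u \<bullet> (u ** ?M) = (u ** X) \<bullet> (u ** X) - (u ** transpose X) \<bullet> (u ** transpose X)"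
  proof -
    have a: "(u ** Y) \<bullet> (u ** Y) = u \<bullet> (u ** (Y ** transpose Y))" for Y :: "real^'n^'n"
    proof -
      have "(u ** Y) \<bullet> (u ** Y) = trace (transpose Y ** (transpose u ** u ** Y))"
        by (simp add: inner_matrix_eq_trace matrix_transpose_mul matrix_mul_assoc)
      also have "\<dots> = trace ((transpose u ** u ** Y) ** transpose Y)" by (rule trace_mul_sym)
      finally show ?thesis by (simp add: inner_matrix_eq_trace matrix_mul_assoc)
    qed
    show ?thesis
      using a[of X] a[of "transpose X"] by (simp add: matrix_diff_ldistrib inner_diff_right)
  qed
  show ?thesis
    using tensor_inner_commutator_transpose[OF bilinear_pull_bracket[OF br_bilinear], of X u]
      frame_ad_derivation[OF iu, of y] 1 2 unfolding X_def by simp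
qed

section \<open>Existence of energy-minimising frames\<close>

lemma frame_minimum_exists_pos:
  assumes d: "\<And>k. d k \<in> {0..<int m}" and u0: "u0 \<in> frames d" and e: "0 < e"
  obtains u where "u \<in> frames d" "\<And>v. v \<in> frames d \<Longrightarrow> frame_energy br e u \<le> frame_energy br e v"
proof -
  let ?E = "frame_energy br e"
  let ?c = "?E u0"
  \<comment> \<open>This contains every frame of energy at most \<open>?c\<close>. The bound on
    \<open>inverse ((det u)^2)\<close> is multiplied out, which gives a closed condition that still
    excludes \<open>det u = 0\<close>.\<close>
  let ?K = "{u. (\<forall>k. column k u \<in> h (d k)) \<and> e * (u \<bullet> u) \<le> ?c \<and> 1 \<le> ?c * (det u)\<^sup>2}"
  have Kdet: "det u \<noteq> 0" if "u \<in> ?K" for u using that by auto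
  have inK: "v \<in> ?K" if "v \<in> frames d" "?E v \<le> ?c" for v
  proof -
    have dv: "det v \<noteq> 0" using that(1) by (auto simp: frames_def invertible_det_nz)
    have "e * (v \<bullet> v) \<le> ?c" "inverse ((det v)\<^sup>2) \<le> ?c"
      using that(2) tensor_inner_self_nonneg[of "pull_bracket br v"] e
      unfolding frame_energy_def
      by (smt (verit) inner_ge_zero inverse_nonnegative_iff_nonnegative mult_nonneg_nonneg zero_le_power2)+
    moreover have "1 \<le> ?c * (det v)\<^sup>2"
    proof -
      have "inverse ((det v)\<^sup>2) * (det v)\<^sup>2 \<le> ?c * (det v)\<^sup>2"
        by (rule mult_right_mono) (use calculation in auto)
      then show ?thesis using dv by simp
    qed
    ultimately show ?thesis using that(1) by (auto simp: frames_def)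
  qed
  have det_cont: "continuous_on UNIV (det :: real^'n^'n \<Rightarrow> real)"
    unfolding continuous_on_def by (auto intro!: tendsto_intros)
  have "compact ?K"
  proof -
    have "bounded ?K"
    proof (rule boundedI[of _ "sqrt (?c / e)"])
      fix u assume "u \<in> ?K"
      then have "e * (norm u)\<^sup>2 \<le> ?c" by (simp add: dot_square_norm)
      then have "(norm u)\<^sup>2 \<le> ?c / e" using e by (simp add: field_simps)
      then show "norm u \<le> sqrt (?c / e)" by (simp add: real_le_rsqrt)
    qed
    moreover have "closed ?K"
    proof -
      have c: "continuous_on UNIV (column k :: real^'n^'n \<Rightarrow> real^'n)" for k
        unfolding column_def by (intro continuous_intros)
      have "closed {u. column k u \<in> h (d k)}" for k
        using continuous_closed_vimage[OF closed_subspace[OF h_subspace[of "d k"]], of "column k"]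
          c[of k] by (simp add: vimage_def continuous_on_eq_continuous_at)
      then have "closed {u. \<forall>k. column k u \<in> h (d k)}" by (simp add: closed_Collect_all)
      moreover have "closed {u :: real^'n^'n. e * (u \<bullet> u) \<le> ?c}"
        by (intro closed_Collect_le continuous_intros)
      moreover have "closed {u :: real^'n^'n. 1 \<le> ?c * (det u)\<^sup>2}"
        by (intro closed_Collect_le continuous_intros det_cont)
      ultimately show ?thesis by (simp add: closed_Collect_conj)
    qed
    ultimately show ?thesis by (simp add: compact_eq_bounded_closed)
  qed
  moreover have "u0 \<in> ?K" using inK[OF u0] by simp
  moreover have "continuous_on ?K ?E"
    unfolding continuous_on_def
    by (intro ballI tendsto_frame_energy br_bilinear tendsto_ident_at Kdet)
  ultimately obtain u where u: "u \<in> ?K" "\<forall>v\<in>?K. ?E u \<le> ?E v"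
    using continuous_attains_inf[of ?K ?E] by blast
  show ?thesis
  proof (rule that)
    show "u \<in> frames d" using u(1) Kdet[OF u(1)] by (auto simp: frames_def invertible_det_nz)
    fix v assume v: "v \<in> frames d"
    show "?E u \<le> ?E v"
    proof (cases "?E v \<le> ?c")
      case True then show ?thesis using inK[OF v] u(2) by blast
    next
      case False
      then show ?thesis using u(2) \<open>u0 \<in> ?K\<close> by fastforce
    qed
  qed
qed


lemma frame_energy_mono:
  "0 \<le> e \<Longrightarrow> e \<le> e' \<Longrightarrow> frame_energy br e u \<le> frame_energy br e' u"
  unfolding frame_energy_def by (simp add: mult_right_mono)

lemma frame_energy_bounds:
  assumes "0 \<le> e"
  shows "tensor_inner (pull_bracket br u) (pull_bracket br u) \<le> frame_energy br e u"
    and "inverse ((det u)\<^sup>2) \<le> frame_energy br e u"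
  using assms tensor_inner_self_nonneg[of "pull_bracket br u"] unfolding frame_energy_def
  by (smt (verit) inner_ge_zero inverse_nonnegative_iff_nonnegative mult_nonneg_nonneg zero_le_power2)+

text \<open>If minimising frames \<open>u\<close> escape to infinity, the range of a limit \<open>U\<close> of the normalised frames
  \<open>u / norm u\<close> is a nonzero abelian ideal: it is abelian since the pulled back brackets are bounded, and
  it is an ideal since \<open>norm (u ** transpose X) \<le> norm (u ** X)\<close> for \<open>X = frame_ad u y\<close>.\<close>

lemma frame_minima_bounded:
  assumes d: "\<And>k. d k \<in> {0..<int m}" and u0: "u0 \<in> frames d"
    and e: "\<And>k::nat. 0 < e k" "\<And>k. e k \<le> 1" and v: "\<And>k. v k \<in> frames d"
    and min: "\<And>k w. w \<in> frames d \<Longrightarrow> frame_energy br (e k) (v k) \<le> frame_energy br (e k) w"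
    and large: "\<And>k. norm (v k) > real k"
  shows False
proof -
  let ?c = "frame_energy br 1 u0"
  let ?w = "\<lambda>k. pull_bracket br (v k)"
  have inv: "invertible (v k)" for k using v by (simp add: frames_def)
  have npos: "norm (v k) > 0" for k using large[of k] by linarith
  have E: "frame_energy br (e k) (v k) \<le> ?c" for k
    using min[OF u0, of k] frame_energy_mono[of "e k" 1 u0] e(1)[of k] e(2)[of k] by linarith
  define n where "n k = (1 / norm (v k)) *\<^sub>R v k" for k
  have n1: "norm (n k) = 1" for k using npos[of k] by (simp add: n_def)
  have vn: "v k = norm (v k) *\<^sub>R n k" for k using npos[of k] by (simp add: n_def)
  have "bounded (range n)" using n1 by (auto intro!: boundedI[of _ 1])
  then obtain U r where r: "strict_mono (r::nat \<Rightarrow> nat)" and U: "(n \<circ> r) \<longlonglongrightarrow> U"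
    using bounded_imp_convergent_subsequence by blast
  have nU: "norm U = 1"
    using tendsto_norm[OF U] n1 by (simp add: o_def LIMSEQ_const_iff)
  have inv0: "(\<lambda>k. 1 / norm (v k)) \<longlonglongrightarrow> 0"
  proof (rule tendsto_sandwich[of "\<lambda>_. 0" _ _ "\<lambda>k. 1 / real k"])
    show "\<forall>\<^sub>F k in sequentially. 1 / norm (v k) \<le> 1 / real k"
      using eventually_gt_at_top[of 0]
      by eventually_elim (use large in \<open>auto intro!: divide_left_mono mult_pos_pos npos simp: less_imp_le\<close>)
    show "(\<lambda>k. 1 / real k) \<longlonglongrightarrow> 0" by (rule lim_1_over_n)
  qed auto
  have abel0: "br (U *v axis i 1) (U *v axis j 1) = 0" for i j
  proof -
    \<comment> \<open>Two factors \<open>1 / norm (v k)\<close> appear on the left and one is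
      absorbed in \<open>n k\<close>. The remaining one tends to 0 while the energy bounds
      \<open>?w k\<close>.\<close>
    have eq: "br (n k *v a) (n k *v b) = (1 / norm (v k)) *\<^sub>R (n k *v ?w k a b)" for k a b
    proof -
      have "v k *v ?w k a b = br (v k *v a) (v k *v b)"
        by (simp add: pull_bracket_def matrix_vector_cancel[OF inv])
      then show ?thesis
        by (simp add: n_def br_simps scaleR_matrix_vector_assoc[symmetric])
    qed
    have bd: "norm (?w k (axis i 1) (axis j 1)) \<le> sqrt ?c" for k
    proof (rule real_le_rsqrt)
      show "(norm (?w k (axis i 1) (axis j 1)))\<^sup>2 \<le> ?c"
        using norm_le_tensor_inner[of "?w k" i j] frame_energy_bounds(1)[of "e k" "v k"] E[of k] e(1)[of k]
        by linarith
    qed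
    have "(\<lambda>k. ((1 / norm (v k)) *\<^sub>R ?w k (axis i 1) (axis j 1))) \<longlonglongrightarrow> 0"
    proof (rule Lim_null_comparison)
      show "\<forall>\<^sub>F k in sequentially.
          norm ((1 / norm (v k)) *\<^sub>R ?w k (axis i 1) (axis j 1)) \<le> (1 / norm (v k)) * sqrt ?c"
        using bd npos by (auto intro!: always_eventually divide_right_mono simp: less_imp_le)
      show "(\<lambda>k. (1 / norm (v k)) * sqrt ?c) \<longlonglongrightarrow> 0"
        using tendsto_mult_left_zero[OF inv0] .
    qed
    then have z: "(\<lambda>k. (1 / norm (v (r k))) *\<^sub>R ?w (r k) (axis i 1) (axis j 1)) \<longlonglongrightarrow> 0"
      using LIMSEQ_subseq_LIMSEQ[OF _ r] by (fastforce simp: o_def)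
    have "(\<lambda>k. n (r k) *v ((1 / norm (v (r k))) *\<^sub>R ?w (r k) (axis i 1) (axis j 1))) \<longlonglongrightarrow> U *v 0"
      by (intro tendsto_matrix_vector_mult z U[unfolded o_def])
    then have "(\<lambda>k. br (n (r k) *v axis i 1) (n (r k) *v axis j 1)) \<longlonglongrightarrow> 0"
      by (simp add: eq matrix_vector_mult_scaleR)
    moreover have "(\<lambda>k. br (n (r k) *v axis i 1) (n (r k) *v axis j 1)) \<longlonglongrightarrow> br (U *v axis i 1) (U *v axis j 1)"
      by (intro bounded_bilinear.tendsto[OF br_bilinear[unfolded bilinear_conv_bounded_bilinear]]
          tendsto_matrix_vector_mult U[unfolded o_def] tendsto_const)
    ultimately show ?thesis by (rule LIMSEQ_unique[symmetric])
  qed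
  have abel: "br (U *v a) (U *v b) = 0" for a b
  proof -
    have bil: "bilinear (\<lambda>a b. br (U *v a) (U *v b))"
      by (subst bilinear_def) (auto intro!: linearI simp: br_simps algebra_simps)
    show ?thesis
      using bilinear_expand_left[OF bil, of a b] bilinear_expand_right[OF bil, of _ b] abel0 by simp
  qed
  have ideal_hom: "br y x \<in> range ((*v) U)" if y: "y \<in> h i" and x: "x \<in> range ((*v) U)" for y x i
  proof -
    let ?X = "\<lambda>k. frame_ad (v k) y"
    \<comment> \<open>Multiplying by \<open>transpose (v k)\<close> on the right gives
      \<open>adm y n n^T = n Y\<close>. Since \<open>X v^T\<close> and its transpose
      \<open>v X^T\<close> have equal norm, the minimality estimate bounds \<open>Y\<close> by
      \<open>adm y ** n\<close>; a limit of \<open>Y\<close> then shows that \<open>adm y\<close>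
      maps the range of \<open>U U^T\<close>, which is that of \<open>U\<close>, into the range of
      \<open>U\<close>.\<close>
    define Y where "Y k = (1 / norm (v k)) *\<^sub>R (?X k ** transpose (v k))" for k
    have conj: "v k ** ?X k = adm y ** v k" for k by (rule frame_ad_conj[OF inv])
    have eq: "adm y ** (n k ** transpose (n k)) = n k ** Y k" for k
    proof -
      have "v k ** (?X k ** transpose (v k)) = adm y ** v k ** transpose (v k)"
        by (simp add: matrix_mul_assoc conj)
      then show ?thesis
        by (simp add: n_def Y_def matrix_scaleR_left matrix_scaleR_right transpose_scalar matrix_mul_assoc)
    qed
    have Yb: "norm (Y k) \<le> norm (adm y ** n k)" for k
    proof -
      let ?A = "v k ** ?X k" and ?B = "v k ** transpose (?X k)"
      have "0 \<le> e k * (?A \<bullet> ?A - ?B \<bullet> ?B)"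
        using frame_minimum_identity[OF d v min y, of k] tensor_inner_self_nonneg by metis
      then have "?B \<bullet> ?B \<le> ?A \<bullet> ?A"
        using e(1)[of k] by (metis diff_ge_0_iff_ge zero_le_mult_iff not_less)
      then have "norm ?B \<le> norm ?A" by (simp add: norm_le)
      moreover have "norm (transpose M) = norm M" for M :: "real^'n^'n"
      proof -
        have "transpose M \<bullet> transpose M = M \<bullet> M"
          by (simp add: inner_matrix_eq_trace trace_mul_sym[of M])
        then show ?thesis by (simp add: norm_eq)
      qed
      from this[of ?B] have "norm (?X k ** transpose (v k)) = norm ?B"
        by (simp add: matrix_transpose_mul)
      ultimately have "norm (?X k ** transpose (v k)) \<le> norm (adm y ** v k)" by (simp add: conj)
      then have "(1 / norm (v k)) * norm (?X k ** transpose (v k)) \<le> (1 / norm (v k)) * norm (adm y ** v k)"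
        using npos[of k] by (intro mult_left_mono) auto
      then show ?thesis
        by (simp add: Y_def n_def matrix_scaleR_right)
    qed
    have "(\<lambda>k. adm y ** n (r k)) \<longlonglongrightarrow> adm y ** U"
      by (intro tendsto_matrix_mult tendsto_const U[unfolded o_def])
    then have "bounded (range (\<lambda>k. adm y ** n (r k)))"
      by (rule convergent_imp_bounded)
    then obtain b where "\<And>k. norm (adm y ** n (r k)) \<le> b" by (auto simp: bounded_iff)
    then have "bounded (range (\<lambda>k. Y (r k)))"
      using Yb by (intro boundedI[of _ b]) (auto intro: order_trans)
    then obtain Y' s where s: "strict_mono (s::nat \<Rightarrow> nat)" and Y': "((\<lambda>k. Y (r k)) \<circ> s) \<longlonglongrightarrow> Y'"
      using bounded_imp_convergent_subsequence by blast
    have U': "(\<lambda>k. n (r (s k))) \<longlonglongrightarrow> U"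
      using LIMSEQ_subseq_LIMSEQ[OF U s] by (simp add: o_def)
    have "(\<lambda>k. adm y ** (n (r (s k)) ** transpose (n (r (s k))))) \<longlonglongrightarrow> adm y ** (U ** transpose U)"
      by (intro tendsto_matrix_mult tendsto_transpose tendsto_const U')
    moreover have "(\<lambda>k. n (r (s k)) ** Y (r (s k))) \<longlonglongrightarrow> U ** Y'"
      by (intro tendsto_matrix_mult U' Y'[unfolded o_def])
    ultimately have lim: "adm y ** (U ** transpose U) = U ** Y'"
      unfolding eq by (rule LIMSEQ_unique)
    obtain z where "x = (U ** transpose U) *v z"
      using x range_matrix_mult_transpose[of U] by (metis image_iff)
    then have "br y x = (adm y ** (U ** transpose U)) *v z"
      by (metis adm_apply matrix_vector_mul_assoc)
    then have "br y x = U *v (Y' *v z)"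
      unfolding lim by (simp add: matrix_vector_mul_assoc)
    then show ?thesis by blast
  qed
  have sub: "subspace (range ((*v) U))" by (auto intro!: linear_subspace_image subspace_UNIV)
  have ideal: "br y x \<in> range ((*v) U)" if x: "x \<in> range ((*v) U)" for y x
  proof (induction y rule: h_induct)
    case (add a b) then show ?case using subspace_add[OF sub] by (simp add: br_simps)
  next
    case (homogeneous i y) then show ?case using ideal_hom x by blast
  qed
  have "range ((*v) U) = {0}"
    by (rule abelian_ideal_trivial) (use sub ideal abel in \<open>auto simp: lie_ideal_def\<close>)
  then have "U *v x = 0" for x by blast
  then have "U = 0" by (simp add: matrix_eq)
  then show False using nU by simp
qed

text \<open>Minimisers for \<open>e = 1 / (k + 1)\<close> cannot be unbounded by
  \<open>frame_minima_bounded\<close>, so a subsequence converges. Comparison with \<open>u0\<close>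
  at parameter 1 bounds their determinants away from 0, so the limit is still a frame.\<close>

lemma frame_minimum_exists:
  assumes d: "\<And>k. d k \<in> {0..<int m}" and u0: "u0 \<in> frames d"
  obtains u where "u \<in> frames d" "\<And>v. v \<in> frames d \<Longrightarrow> frame_energy br 0 u \<le> frame_energy br 0 v"
proof -
  define e where "e k = 1 / real (Suc k)" for k :: nat
  have e: "0 < e k" "e k \<le> 1" for k by (auto simp: e_def)
  have "\<exists>u\<in>frames d. \<forall>v\<in>frames d. frame_energy br (e k) u \<le> frame_energy br (e k) v" for k
    using frame_minimum_exists_pos[OF d u0 e(1)] by metis
  then obtain v where v: "\<And>k. v k \<in> frames d"
      and min: "\<And>k w. w \<in> frames d \<Longrightarrow> frame_energy br (e k) (v k) \<le> frame_energy br (e k) w"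
    by metis
  have bdd: "bounded (range v)"
  proof (rule ccontr)
    assume "\<not> bounded (range v)"
    then have "\<forall>k::nat. \<exists>j. norm (v j) > real k"
      by (auto simp: bounded_iff not_le)
    then obtain f where "\<And>k::nat. norm (v (f k)) > real k" by metis
    then show False
      by (intro frame_minima_bounded[OF d u0, of "\<lambda>k. e (f k)" "\<lambda>k. v (f k)"]) (use e v min in auto)
  qed
  then obtain l r where r: "strict_mono (r::nat \<Rightarrow> nat)" and l: "(v \<circ> r) \<longlonglongrightarrow> l"
    using bounded_imp_convergent_subsequence by blast
  let ?c = "frame_energy br 1 u0"
  have "1 \<le> ?c * (det (v k))\<^sup>2" for k
  proof -
    have "inverse ((det (v k))\<^sup>2) \<le> ?c"
      using frame_energy_bounds(2)[of "e k" "v k"] min[OF u0, of k] frame_energy_mono[of "e k" 1 u0] e[of k]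
      by linarith
    then have "inverse ((det (v k))\<^sup>2) * (det (v k))\<^sup>2 \<le> ?c * (det (v k))\<^sup>2"
      by (intro mult_right_mono) auto
    then show ?thesis using v[of k] by (simp add: frames_def invertible_det_nz)
  qed
  moreover have "(\<lambda>k. ?c * (det (v (r k)))\<^sup>2) \<longlonglongrightarrow> ?c * (det l)\<^sup>2"
    by (intro tendsto_intros l[unfolded o_def])
  ultimately have "1 \<le> ?c * (det l)\<^sup>2"
    by (intro LIMSEQ_le_const) auto
  then have detl: "det l \<noteq> 0" by auto
  have coll: "column k l \<in> h (d k)" for k
  proof (rule closed_sequentially[OF closed_subspace[OF h_subspace]])
    show "column k (v (r j)) \<in> h (d k)" for j using v by (simp add: frames_def)
    show "(\<lambda>j. column k (v (r j))) \<longlonglongrightarrow> column k l"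
      unfolding column_def by (intro tendsto_intros l[unfolded o_def])
  qed
  show ?thesis
  proof (rule that)
    show "l \<in> frames d" using detl coll by (simp add: frames_def invertible_det_nz)
    fix w assume w: "w \<in> frames d"
    have "(\<lambda>k. frame_energy br 0 (v (r k))) \<longlonglongrightarrow> frame_energy br 0 l"
      by (intro tendsto_frame_energy br_bilinear l[unfolded o_def] detl)
    moreover have "(\<lambda>k. frame_energy br 0 w + e (r k) * (w \<bullet> w)) \<longlonglongrightarrow> frame_energy br 0 w + 0 * (w \<bullet> w)"
    proof -
      have "e \<longlonglongrightarrow> 0" unfolding e_def by (rule LIMSEQ_Suc[OF lim_1_over_n])
      then have "(\<lambda>k. e (r k)) \<longlonglongrightarrow> 0" using LIMSEQ_subseq_LIMSEQ[OF _ r] by (fastforce simp: o_def)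
      then show ?thesis by (intro tendsto_intros)
    qed
    moreover have "frame_energy br 0 (v (r k)) \<le> frame_energy br 0 w + e (r k) * (w \<bullet> w)" for k
    proof -
      have "frame_energy br (e (r k)) w = frame_energy br 0 w + e (r k) * (w \<bullet> w)"
        by (simp add: frame_energy_def)
      then show ?thesis
        using min[OF w, of "r k"] frame_energy_mono[of 0 "e (r k)" "v (r k)"] e(1)[of "r k"] by linarith
    qed
    ultimately have "frame_energy br 0 l \<le> frame_energy br 0 w + 0 * (w \<bullet> w)"
      by (intro LIMSEQ_le) auto
    then show "frame_energy br 0 l \<le> frame_energy br 0 w" by simp
  qed
qed

end

lemma linear_functional_expand:
  fixes f :: "real^'n \<Rightarrow> real"
  assumes "linear f"
  shows "f x = (\<Sum>k\<in>UNIV. x $ k * f (axis k 1))"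
proof -
  have "f x = f (\<Sum>k\<in>UNIV. x $ k *\<^sub>R axis k 1)"
    using basis_expansion[of x] by (simp add: scalar_mult_eq_scaleR)
  also have "\<dots> = (\<Sum>k\<in>UNIV. x $ k * f (axis k 1))"
    using assms by (simp add: linear_sum linear_scale)
  finally show ?thesis .
qed

lemma trace_scaleR: "trace (c *\<^sub>R (A::real^'n^'n)) = c * trace A"
  by (simp add: trace_def sum_distrib_left)

lemma trace_minus: "trace (- (A::'a::comm_ring_1^'n^'n)) = - trace A"
  by (simp add: trace_def sum_negf)

lemma matrix_mul_minus_left: "(- A) ** B = - (A ** B)" for A :: "'a::ring_1^'n^'m"
  by (vector matrix_matrix_mult_def sum_negf)

lemma matrix_mul_minus_right: "A ** (- B) = - (A ** B)" for A :: "'a::ring_1^'n^'m"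
  by (vector matrix_matrix_mult_def sum_negf)

lemma transpose_add: "transpose (A + B) = transpose A + transpose B"
  by (vector transpose_def)

lemma transpose_diff: "transpose (A - B) = transpose A - transpose B"
  by (vector transpose_def)

lemma transpose_minus: "transpose (- A) = - transpose A"
  by (vector transpose_def)

context graded_lie
begin

section \<open>The adjoint representation, derivations and the Killing form\<close>

lemma adm_add: "adm (x + y) = adm x + adm y"
  and adm_scale: "adm (c *\<^sub>R x) = c *\<^sub>R adm x"
  and adm_minus: "adm (- x) = - adm x"
  by (simp_all add: vec_eq_iff adm_def matrix_def br_simps)

lemma adm_br: "adm (br x y) = adm x ** adm y - adm y ** adm x"
  by (simp add: matrix_eq matrix_vector_mult_diff_rdistrib matrix_vector_mul_assoc[symmetric]
      br_leibniz[of x y])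

lemma adm_inj: "adm x = adm y \<Longrightarrow> x = y"
proof -
  assume "adm x = adm y"
  then have "br (x - y) z = 0" for z by (metis adm_apply br_simps(9) right_minus_eq)
  then have "x - y = 0" by (rule center_trivial)
  then show "x = y" by simp
qed

definition derivation :: "real^'n^'n \<Rightarrow> bool" where
  "derivation D \<longleftrightarrow> (\<forall>x y. D *v br x y = br (D *v x) y + br x (D *v y))"

lemma derivation_adm: "derivation (adm y)"
  by (simp add: derivation_def br_leibniz[of y])

lemma derivation_add: "derivation D \<Longrightarrow> derivation E \<Longrightarrow> derivation (D + E)"
  by (simp add: derivation_def matrix_vector_mult_add_rdistrib br_simps)

lemma derivation_diff: "derivation D \<Longrightarrow> derivation E \<Longrightarrow> derivation (D - E)"
  by (simp add: derivation_def matrix_vector_mult_diff_rdistrib br_simps)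

lemma derivation_commutator: "derivation D \<Longrightarrow> D ** adm a - adm a ** D = adm (D *v a)"
  by (simp add: derivation_def matrix_eq matrix_vector_mult_diff_rdistrib matrix_vector_mul_assoc[symmetric])

definition killing :: "real^'n \<Rightarrow> real^'n \<Rightarrow> real" where
  "killing x y = trace (adm x ** adm y)"

lemma killing_sym: "killing x y = killing y x"
  unfolding killing_def by (rule trace_mul_sym)

lemma linear_trace_adm: "linear (\<lambda>x. trace (M ** adm x))"
  by (intro linearI)
    (simp_all add: adm_add adm_scale matrix_add_ldistrib trace_add matrix_scaleR_right trace_scaleR)

text \<open>The dual of \<^term>\<open>adm y\<close> with respect to the inner product for which the frame \<open>u\<close> is
  orthonormal.\<close>

definition dual_ad :: "real^'n^'n \<Rightarrow> real^'n \<Rightarrow> real^'n^'n" where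
  "dual_ad u y = u ** transpose (frame_ad u y) ** matrix_inv u"

lemma frame_ad_add: "frame_ad u (x + y) = frame_ad u x + frame_ad u y"
  by (simp add: frame_ad_def adm_add matrix_add_ldistrib matrix_add_rdistrib')

lemma dual_ad_add: "dual_ad u (x + y) = dual_ad u x + dual_ad u y"
  by (simp add: dual_ad_def frame_ad_add transpose_add matrix_add_ldistrib matrix_add_rdistrib')

lemma dual_ad_scale: "dual_ad u (c *\<^sub>R x) = c *\<^sub>R dual_ad u x"
  by (simp add: dual_ad_def frame_ad_def adm_scale transpose_scalar matrix_scaleR_left matrix_scaleR_right)

lemma derivation_of_deriv_act:
  assumes u: "invertible u" and Z: "\<And>a b. deriv_act Z (pull_bracket br u) a b = 0"
  shows "derivation (u ** Z ** matrix_inv u)"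
  unfolding derivation_def
proof (intro allI)
  fix p q
  let ?a = "matrix_inv u *v p" and ?b = "matrix_inv u *v q"
  have "Z *v pull_bracket br u ?a ?b = pull_bracket br u (Z *v ?a) ?b + pull_bracket br u ?a (Z *v ?b)"
    using Z[of ?a ?b] unfolding deriv_act_def by (simp only: diff_diff_eq right_minus_eq)
  then have "u *v (Z *v (matrix_inv u *v br p q))
      = u *v (matrix_inv u *v br (u *v (Z *v ?a)) q + matrix_inv u *v br p (u *v (Z *v ?b)))"
    by (simp add: pull_bracket_def matrix_vector_cancel[OF u])
  then show "(u ** Z ** matrix_inv u) *v br p q
      = br ((u ** Z ** matrix_inv u) *v p) q + br p ((u ** Z ** matrix_inv u) *v q)"
    by (simp add: matrix_vector_right_distrib matrix_vector_cancel[OF u] matrix_vector_mul_assoc[symmetric])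
qed

text \<open>For \<open>e = 0\<close> the right side of \<open>frame_minimum_identity\<close> is 0,
  so the transpose of \<open>frame_ad u y\<close> annihilates the pulled back bracket for
  homogeneous \<open>y\<close>; additivity gives all \<open>y\<close>.\<close>

lemma minimal_frame:
  obtains d u where "\<And>k. d k \<in> {0..<int m}" "u \<in> frames d" "\<And>y. derivation (dual_ad u y)"
proof -
  obtain d u0 where d: "\<And>k. d k \<in> {0..<int m}" and u0: "u0 \<in> frames d"
    by (rule frame_exists) blast
  obtain u where u: "u \<in> frames d"
      and min: "\<And>v. v \<in> frames d \<Longrightarrow> frame_energy br 0 u \<le> frame_energy br 0 v"
    by (rule frame_minimum_exists[OF d u0]) blast
  have iu: "invertible u" using u by (simp add: frames_def)
  have "derivation (dual_ad u y)" for y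
  proof (induction y rule: h_induct)
    case (add x y)
    then show ?case by (simp add: dual_ad_add derivation_add)
  next
    case (homogeneous i y)
    show ?case
      unfolding dual_ad_def
    proof (rule derivation_of_deriv_act[OF iu])
      fix a b
      show "deriv_act (transpose (frame_ad u y)) (pull_bracket br u) a b = 0"
        using frame_minimum_identity[OF d u min homogeneous]
        by (intro tensor_inner_self_eq_0 bilinear_deriv_act bilinear_pull_bracket br_bilinear) simp
    qed
  qed
  then show ?thesis using that d u by blast
qed

text \<open>The source of all positivity: pairing \<open>adm y\<close> with its dual under the trace
  gives a squared norm, which vanishes only for \<open>y = 0\<close>.\<close>

lemma trace_adm_dual_ad:
  assumes u: "invertible u"
  shows "trace (adm y ** dual_ad u y) = frame_ad u y \<bullet> frame_ad u y"
proof -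
  let ?X = "frame_ad u y"
  have "trace (adm y ** dual_ad u y) = trace (adm y ** u ** (transpose ?X ** matrix_inv u))"
    by (simp add: dual_ad_def matrix_mul_assoc)
  also have "\<dots> = trace ((transpose ?X ** matrix_inv u) ** (u ** ?X))"
    unfolding frame_ad_conj[OF u] by (rule trace_mul_sym)
  also have "\<dots> = trace (transpose ?X ** (matrix_inv u ** u) ** ?X)"
    by (simp only: matrix_mul_assoc)
  finally show ?thesis
    by (simp add: matrix_inv_left[OF u] inner_matrix_eq_trace)
qed

lemma frame_ad_eq_0:
  assumes u: "invertible u" and 0: "frame_ad u y = 0" shows "y = 0"
proof (rule center_trivial)
  fix x
  have "adm y ** u = 0" using frame_ad_conj[OF u, of y] 0 by simp
  then have "(adm y ** u) *v (matrix_inv u *v x) = 0" by simp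
  then show "br y x = 0" by (simp add: matrix_vector_mul_assoc[symmetric] matrix_vector_cancel[OF u])
qed

text \<open>For \<open>b = E a\<close> one has \<open>[E, ad a] = ad b\<close>. With
  \<open>D\<close> the dual of \<open>ad b\<close>, the trace of \<open>ad b D\<close> equals minus
  that of \<open>E [D, ad a] = E ad (D a)\<close>, which is 0 by hypothesis; but it is a squared
  norm. The lemma yields both nondegeneracy, for \<open>E = ad y\<close>, and innerness, for
  \<open>E = D - ad y\<close>.\<close>

lemma derivation_orthogonal_adm:
  assumes E: "derivation E" and 0: "\<And>x. trace (E ** adm x) = 0"
  shows "E = 0"
proof -
  obtain d u where u: "u \<in> frames d" and der: "\<And>y. derivation (dual_ad u y)"
    by (rule minimal_frame) blast
  have iu: "invertible u" using u by (simp add: frames_def)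
  have "E *v a = 0" for a
  proof -
    let ?b = "E *v a"
    let ?D = "dual_ad u ?b"
    have "trace (adm ?b ** ?D) = trace (E ** adm a ** ?D) - trace (adm a ** E ** ?D)"
      by (simp add: derivation_commutator[OF E, symmetric] matrix_diff_rdistrib trace_sub)
    also have "trace (adm a ** E ** ?D) = trace (E ** ?D ** adm a)"
      by (simp only: matrix_mul_assoc[symmetric] trace_mul_sym[of "adm a"])
    finally have "trace (adm ?b ** ?D) = - trace (E ** (?D ** adm a - adm a ** ?D))"
      by (simp add: matrix_diff_ldistrib trace_sub matrix_mul_assoc)
    then have "trace (adm ?b ** ?D) = 0"
      by (simp add: derivation_commutator[OF der] 0)
    then have "frame_ad u ?b = 0" by (simp add: trace_adm_dual_ad[OF iu])
    then show ?thesis by (rule frame_ad_eq_0[OF iu])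
  qed
  then show ?thesis by (simp add: matrix_eq)
qed

lemma killing_nondegenerate:
  assumes "\<And>x. killing y x = 0" shows "y = 0"
proof -
  have "adm y = 0"
    by (rule derivation_orthogonal_adm[OF derivation_adm]) (use assms in \<open>simp add: killing_def\<close>)
  then show ?thesis by (metis adm_apply center_trivial matrix_vector_mult_0)
qed

text \<open>Nondegeneracy represents the functional \<open>x \<mapsto> trace (D ad x)\<close> as
  \<open>killing y\<close> for some \<open>y\<close>; then \<open>D - ad y\<close> is a derivation
  orthogonal to every \<open>ad x\<close>. \<open>K\<close> is the Gram matrix of the Killing
  form.\<close>

lemma derivation_inner:
  assumes D: "derivation D"
  obtains y where "D = adm y"
proof -
  define K where "K = ((\<chi> i j. killing (axis i 1) (axis j 1)) :: real^'n^'n)"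
  have K: "(K *v y) $ i = killing (axis i 1) y" for y i
    using linear_functional_expand[OF linear_trace_adm[of "adm (axis i 1)"], of y]
    by (simp add: matrix_vector_mult_def killing_def mult.commute K_def)
  have "y = 0" if "K *v y = 0" for y
  proof (rule killing_nondegenerate)
    fix x
    have "killing y (axis i 1) = 0" for i using K[of y i] that by (simp add: killing_sym[of y])
    then show "killing y x = 0"
      using linear_functional_expand[OF linear_trace_adm[of "adm y"], of x]
      by (simp add: killing_def[symmetric])
  qed
  then have iK: "invertible K"
    using matrix_left_invertible_ker[of K] invertible_left_inverse by blast
  define z where "z = (\<chi> i. trace (D ** adm (axis i 1)))"
  define y where "y = matrix_inv K *v z"
  have Ky: "K *v y = z"
    by (simp add: y_def matrix_vector_cancel[OF iK])
  have 1: "trace (adm y ** adm (axis i 1)) = trace (D ** adm (axis i 1))" for i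
  proof -
    have "killing y (axis i 1) = z $ i" using K[of y i] unfolding Ky killing_sym[of y] by simp
    then show ?thesis by (simp add: killing_def z_def)
  qed
  have "trace (D ** adm x) = trace (adm y ** adm x)" for x
    using linear_functional_expand[OF linear_trace_adm[of D], of x]
      linear_functional_expand[OF linear_trace_adm[of "adm y"], of x] 1 by simp
  then have "D - adm y = 0"
    by (intro derivation_orthogonal_adm derivation_diff D derivation_adm)
      (simp add: matrix_diff_rdistrib trace_sub)
  then show ?thesis using that by simp
qed

text \<open>Each component of \<open>z\<close> of degree other than \<open>i\<close> would
  contribute to \<open>br z x\<close> in a degree other than \<open>i + j\<close>; it therefore acts
  as 0 and is central.\<close>

lemma ad_degree_imp_degree:
  assumes z: "\<And>j x. x \<in> h j \<Longrightarrow> br z x \<in> h (i + j)"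
  shows "z \<in> h i"
proof -
  let ?I = "{0..<int m}"
  have mi: "int m > 0" using m_pos by simp
  obtain f where f: "\<And>l. f l \<in> h l" "z = (\<Sum>l\<in>?I. f l)"
    by (rule h_decompE[of z]) blast
  have zero: "f l = 0" if l: "l \<in> ?I" "l \<noteq> i mod int m" for l
  proof (rule center_trivial)
    fix x
    show "br (f l) x = 0"
    proof (induction x rule: h_induct)
      case (add x y) then show ?case by (simp add: br_simps)
    next
      case (homogeneous j x)
      \<comment> \<open>The component of \<open>br z x\<close> in degree \<open>k\<close> comes from
        the component of \<open>z\<close> in degree \<open>k - j\<close>, reduced to its
        representative modulo \<open>m\<close>.\<close>
      define g where "g k = br (f ((k - j) mod int m)) x" for k
      have g: "g k \<in> h k" for k
      proof -
        have "g k \<in> h ((k - j) mod int m + j)" unfolding g_def by (rule h_br[OF f(1) homogeneous])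
        also have "h ((k - j) mod int m + j) = h k" by (rule h_cong) (simp add: cong_def mod_simps)
        finally show ?thesis .
      qed
      have lin: "linear (\<lambda>a. br a x)" using br_bilinear by (simp add: bilinear_def)
      have "br z x = (\<Sum>l\<in>?I. br (f l) x)" unfolding f(2) by (rule linear_sum[OF lin])
      also have "\<dots> = (\<Sum>k\<in>?I. g k)"
        unfolding g_def
        by (rule sum.reindex_bij_witness[of _ "\<lambda>k. (k - j) mod int m" "\<lambda>l. (l + j) mod int m"])
          (use mi in \<open>auto simp: mod_simps\<close>)
      finally have s: "(\<Sum>k\<in>?I. g k) = (\<Sum>k\<in>?I. if k = (i + j) mod int m then br z x else 0)"
        using mi by simp
      have w: "(if k = (i + j) mod int m then br z x else 0) \<in> h k" for k
        using z[OF homogeneous] h_mod[of "i + j"] by (auto simp: subspace_0[OF h_subspace])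
      let ?k = "(l + j) mod int m"
      have kI: "?k \<in> ?I" using mi by simp
      have "?k \<noteq> (i + j) mod int m"
      proof
        assume "?k = (i + j) mod int m"
        then have "[l = i] (mod int m)" by (simp add: cong_def[symmetric] cong_add_rcancel)
        then show False using l by (simp add: cong_def)
      qed
      then have "g ?k = 0" using h_decomp_unique[OF g w s kI] by simp
      moreover have "(?k - j) mod int m = l" using l(1) by (simp add: mod_simps)
      ultimately show ?case by (simp add: g_def)
    qed
  qed
  have "z = (\<Sum>l\<in>?I. if l = i mod int m then f l else 0)"
    unfolding f(2) by (rule sum.cong) (use zero in auto)
  also have "\<dots> = f (i mod int m)" using mi by simp
  finally show ?thesis using f(1)[of "i mod int m"] h_mod[of i] by simp
qed

text \<open>On matrices, \<open>X \<mapsto> - transpose X\<close> is an involutive Lie algebra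
  automorphism. In a minimal frame it preserves the image of \<open>ad\<close>, because the dual of
  \<open>ad y\<close> is a derivation and so inner; it thus descends to an involution
  \<open>s\<close>. Transposition reverses degrees, and \<open>killing x (s x)\<close> is minus a
  squared norm.\<close>

theorem graded_cartan_involution:
  obtains t :: "real^'n^'n" where "t ** t = mat 1"
    "\<And>x y. t *v br x y = br (t *v x) (t *v y)"
    "\<And>i x. x \<in> h i \<Longrightarrow> t *v x \<in> h (- i)"
    "\<And>x. x \<noteq> 0 \<Longrightarrow> killing x (t *v x) < 0"
proof -
  obtain d u where d: "\<And>k. d k \<in> {0..<int m}" and u: "u \<in> frames d"
      and der: "\<And>y. derivation (dual_ad u y)"
    by (rule minimal_frame) blast
  have iu: "invertible u" and cu: "\<And>k. column k u \<in> h (d k)" using u by (simp_all add: frames_def)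
  have "\<forall>y. \<exists>z. adm z = - dual_ad u y"
  proof
    fix y
    obtain x where "dual_ad u y = adm x" by (rule derivation_inner[OF der])
    then have "adm (- x) = - dual_ad u y" by (simp add: adm_minus)
    then show "\<exists>z. adm z = - dual_ad u y" by blast
  qed
  then obtain s where s: "\<And>y. adm (s y) = - dual_ad u y" by metis
  have lin: "linear s"
  proof (rule linearI)
    show "s (x + y) = s x + s y" for x y
      by (rule adm_inj) (simp add: s adm_add dual_ad_add)
    show "s (c *\<^sub>R x) = c *\<^sub>R s x" for c x
      by (rule adm_inj) (simp add: s adm_scale dual_ad_scale)
  qed
  have conj: "frame_ad u (s y) = - transpose (frame_ad u y)" for y
  proof -
    have "frame_ad u (s y) = - (matrix_inv u ** u ** transpose (frame_ad u y) ** (matrix_inv u ** u))"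
      unfolding frame_ad_def[of u "s y"] s dual_ad_def
      by (simp add: matrix_mul_minus_left matrix_mul_minus_right matrix_mul_assoc)
    then show ?thesis by (simp add: matrix_inv_left[OF iu])
  qed
  have recov: "u ** frame_ad u y ** matrix_inv u = adm y" for y
    by (simp add: frame_ad_conj[OF iu] matrix_mul_assoc[symmetric] matrix_inv_right[OF iu])
  have ss: "s (s y) = y" for y
  proof (rule adm_inj)
    show "adm (s (s y)) = adm y"
      unfolding s dual_ad_def conj
      by (simp add: transpose_minus matrix_mul_minus_left matrix_mul_minus_right recov)
  qed
  have fbr: "frame_ad u (br x y) = frame_ad u x ** frame_ad u y - frame_ad u y ** frame_ad u x" for x y
  proof -
    have "frame_ad u a ** frame_ad u b = matrix_inv u ** (adm a ** adm b) ** u" for a b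
    proof -
      have "frame_ad u a ** frame_ad u b = matrix_inv u ** adm a ** (u ** frame_ad u b)"
        by (simp add: frame_ad_def matrix_mul_assoc)
      then show ?thesis by (simp add: frame_ad_conj[OF iu] matrix_mul_assoc)
    qed
    then show ?thesis
      by (simp add: frame_ad_def[of u "br x y"] adm_br matrix_diff_ldistrib matrix_diff_rdistrib)
  qed
  have finj: "x = y" if "frame_ad u x = frame_ad u y" for x y
    using that recov[of x] recov[of y] adm_inj by simp
  have sbr: "s (br x y) = br (s x) (s y)" for x y
    by (rule finj) (simp add: conj fbr transpose_diff matrix_transpose_mul
        matrix_mul_minus_left matrix_mul_minus_right)
  have neg: "killing x (s x) < 0" if "x \<noteq> 0" for x
  proof -
    have "killing x (s x) = - (frame_ad u x \<bullet> frame_ad u x)"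
      by (simp add: killing_def s matrix_mul_minus_right trace_minus trace_adm_dual_ad[OF iu])
    moreover have "frame_ad u x \<noteq> 0" using frame_ad_eq_0[OF iu] that by blast
    ultimately show ?thesis by simp
  qed
  have deg: "s y \<in> h (- i)" if y: "y \<in> h i" for i y
  proof (rule ad_degree_imp_degree)
    fix j x assume x: "x \<in> h j"
    let ?a = "matrix_inv u *v x"
    have ua: "u *v ?a = x" by (simp add: matrix_vector_cancel[OF iu])
    have "u *v (transpose (frame_ad u y) *v ?a) \<in> h (- i + j)"
    proof (rule frame_image[OF cu])
      fix l assume "(transpose (frame_ad u y) *v ?a) $ l \<noteq> 0"
      then have "(\<Sum>k\<in>UNIV. frame_ad u y $ k $ l * ?a $ k) \<noteq> 0"
        unfolding transpose_def matrix_vector_mult_def by (simp only: vec_lambda_beta) simp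
      then obtain k where "frame_ad u y $ k $ l * ?a $ k \<noteq> 0"
        by (rule sum.not_neutral_contains_not_neutral)
      then have k: "frame_ad u y $ k $ l \<noteq> 0" "?a $ k \<noteq> 0" by auto
      have "[d k = j] (mod int m)"
        by (rule frame_coords[OF d u, of ?a]) (use x ua k in auto)
      moreover have "[d k = d l + i] (mod int m)" by (rule frame_ad_degree[OF d u y k(1)])
      ultimately have "[d l + i = j] (mod int m)" by (meson cong_sym cong_trans)
      then have "[d l + i + (- i) = j + (- i)] (mod int m)" by (rule cong_add) simp
      then show "[d l = - i + j] (mod int m)" by simp
    qed
    moreover have "br (s y) x = - (u *v (transpose (frame_ad u y) *v ?a))"
    proof -
      have "br (s y) x = (- dual_ad u y) *v x" by (metis adm_apply s)
      also have "\<dots> = - (dual_ad u y *v x)"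
        by (simp add: vec_eq_iff matrix_vector_mult_def sum_negf)
      finally show ?thesis
        unfolding dual_ad_def by (simp only: matrix_vector_mul_assoc matrix_mul_assoc)
    qed
    ultimately show "br (s y) x \<in> h (- i + j)" by (simp add: subspace_neg[OF h_subspace])
  qed
  have app: "matrix s *v x = s x" for x using lin by (metis matrix_vector_mul(2))
  show ?thesis
  proof (rule that[of "matrix s"])
    show "matrix s ** matrix s = mat 1"
      by (simp add: matrix_eq matrix_vector_mul_assoc[symmetric] app ss)
  qed (auto simp: app sbr deg neg)
qed

end

section \<open>Real-diagonalisable complex matrices\<close>

lemma quadratic_min_linear_term:
  fixes b c :: real
  assumes "\<And>t. 0 \<le> 2 * t * b + t\<^sup>2 * c" shows "b = 0"
proof -
  have "((\<lambda>t. 2 * t * b + t\<^sup>2 * c) has_real_derivative 2 * b) (at 0)"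
    by (auto intro!: derivative_eq_intros)
  then have "2 * b = 0"
    by (rule DERIV_local_min[of _ _ _ 1]) (use assms in auto)
  then show ?thesis by simp
qed

text \<open>Induction on the dimension of \<open>W\<close>: a maximiser of the Rayleigh quotient on \<open>W\<close> is an
  eigenvector, and its orthogonal complement in \<open>W\<close> is invariant.\<close>

lemma selfadjoint_spectral:
  fixes f :: "'a::euclidean_space \<Rightarrow> 'a" and \<beta> :: "'a \<Rightarrow> 'a \<Rightarrow> real"
  assumes \<beta>: "bilinear \<beta>" and sym: "\<And>x y. \<beta> x y = \<beta> y x" and pos: "\<And>x. x \<noteq> 0 \<Longrightarrow> 0 < \<beta> x x"
    and f: "linear f" and sa: "\<And>x y. \<beta> (f x) y = \<beta> x (f y)"
    and W: "subspace W" and inv: "\<And>x. x \<in> W \<Longrightarrow> f x \<in> W"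
  shows "W \<subseteq> span {x \<in> W. \<exists>l. f x = l *\<^sub>R x}"
  using W inv
proof (induction "dim W" arbitrary: W rule: less_induct)
  case less
  note bs = bilinear_ladd[OF \<beta>] bilinear_radd[OF \<beta>] bilinear_lmul[OF \<beta>] bilinear_rmul[OF \<beta>]
    bilinear_lsub[OF \<beta>] bilinear_rsub[OF \<beta>] bilinear_lzero[OF \<beta>] bilinear_rzero[OF \<beta>]
  have bbb: "bounded_bilinear \<beta>" using \<beta> by (simp add: bilinear_conv_bounded_bilinear)
  have bf: "bounded_linear f" using f by (simp add: linear_conv_bounded_linear)
  show ?case
  proof (cases "W \<subseteq> {0}")
    case True
    then show ?thesis using span_zero by blast
  next
    case False
    then obtain w where w: "w \<in> W" "w \<noteq> 0" by auto
    let ?S = "W \<inter> sphere 0 1"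
    have "compact ?S" by (intro closed_Int_compact closed_subspace less.prems(1) compact_sphere)
    moreover have "(1 / norm w) *\<^sub>R w \<in> ?S"
      using w by (simp add: subspace_scale[OF less.prems(1)])
    moreover have nz: "\<beta> x x \<noteq> 0" if "x \<in> ?S" for x
    proof -
      have "x \<noteq> 0" using that by auto
      then show ?thesis using pos[of x] by linarith
    qed
    moreover have "continuous_on ?S (\<lambda>x. \<beta> (f x) x / \<beta> x x)"
      by (intro continuous_intros bounded_bilinear.continuous_on[OF bbb]
          bounded_linear.continuous_on[OF bf])
        (use nz in blast)
    ultimately obtain x where x: "x \<in> ?S" "\<forall>y\<in>?S. \<beta> (f y) y / \<beta> y y \<le> \<beta> (f x) x / \<beta> x x"
      using continuous_attains_sup[of ?S "\<lambda>x. \<beta> (f x) x / \<beta> x x"] by blast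
    have xW: "x \<in> W" and x0: "x \<noteq> 0" using x(1) by auto
    define l where "l = \<beta> (f x) x / \<beta> x x"
    have le: "\<beta> (f y) y \<le> l * \<beta> y y" if "y \<in> W" for y
    proof (cases "y = 0")
      case True then show ?thesis by (simp add: bs linear_0[OF f])
    next
      case False
      let ?y = "(1 / norm y) *\<^sub>R y"
      have "\<beta> (f ?y) ?y / \<beta> ?y ?y \<le> l"
        using x(2) that False unfolding l_def by (auto simp: subspace_scale[OF less.prems(1)])
      then have "\<beta> (f y) y / \<beta> y y \<le> l" using False by (simp add: linear_scale[OF f] bs)
      then show ?thesis using pos[OF False] by (simp add: field_simps)
    qed
    have eig: "f x = l *\<^sub>R x"
    proof -
      let ?d = "f x - l *\<^sub>R x"
      have dW: "?d \<in> W" using less.prems xW by (simp add: subspace_diff subspace_scale)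
      have q0: "l * \<beta> x x - \<beta> (f x) x = 0" using pos[OF x0] by (simp add: l_def)
      \<comment> \<open>\<open>l \<beta>(y, y) - \<beta>(f y, y)\<close> is nonnegative on
        \<open>W\<close> and vanishes at \<open>x\<close>. Moving \<open>x\<close> towards the
        residual \<open>?d\<close> has this number as its linear coefficient, and it equals
        \<open>- \<beta> ?d ?d\<close>.\<close>
      have "l * \<beta> x ?d - \<beta> (f x) ?d = 0"
      proof (rule quadratic_min_linear_term)
        fix t
        have "0 \<le> l * \<beta> (x + t *\<^sub>R ?d) (x + t *\<^sub>R ?d) - \<beta> (f (x + t *\<^sub>R ?d)) (x + t *\<^sub>R ?d)"
          using le[of "x + t *\<^sub>R ?d"] xW dW less.prems(1) by (simp add: subspace_add subspace_scale)
        also have "\<dots> = (l * \<beta> x x - \<beta> (f x) x) + 2 * t * (l * \<beta> x ?d - \<beta> (f x) ?d)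
            + t\<^sup>2 * (l * \<beta> ?d ?d - \<beta> (f ?d) ?d)"
        proof -
          have "\<beta> (f ?d) x = \<beta> (f x) ?d" using sa[of ?d x] sym by simp
          moreover have "\<beta> ?d x = \<beta> x ?d" by (rule sym)
          ultimately show ?thesis
            by (simp only: linear_add[OF f] linear_scale[OF f] bs(1-4) power2_eq_square)
              (simp add: algebra_simps)
        qed
        finally show "0 \<le> 2 * t * (l * \<beta> x ?d - \<beta> (f x) ?d) + t\<^sup>2 * (l * \<beta> ?d ?d - \<beta> (f ?d) ?d)"
          using q0 by simp
      qed
      moreover have "\<beta> ?d ?d = \<beta> (f x) ?d - l * \<beta> x ?d" by (simp only: bs(3,5) real_scaleR_def)
      ultimately have "\<beta> ?d ?d = 0" by simp
      then show ?thesis using pos[of ?d] by (cases "?d = 0") auto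
    qed
    let ?V = "{y \<in> W. \<beta> x y = 0}"
    have sV: "subspace ?V"
      using less.prems(1) by (auto simp: subspace_def bs)
    have iV: "f y \<in> ?V" if "y \<in> ?V" for y
      using that less.prems(2) sa[of x y, symmetric] by (simp add: eig bs)
    have "x \<notin> ?V" using pos[OF x0] by simp
    then have "dim ?V < dim W"
      using xW sV less.prems(1) by (intro dim_psubset) (auto simp: span_eq_iff[THEN iffD2])
    then have IH: "?V \<subseteq> span {y \<in> ?V. \<exists>l. f y = l *\<^sub>R y}"
      using less.hyps[OF _ sV iV] by simp
    have mono: "span {y \<in> ?V. \<exists>l. f y = l *\<^sub>R y} \<subseteq> span {y \<in> W. \<exists>l. f y = l *\<^sub>R y}"
      by (intro span_mono) auto
    show ?thesis
    proof
      fix y assume y: "y \<in> W"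
      let ?c = "\<beta> x y / \<beta> x x"
      have "y - ?c *\<^sub>R x \<in> ?V"
        using y xW less.prems(1) pos[OF x0] by (simp add: subspace_diff subspace_scale bs)
      then have "y - ?c *\<^sub>R x \<in> span {y \<in> W. \<exists>l. f y = l *\<^sub>R y}" using IH mono by blast
      moreover have "x \<in> span {y \<in> W. \<exists>l. f y = l *\<^sub>R y}" using xW eig by (intro span_base) auto
      ultimately have "(y - ?c *\<^sub>R x) + ?c *\<^sub>R x \<in> span {y \<in> W. \<exists>l. f y = l *\<^sub>R y}"
        by (intro span_add span_scale)
      then show "y \<in> span {y \<in> W. \<exists>l. f y = l *\<^sub>R y}" by simp
    qed
  qed
qed

lemma scaleR_eq_smult: "r *\<^sub>R (x::complex^'n) = complex_of_real r *s x"
  by (simp add: vec_eq_iff complex_eq_iff)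

lemma matrix_vector_scaleR: "(A::complex^'n^'m) *v (r *\<^sub>R x) = r *\<^sub>R (A *v x)"
  by (simp add: scaleR_eq_smult vector_scalar_commute)

definition csm :: "complex \<Rightarrow> complex^'n^'m \<Rightarrow> complex^'n^'m" where
  "csm a A = (\<chi> i j. a * A $ i $ j)"

lemma csm_apply: "csm a A *v x = a *s (A *v x)"
  by (simp add: csm_def vec_eq_iff matrix_vector_mult_def sum_distrib_left mult_ac)

lemma bounded_linear_csm: "bounded_linear (\<lambda>a. csm a A)"
  by (simp add: linear_conv_bounded_linear[symmetric])
    (auto intro!: linearI simp: csm_def vec_eq_iff algebra_simps)

text \<open>Diagonalisable over the complex numbers with real eigenvalues. Real spans suffice,
  because the eigenvectors for a fixed \<open>l\<close> already form a complex subspace.\<close>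

definition rdiag :: "complex^'n^'n \<Rightarrow> bool" where
  "rdiag L \<longleftrightarrow> span {x. \<exists>l. L *v x = l *\<^sub>R x} = UNIV"

text \<open>Linearity is over the reals, so that antilinear maps can be compared on eigenvectors
  too.\<close>

lemma rdiag_eqI:
  assumes "rdiag L" "linear f" "linear g" "\<And>l x. L *v x = l *\<^sub>R x \<Longrightarrow> f x = g x"
  shows "f x = g x"
proof -
  have "x \<in> span {x. \<exists>l. L *v x = l *\<^sub>R x}" using assms(1) by (simp add: rdiag_def)
  then show ?thesis by (rule linear_eq_on_span[OF assms(2,3), rotated]) (use assms(4) in auto)
qed

lemma rdiag_matrix_eqI:
  assumes "rdiag L" "\<And>l x. L *v x = l *\<^sub>R x \<Longrightarrow> A *v x = B *v x"
  shows "A = B"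
  unfolding matrix_eq
proof
  fix x
  show "A *v x = B *v x"
    by (rule rdiag_eqI[OF assms(1) matrix_vector_mul_linear matrix_vector_mul_linear assms(2)])
qed

text \<open>Take a complex basis of eigenvectors. By independence, the expansion of an eigenvector
  for \<open>l\<close> uses only basis vectors with eigenvalue \<open>l\<close>, so
  \<open>E k\<close> can be the projection onto those with eigenvalue \<open>k\<close>.\<close>

lemma rdiag_resolution:
  fixes L :: "complex^'n^'n"
  assumes "rdiag L"
  shows "\<exists>(\<Lambda>::real set) E. finite \<Lambda>
    \<and> (\<forall>l x k. L *v x = l *\<^sub>R x \<longrightarrow> E k *v x = (if k = l then x else 0))
    \<and> (\<forall>l x. L *v x = l *\<^sub>R x \<longrightarrow> x \<noteq> 0 \<longrightarrow> l \<in> \<Lambda>)"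
proof -
  let ?S = "{x. x \<noteq> 0 \<and> (\<exists>l. L *v x = l *\<^sub>R x)}"
  obtain B where B: "B \<subseteq> ?S" "vec.independent B" "?S \<subseteq> vec.span B"
    by (rule vec.maximal_independent_subset)
  have fin: "finite B" using B(2) by (rule vec.finiteI_independent)
  have "\<forall>b\<in>B. \<exists>l. L *v b = l *\<^sub>R b" using B(1) by auto
  then obtain ev where ev: "\<And>b. b \<in> B \<Longrightarrow> L *v b = ev b *\<^sub>R b" by metis
  have coef: "\<exists>c. x = (\<Sum>b\<in>B. c b *s b) \<and> (\<forall>b\<in>B. c b \<noteq> 0 \<longrightarrow> ev b = l)" if x: "L *v x = l *\<^sub>R x" for x l
  proof -
    have "x \<in> vec.span B" using B(3) x vec.span_zero by (cases "x = 0") auto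
    then obtain c where c: "x = (\<Sum>b\<in>B. c b *s b)" using vec.span_finite[OF fin] by auto
    have "(\<Sum>b\<in>B. (c b * (of_real (ev b) - of_real l)) *s b) = L *v x - l *\<^sub>R x"
    proof -
      have "L *v x = (\<Sum>b\<in>B. L *v (c b *s b))"
        unfolding c by (rule linear_sum[OF matrix_vector_mul_linear])
      also have "\<dots> = (\<Sum>b\<in>B. (c b * of_real (ev b)) *s b)"
        by (intro sum.cong) (auto simp: vector_scalar_commute ev scaleR_eq_smult vector_smult_assoc)
      finally have 1: "L *v x = (\<Sum>b\<in>B. (c b * of_real (ev b)) *s b)" .
      have 2: "l *\<^sub>R x = (\<Sum>b\<in>B. (c b * of_real l) *s b)"
        unfolding c scaleR_eq_smult vec.scale_sum_right by (simp add: vector_smult_assoc mult.commute)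
      show ?thesis
        unfolding 1 2 sum_subtractf[symmetric]
        by (intro sum.cong refl) (simp add: right_diff_distrib vector_sub_rdistrib)
    qed
    then have s0: "(\<Sum>b\<in>B. (c b * (of_real (ev b) - of_real l)) *s b) = 0" using x by simp
    have "\<forall>b\<in>B. c b * (of_real (ev b) - of_real l) = 0"
    proof (rule ccontr)
      assume "\<not> ?thesis"
      then have "vec.dependent B"
        unfolding vec.dependent_finite[OF fin]
        by (intro exI[of _ "\<lambda>b. c b * (of_real (ev b) - of_real l)"] conjI s0) simp
      then show False using B(2) by simp
    qed
    then have "\<forall>b\<in>B. c b \<noteq> 0 \<longrightarrow> ev b = l" by auto
    with c show ?thesis by blast
  qed
  have "\<forall>k. \<exists>g. Vector_Spaces.linear (*s) (*s) g \<and> (\<forall>b\<in>B. g b = (if k = ev b then b else 0))"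
    by (rule allI) (rule vec.linear_independent_extend[OF B(2)])
  then obtain g where g: "\<And>k. Vector_Spaces.linear (*s) (*s) (g k)"
      "\<And>k b. b \<in> B \<Longrightarrow> g k b = (if k = ev b then b else 0)"
    by metis
  show ?thesis
  proof (rule exI[of _ "ev ` B"], rule exI[of _ "\<lambda>k. matrix (g k)"], intro conjI allI impI)
    show "finite (ev ` B)" using fin by simp
    fix l x k assume x: "L *v x = l *\<^sub>R x"
    obtain c where c: "x = (\<Sum>b\<in>B. c b *s b)" "\<forall>b\<in>B. c b \<noteq> 0 \<longrightarrow> ev b = l" using coef[OF x] by blast
    have "matrix (g k) *v x = (\<Sum>b\<in>B. matrix (g k) *v (c b *s b))"
      unfolding c(1) by (rule linear_sum[OF matrix_vector_mul_linear])
    also have "\<dots> = (\<Sum>b\<in>B. c b *s (if k = ev b then b else 0))"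
      by (intro sum.cong) (auto simp: vector_scalar_commute matrix_works[OF g(1)] g(2))
    also have "\<dots> = (\<Sum>b\<in>B. if k = l then c b *s b else 0)"
      by (intro sum.cong) (use c(2) in auto)
    finally show "matrix (g k) *v x = (if k = l then x else 0)"
      using c(1) by simp
  next
    fix l x assume x: "L *v x = l *\<^sub>R x" and nz: "x \<noteq> 0"
    obtain c where c: "x = (\<Sum>b\<in>B. c b *s b)" "\<forall>b\<in>B. c b \<noteq> 0 \<longrightarrow> ev b = l" using coef[OF x] by blast
    have "\<exists>b\<in>B. c b \<noteq> 0"
    proof (rule ccontr)
      assume "\<not> ?thesis"
      then have "x = 0" unfolding c(1) by (intro sum.neutral) auto
      then show False using nz by simp
    qed
    then show "l \<in> ev ` B" using c(2) by auto
  qed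
qed

text \<open>The functional calculus \<open>q(L)\<close>, prescribed on eigenvectors only; for
  \<open>rdiag L\<close> such a matrix exists and is unique.\<close>

definition spec_map :: "complex^'n^'n \<Rightarrow> (real \<Rightarrow> complex) \<Rightarrow> complex^'n^'n" where
  "spec_map L q = (SOME M. \<forall>l x. L *v x = l *\<^sub>R x \<longrightarrow> M *v x = q l *s x)"

definition eigvals :: "complex^'n^'n \<Rightarrow> real set" where
  "eigvals L = {l. \<exists>x. x \<noteq> 0 \<and> L *v x = l *\<^sub>R x}"

definition eigproj :: "complex^'n^'n \<Rightarrow> real \<Rightarrow> complex^'n^'n" where
  "eigproj L k = spec_map L (\<lambda>l. if l = k then 1 else 0)"

lemma sum_csm_apply: "(\<Sum>k\<in>A. csm (q k) (E k)) *v x = (\<Sum>k\<in>A. q k *s (E k *v x))"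
proof (cases "finite A")
  case True
  then show ?thesis
    by induction (simp_all add: matrix_vector_mult_add_rdistrib csm_apply)
qed simp

lemma
  fixes L :: "complex^'n^'n"
  assumes L: "rdiag L"
  shows finite_eigvals: "finite (eigvals L)"
    and spec_map_apply: "L *v x = l *\<^sub>R x \<Longrightarrow> spec_map L q *v x = q l *s x"
proof -
  obtain \<Lambda> :: "real set" and E where fin: "finite \<Lambda>"
    and E: "\<forall>l x k. L *v x = l *\<^sub>R x \<longrightarrow> E k *v x = (if k = l then x else 0)"
    and mem: "\<forall>l x. L *v x = l *\<^sub>R x \<longrightarrow> x \<noteq> 0 \<longrightarrow> l \<in> \<Lambda>"
    using rdiag_resolution[OF L] by (elim exE conjE)
  have "eigvals L \<subseteq> \<Lambda>" using mem unfolding eigvals_def by auto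
  then show "finite (eigvals L)" using fin by (rule finite_subset)
  have app: "(\<Sum>k\<in>\<Lambda>. csm (q k) (E k)) *v x = q l *s x" if x: "L *v x = l *\<^sub>R x" for q x l
  proof (cases "x = 0")
    case False
    have "(\<Sum>k\<in>\<Lambda>. csm (q k) (E k)) *v x = (\<Sum>k\<in>\<Lambda>. if k = l then q k *s x else 0)"
      unfolding sum_csm_apply by (intro sum.cong) (auto simp: E[rule_format, OF x])
    also have "\<dots> = q l *s x" using fin mem[rule_format, OF x False] by simp
    finally show ?thesis .
  qed simp
  have "\<forall>l x. L *v x = l *\<^sub>R x \<longrightarrow> spec_map L q *v x = q l *s x"
    unfolding spec_map_def by (rule someI[of _ "\<Sum>k\<in>\<Lambda>. csm (q k) (E k)"]) (intro allI impI app)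
  then show "L *v x = l *\<^sub>R x \<Longrightarrow> spec_map L q *v x = q l *s x" by simp
qed

text \<open>With the matrices fixed and only the scalars \<open>q k\<close> varying, continuity and
  differentiability of \<open>mexp\<close> reduce to those of the scalar exponential.\<close>

lemma spec_map_sum:
  assumes L: "rdiag L"
  shows "spec_map L q = (\<Sum>k\<in>eigvals L. csm (q k) (eigproj L k))"
proof (rule rdiag_matrix_eqI[OF L])
  fix l x assume x: "L *v x = l *\<^sub>R x"
  show "spec_map L q *v x = (\<Sum>k\<in>eigvals L. csm (q k) (eigproj L k)) *v x"
  proof (cases "x = 0")
    case False
    then have l: "l \<in> eigvals L" using x by (auto simp: eigvals_def)
    have "(\<Sum>k\<in>eigvals L. csm (q k) (eigproj L k)) *v x = (\<Sum>k\<in>eigvals L. if k = l then q k *s x else 0)"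
      unfolding sum_csm_apply
      by (intro sum.cong) (auto simp: eigproj_def spec_map_apply[OF L x])
    also have "\<dots> = q l *s x" using finite_eigvals[OF L] l by simp
    finally show ?thesis by (simp add: spec_map_apply[OF L x])
  qed simp
qed

lemma eigproj_eigenvector:
  assumes L: "rdiag L"
  shows "L *v (eigproj L k *v x) = k *\<^sub>R (eigproj L k *v x)"
proof -
  have "L ** eigproj L k = csm (of_real k) (eigproj L k)"
  proof (rule rdiag_matrix_eqI[OF L])
    fix l x assume x: "L *v x = l *\<^sub>R x"
    show "(L ** eigproj L k) *v x = csm (of_real k) (eigproj L k) *v x"
      by (cases "l = k") (simp_all add: matrix_vector_mul_assoc[symmetric] csm_apply eigproj_def
          spec_map_apply[OF L x] x scaleR_eq_smult)
  qed
  then have "(L ** eigproj L k) *v x = csm (of_real k) (eigproj L k) *v x" by simp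
  then show ?thesis by (simp only: csm_apply matrix_vector_mul_assoc[symmetric] scaleR_eq_smult)
qed

lemma sum_eigproj:
  assumes L: "rdiag L"
  shows "(\<Sum>k\<in>eigvals L. eigproj L k *v x) = x"
proof -
  have "spec_map L (\<lambda>_. 1) = mat 1"
  proof (rule rdiag_matrix_eqI[OF L])
    fix l x assume x: "L *v x = l *\<^sub>R x"
    show "spec_map L (\<lambda>_. 1) *v x = mat 1 *v x" by (simp add: spec_map_apply[OF L x])
  qed
  then have "(\<Sum>k\<in>eigvals L. csm 1 (eigproj L k)) *v x = x"
    using spec_map_sum[OF L, of "\<lambda>_. 1"] by simp
  then show ?thesis unfolding sum_csm_apply by simp
qed

section \<open>One-parameter groups \<open>exp (s L)\<close> of real-diagonalisable matrices\<close>

definition mexp :: "complex^'n^'n \<Rightarrow> complex \<Rightarrow> complex^'n^'n" where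
  "mexp L s = spec_map L (\<lambda>l. exp (s * of_real l))"

lemma mexp_apply:
  "rdiag L \<Longrightarrow> L *v x = l *\<^sub>R x \<Longrightarrow> mexp L s *v x = exp (s * of_real l) *s x"
  unfolding mexp_def by (rule spec_map_apply)

lemma mexp_0:
  assumes L: "rdiag L" shows "mexp L 0 = mat 1"
proof (rule rdiag_matrix_eqI[OF L])
  fix l x assume x: "L *v x = l *\<^sub>R x"
  show "mexp L 0 *v x = mat 1 *v x" by (simp add: mexp_apply[OF L x])
qed

lemma mexp_add:
  assumes L: "rdiag L" shows "mexp L (s + t) = mexp L s ** mexp L t"
proof (rule rdiag_matrix_eqI[OF L])
  fix l x assume x: "L *v x = l *\<^sub>R x"
  show "mexp L (s + t) *v x = (mexp L s ** mexp L t) *v x"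
    by (simp add: mexp_apply[OF L x] matrix_vector_mul_assoc[symmetric] vector_scalar_commute
        vector_smult_assoc exp_add algebra_simps)
qed

lemma mexp_inverse:
  assumes L: "rdiag L"
  shows "mexp L s ** mexp L (- s) = mat 1" "matrix_inv (mexp L s) = mexp L (- s)" "invertible (mexp L s)"
proof -
  show 1: "mexp L s ** mexp L (- s) = mat 1"
    unfolding mexp_add[OF L, symmetric] by (simp add: mexp_0[OF L])
  show "matrix_inv (mexp L s) = mexp L (- s)" "invertible (mexp L s)"
    using matrix_inv_unique[OF 1] by simp_all
qed

lemma mexp_has_vector_derivative:
  assumes L: "rdiag L"
  shows "((\<lambda>t::real. mexp L (c * of_real t)) has_vector_derivative csm c L) (at 0)"
proof -
  have d: "((\<lambda>t::real. exp (c * of_real t * of_real k)) has_vector_derivative c * of_real k) (at 0)" for k :: real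
  proof -
    let ?a = "c * of_real k"
    have "((\<lambda>z. exp (?a * z)) has_field_derivative exp (?a * of_real 0) * ?a) (at (of_real 0))"
      by (rule DERIV_fun_exp[OF DERIV_cmult_Id])
    from has_vector_derivative_real_field[OF this, of UNIV] show ?thesis
      by (simp add: mult_ac)
  qed
  have "((\<lambda>t::real. csm (exp (c * of_real t * of_real k)) (eigproj L k)) has_vector_derivative
      csm (c * of_real k) (eigproj L k)) (at 0)" for k
    using bounded_linear.has_vector_derivative[OF bounded_linear_csm d] .
  then have "((\<lambda>t::real. \<Sum>k\<in>eigvals L. csm (exp (c * of_real t * of_real k)) (eigproj L k)) has_vector_derivative
      (\<Sum>k\<in>eigvals L. csm (c * of_real k) (eigproj L k))) (at 0)"
    by (rule has_vector_derivative_sum)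
  also have "(\<Sum>k\<in>eigvals L. csm (c * of_real k) (eigproj L k)) = spec_map L (\<lambda>k. c * of_real k)"
    by (rule spec_map_sum[OF L, symmetric])
  also have "\<dots> = csm c L"
  proof (rule rdiag_matrix_eqI[OF L])
    fix l x assume x: "L *v x = l *\<^sub>R x"
    show "spec_map L (\<lambda>k. c * of_real k) *v x = csm c L *v x"
      by (simp add: spec_map_apply[OF L x] csm_apply x, simp add: scaleR_eq_smult vector_smult_assoc)
  qed
  finally show ?thesis unfolding mexp_def spec_map_sum[OF L, of "\<lambda>l. exp (_ * of_real l)"] .
qed

lemma continuous_on_mexp:
  assumes L: "rdiag L"
  shows "continuous_on UNIV (\<lambda>t::real. mexp L (c * of_real t))"
proof -
  show ?thesis
    unfolding mexp_def spec_map_sum[OF L]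
    by (rule continuous_on_sum, rule bounded_linear.continuous_on[OF bounded_linear_csm])
      (intro continuous_intros)
qed

lemma mexp_preserves:
  fixes L :: "complex^'n^'n"
  assumes L: "rdiag L" and W: "subspace W" and Wc: "\<And>a x. x \<in> W \<Longrightarrow> a *s x \<in> W"
    and sp: "W \<subseteq> span {x \<in> W. \<exists>l. L *v x = l *\<^sub>R x}" and x: "x \<in> W"
  shows "mexp L s *v x \<in> W"
proof -
  have "x \<in> span {x \<in> W. \<exists>l. L *v x = l *\<^sub>R x}" using sp x by blast
  then show ?thesis
  proof (induction rule: span_induct_alt)
    case base then show ?case using subspace_0[OF W] by simp
  next
    case (step c a b)
    then obtain l where a: "a \<in> W" "L *v a = l *\<^sub>R a" by blast
    then have "mexp L s *v a \<in> W" using Wc by (simp add: mexp_apply[OF L a(2)])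
    then show ?case
      using W step by (simp add: matrix_vector_right_distrib matrix_vector_scaleR subspace_add subspace_scale)
  qed
qed

text \<open>\<open>C\<close> may be antilinear, which is why the time is real and only real scalars
  have to pass through \<open>C\<close>. The factor \<open>k = - 1\<close> serves real structures
  that reverse the flow, \<open>k = 1\<close> maps that commute with it.\<close>

lemma mexp_intertwine:
  assumes L: "rdiag L" and L': "rdiag L'" and C: "linear C"
    and 1: "\<And>l x. L *v x = l *\<^sub>R x \<Longrightarrow> L' *v C x = (k * l) *\<^sub>R C x"
    and 2: "\<And>a x. C (complex_of_real a *s x) = complex_of_real a *s C x"
  shows "C (mexp L (of_real t * of_real k) *v x) = mexp L' (of_real t) *v C x"
proof (rule rdiag_eqI[OF L, of "\<lambda>x. C (mexp L (of_real t * of_real k) *v x)" "\<lambda>x. mexp L' (of_real t) *v C x"])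
  show "linear (\<lambda>x. C (mexp L (of_real t * of_real k) *v x))"
    using linear_compose[OF matrix_vector_mul_linear C] by (simp add: o_def)
  show "linear (\<lambda>x. mexp L' (of_real t) *v C x)"
    using linear_compose[OF C matrix_vector_mul_linear] by (simp add: o_def)
  fix l x assume x: "L *v x = l *\<^sub>R x"
  have e: "exp (of_real t * of_real k * of_real l) = complex_of_real (exp (t * k * l))"
    "exp (of_real t * of_real (k * l)) = complex_of_real (exp (t * k * l))"
    by (simp_all add: exp_of_real[symmetric] mult_ac)
  show "C (mexp L (of_real t * of_real k) *v x) = mexp L' (of_real t) *v C x"
    by (simp add: mexp_apply[OF L x] mexp_apply[OF L' 1[OF x]] e 2 del: of_real_mult)
qed

lemma mexp_eq_one_imp_zero:
  assumes L: "rdiag L" and t: "t \<noteq> 0" and 1: "mexp L (of_real t) = mat 1"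
  shows "L = 0"
proof (rule rdiag_matrix_eqI[OF L])
  fix l x assume x: "L *v x = l *\<^sub>R x"
  have "x = complex_of_real (exp (t * l)) *s x"
    using mexp_apply[OF L x, of "of_real t"] 1 by (simp add: exp_of_real[symmetric])
  then have "x = exp (t * l) *\<^sub>R x" by (simp add: scaleR_eq_smult)
  then have "(exp (t * l) - 1) *\<^sub>R x = 0" by (simp add: algebra_simps)
  then have "x = 0 \<or> l = 0" using t by auto
  then show "L *v x = 0 *v x" using x by auto
qed

text \<open>The last clause, which sends eigenvectors of \<open>P\<close> to eigenvectors of
  \<open>L\<close>, lets properties of the logarithm be read off the eigenspaces of
  \<open>P\<close>.\<close>

lemma rdiag_log:
  fixes P :: "complex^'n^'n"
  assumes P: "rdiag P" and pos: "\<And>l x. P *v x = l *\<^sub>R x \<Longrightarrow> x \<noteq> 0 \<Longrightarrow> 0 < l"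
  shows "\<exists>L. rdiag L \<and> mexp L 1 = P \<and> (\<forall>l x. P *v x = l *\<^sub>R x \<longrightarrow> L *v x = ln l *\<^sub>R x)"
proof -
  let ?L = "spec_map P (\<lambda>l. of_real (ln l))"
  have app: "?L *v x = ln l *\<^sub>R x" if "P *v x = l *\<^sub>R x" for l x
    using spec_map_apply[OF P that] by (simp add: scaleR_eq_smult)
  have "span {x. \<exists>l. P *v x = l *\<^sub>R x} \<subseteq> span {x. \<exists>l. ?L *v x = l *\<^sub>R x}"
    by (rule span_mono) (use app in auto)
  then have L: "rdiag ?L" using P unfolding rdiag_def by auto
  have "mexp ?L 1 = P"
  proof (rule rdiag_matrix_eqI[OF P])
    fix l x assume x: "P *v x = l *\<^sub>R x"
    show "mexp ?L 1 *v x = P *v x"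
    proof (cases "x = 0")
      case False
      then have "exp (complex_of_real (ln l)) = of_real l"
        using pos[OF x] by (simp add: exp_of_real)
      then show ?thesis using mexp_apply[OF L app[OF x], of 1] x by (simp add: scaleR_eq_smult)
    qed simp
  qed
  then show ?thesis using L app by (intro exI[of _ ?L]) simp
qed

section \<open>Zariski topology and identity components\<close>

lemma topspace_zariski [simp]: "topspace (zariski X) = UNIV"
proof -
  have "(\<lambda>_. 1) \<in> poly_funs UNIV X" by (rule poly_funs.const) simp
  then have "{a. (\<lambda>_. 1::complex) a \<noteq> 0} \<in> {{a. p a \<noteq> 0} | p. p \<in> poly_funs UNIV X}"
    by (intro CollectI exI[of _ "\<lambda>_. 1"]) simp
  then show ?thesis unfolding zariski_def topology_generated_by_topspace by auto
qed

lemma openin_zariski_nonzero: "p \<in> poly_funs UNIV X \<Longrightarrow> openin (zariski X) {a. p a \<noteq> 0}"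
  unfolding zariski_def by (rule topology_generated_by_Basis) (intro CollectI exI[of _ p] conjI refl)

lemma continuous_map_into_zariski:
  assumes "\<And>p. p \<in> poly_funs UNIV X \<Longrightarrow> openin T {a \<in> topspace T. p (f a) \<noteq> 0}"
  shows "continuous_map T (zariski X) f"
  unfolding zariski_def
proof (rule continuous_on_generated_topo)
  fix U assume "U \<in> {{a. p a \<noteq> 0} | p. p \<in> poly_funs UNIV X}"
  then obtain p where p: "p \<in> poly_funs UNIV X" "U = {a. p a \<noteq> 0}" by blast
  have "f -` U \<inter> topspace T = {a \<in> topspace T. p (f a) \<noteq> 0}" using p(2) by auto
  then show "openin T (f -` U \<inter> topspace T)" using assms[OF p(1)] by simp
next
  show "f ` topspace T \<subseteq> \<Union> {{a. p a \<noteq> 0} | p. p \<in> poly_funs UNIV X}"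
    using topspace_zariski[of X] unfolding zariski_def topology_generated_by_topspace by simp
qed

lemma poly_funs_compose:
  assumes "p \<in> poly_funs UNIV X" "\<And>x. x \<in> X \<Longrightarrow> (\<lambda>a. x (f a)) \<in> poly_funs UNIV Y"
  shows "(\<lambda>a. p (f a)) \<in> poly_funs UNIV Y"
  using assms(1)
proof induction
  case (coord x) then show ?case by (rule assms(2))
qed (simp_all add: poly_funs.const poly_funs.add poly_funs.mult)

lemma continuous_map_zariski_poly:
  assumes "\<And>x. x \<in> X \<Longrightarrow> (\<lambda>a. x (f a)) \<in> poly_funs UNIV Y"
  shows "continuous_map (zariski Y) (zariski X) f"
proof (rule continuous_map_into_zariski)
  fix p assume "p \<in> poly_funs UNIV X"
  then have "(\<lambda>a. p (f a)) \<in> poly_funs UNIV Y" by (rule poly_funs_compose) (rule assms)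
  then show "openin (zariski Y) {a \<in> topspace (zariski Y). p (f a) \<noteq> 0}"
    using openin_zariski_nonzero by simp
qed

lemma poly_funs_sum:
  assumes "finite I" "0 \<in> K" "\<And>i. i \<in> I \<Longrightarrow> f i \<in> poly_funs K X"
  shows "(\<lambda>a. \<Sum>i\<in>I. f i a) \<in> poly_funs K X"
  using assms(1,3) by induction (simp_all add: poly_funs.const poly_funs.add poly_funs.mult assms(2))

lemma poly_funs_prod:
  assumes "finite I" "1 \<in> K" "\<And>i. i \<in> I \<Longrightarrow> f i \<in> poly_funs K X"
  shows "(\<lambda>a. \<Prod>i\<in>I. f i a) \<in> poly_funs K X"
  using assms(1,3) by induction (simp_all add: poly_funs.const poly_funs.add poly_funs.mult assms(2))

lemma poly_funs_coord: "(\<lambda>A. A $ i $ j) \<in> poly_funs K mat_coords"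
  by (rule poly_funs.coord) (auto simp: mat_coords_def)

lemma poly_funs_conjugation:
  assumes "\<And>i j. B $ i $ j \<in> K" "\<And>i j. C $ i $ j \<in> K" "0 \<in> K"
  shows "(\<lambda>A. (B ** A ** C) $ i $ j) \<in> poly_funs K mat_coords"
proof -
  have 1: "(\<lambda>A. B $ i $ l * A $ l $ k) \<in> poly_funs K mat_coords" for l k
    by (rule poly_funs.mult[OF poly_funs.const[OF assms(1)] poly_funs_coord])
  have 2: "(\<lambda>A. \<Sum>l\<in>UNIV. B $ i $ l * A $ l $ k) \<in> poly_funs K mat_coords" for k
    by (rule poly_funs_sum[OF finite assms(3) 1])
  have "(\<lambda>A. \<Sum>k\<in>UNIV. (\<Sum>l\<in>UNIV. B $ i $ l * A $ l $ k) * C $ k $ j) \<in> poly_funs K mat_coords"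
    by (rule poly_funs_sum[OF finite assms(3) poly_funs.mult[OF 2 poly_funs.const[OF assms(2)]]])
  then show ?thesis by (simp add: matrix_matrix_mult_def)
qed

lemma continuous_map_zariski_conjugation:
  fixes B C :: "complex^'n^'n"
  shows "continuous_map (zariski mat_coords) (zariski mat_coords) (\<lambda>A. B ** A ** C)"
proof (rule continuous_map_zariski_poly)
  fix x :: "complex^'n^'n \<Rightarrow> complex" assume "x \<in> mat_coords"
  then obtain i j where "x = (\<lambda>A. A $ i $ j)" by (auto simp: mat_coords_def)
  then show "(\<lambda>A. x (B ** A ** C)) \<in> poly_funs UNIV mat_coords"
    using poly_funs_conjugation[of B UNIV C i j] by simp
qed

lemma continuous_on_poly_funs:
  fixes X :: "('a::topological_space \<Rightarrow> complex) set"
  assumes "p \<in> poly_funs K X" "\<And>x. x \<in> X \<Longrightarrow> continuous_on UNIV x"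
  shows "continuous_on UNIV p"
  using assms(1) by induction (simp_all add: assms(2) continuous_on_add continuous_on_mult)

lemma continuous_map_euclidean_zariski:
  fixes X :: "('a::topological_space \<Rightarrow> complex) set"
  assumes "\<And>x. x \<in> X \<Longrightarrow> continuous_on UNIV x"
  shows "continuous_map euclidean (zariski X) id"
proof (rule continuous_map_into_zariski)
  fix p assume p: "p \<in> poly_funs UNIV X"
  have "open {a. p a \<noteq> 0}"
    by (intro open_Collect_neq continuous_on_poly_funs[OF p] assms continuous_on_const)
  then show "openin euclidean {a \<in> topspace euclidean. p (id a) \<noteq> 0}" by simp
qed

lemma continuous_on_mat_coords: "x \<in> mat_coords \<Longrightarrow> continuous_on UNIV x"
  by (auto simp: mat_coords_def intro!: continuous_on_component continuous_on_id)

lemma continuous_on_vec_coords: "x \<in> vec_coords \<Longrightarrow> continuous_on UNIV x"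
  by (auto simp: vec_coords_def intro!: continuous_on_component continuous_on_id)

lemma closedin_zariski_imp_closed:
  fixes X :: "('a::topological_space \<Rightarrow> complex) set"
  assumes "\<And>x. x \<in> X \<Longrightarrow> continuous_on UNIV x" "closedin (zariski X) Z"
  shows "closed Z"
proof -
  have c: "continuous_map euclidean (zariski X) id"
    by (rule continuous_map_euclidean_zariski) (rule assms(1))
  have "closedin euclidean {x \<in> topspace euclidean. id x \<in> Z}"
    by (rule closedin_continuous_map_preimage[OF c assms(2)])
  then show ?thesis by simp
qed

section \<open>Zariski identity components of matrix groups\<close>

lemma identity_component_subset: "identity_component M \<subseteq> M"
  unfolding identity_component_def
  using connected_component_of_subset_topspace[of "subtopology (zariski mat_coords) M" "mat 1"] by auto

lemma identity_component_one:
  assumes "mat 1 \<in> M" shows "mat 1 \<in> identity_component M"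
  unfolding identity_component_def using assms by (simp add: connected_component_of_refl)

lemma connectedin_identity_component:
  "connectedin (subtopology (zariski mat_coords) M) (identity_component M)"
  unfolding identity_component_def by (rule connectedin_connected_component_of)

lemma identity_component_maximal:
  assumes "connectedin (subtopology (zariski mat_coords) M) S" "a \<in> S" "a \<in> identity_component M"
  shows "S \<subseteq> identity_component M"
proof
  fix b assume "b \<in> S"
  then have 1: "connected_component_of (subtopology (zariski mat_coords) M) a b"
    using assms(1,2) unfolding connected_component_of_def by (intro exI[of _ S]) simp
  have "connected_component_of (subtopology (zariski mat_coords) M) (mat 1) a"
    using assms(3) by (simp add: identity_component_def)
  from connected_component_of_trans[OF this 1] show "b \<in> identity_component M"
    unfolding identity_component_def by simp
qed

lemma identity_component_map:
  assumes f: "continuous_map (zariski mat_coords) (zariski mat_coords) f"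
    and M: "\<And>A. A \<in> M \<Longrightarrow> f A \<in> M'"
    and a: "a \<in> identity_component M" "f a \<in> identity_component M'" and b: "b \<in> identity_component M"
  shows "f b \<in> identity_component M'"
proof -
  have "continuous_map (subtopology (zariski mat_coords) M) (subtopology (zariski mat_coords) M') f"
    using f M by (auto simp: continuous_map_in_subtopology continuous_map_from_subtopology)
  then have "connectedin (subtopology (zariski mat_coords) M') (f ` identity_component M)"
    by (rule connectedin_continuous_map_image) (rule connectedin_identity_component)
  then have "f ` identity_component M \<subseteq> identity_component M'"
    by (rule identity_component_maximal[of _ _ "f a"]) (use a in auto)
  then show ?thesis using b by blast
qed

text \<open>A Euclidean continuous curve is Zariski continuous, so its image is Zariski connected.
  This is how exponentials are shown to lie in identity components.\<close>

lemma identity_component_path: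
  fixes \<gamma> :: "real \<Rightarrow> complex^'n^'n"
  assumes "continuous_on UNIV \<gamma>" "\<And>t. \<gamma> t \<in> M" "\<gamma> 0 \<in> identity_component M"
  shows "\<gamma> t \<in> identity_component M"
proof -
  have "continuous_map euclidean euclidean \<gamma>" using assms(1) by simp
  then have "continuous_map euclidean (zariski mat_coords) (id \<circ> \<gamma>)"
    by (rule continuous_map_compose[OF _ continuous_map_euclidean_zariski]) (rule continuous_on_mat_coords)
  then have "continuous_map euclidean (subtopology (zariski mat_coords) M) \<gamma>"
    using assms(2) by (auto simp: continuous_map_in_subtopology)
  then have "connectedin (subtopology (zariski mat_coords) M) (range \<gamma>)"
    by (rule connectedin_continuous_map_image) simp
  then have "range \<gamma> \<subseteq> identity_component M"
    by (rule identity_component_maximal[of _ _ "\<gamma> 0"]) (use assms(3) in auto)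
  then show ?thesis by blast
qed

text \<open>The component is only relatively closed in \<open>M\<close>; membership of a limit in
  \<open>M\<close> itself has to come from elsewhere.\<close>

lemma identity_component_closed:
  obtains Z where "closed Z" "identity_component M = Z \<inter> M"
proof -
  have "closedin (subtopology (zariski mat_coords) M) (identity_component M)"
    unfolding identity_component_def by (rule closedin_connected_component_of)
  then obtain Z where Z: "closedin (zariski mat_coords) Z" "identity_component M = Z \<inter> M"
    by (auto simp: closedin_subtopology)
  have "closed Z" by (rule closedin_zariski_imp_closed[OF continuous_on_mat_coords Z(1)])
  then show ?thesis using that Z(2) by blast
qed

locale matrix_group =
  fixes M :: "(complex^'n^'n) set"
  assumes one_mem: "mat 1 \<in> M" and mult_mem: "A \<in> M \<Longrightarrow> B \<in> M \<Longrightarrow> A ** B \<in> M"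
    and inv_mem: "A \<in> M \<Longrightarrow> matrix_inv A \<in> M" and invertible_mem: "A \<in> M \<Longrightarrow> invertible A"
begin

lemma idc_mult:
  assumes "A \<in> identity_component M" "B \<in> identity_component M"
  shows "A ** B \<in> identity_component M"
proof -
  have A: "A \<in> M" using assms(1) identity_component_subset by blast
  show ?thesis
    by (rule identity_component_map[where f="\<lambda>X. A ** X" and M=M and a="mat 1"])
      (use continuous_map_zariski_conjugation[of A "mat 1"] A assms one_mem in
        \<open>auto intro: mult_mem identity_component_one\<close>)
qed

lemma idc_inv:
  assumes "A \<in> identity_component M"
  shows "matrix_inv A \<in> identity_component M"
proof -
  have A: "A \<in> M" using assms identity_component_subset by blast
  have "matrix_inv A ** mat 1 \<in> identity_component M"
    by (rule identity_component_map[where f="\<lambda>X. matrix_inv A ** X" and M=M and a=A])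
      (use continuous_map_zariski_conjugation[of "matrix_inv A" "mat 1"] A assms one_mem in
        \<open>auto intro: mult_mem inv_mem identity_component_one simp: matrix_inv_left invertible_mem\<close>)
  then show ?thesis by simp
qed

lemma matrix_group_idc: "matrix_group (identity_component M)"
  by unfold_locales
    (use one_mem identity_component_subset[of M, THEN subsetD] idc_mult idc_inv invertible_mem in
      \<open>auto intro: identity_component_one\<close>)

end

section \<open>Complexification\<close>

definition vcnj :: "complex^'n \<Rightarrow> complex^'n" where
  "vcnj z = (\<chi> i. cnj (z $ i))"

lemma vcnj_vcnj [simp]: "vcnj (vcnj z) = z"
  and vcnj_add: "vcnj (x + y) = vcnj x + vcnj y"
  and vcnj_smult: "vcnj (a *s x) = cnj a *s vcnj x"
  and vcnj_scaleR: "vcnj (r *\<^sub>R x) = r *\<^sub>R vcnj x"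
  and vcnj_zero [simp]: "vcnj 0 = 0"
  by (simp_all add: vcnj_def vec_eq_iff)

lemma vcnj_mult: "vcnj (A *v x) = mat_cnj A *v vcnj x"
  by (simp add: vcnj_def mat_cnj_def vec_eq_iff matrix_vector_mult_def)

lemma mat_cnj_cnj [simp]: "mat_cnj (mat_cnj A) = A"
  and mat_cnj_one [simp]: "mat_cnj (mat 1) = mat 1"
  by (simp_all add: mat_cnj_def vec_eq_iff mat_def)

lemma mat_cnj_mult: "mat_cnj (A ** B) = mat_cnj A ** mat_cnj B"
  by (simp add: mat_cnj_def vec_eq_iff matrix_matrix_mult_def)

lemma mat_complex_mult: "mat_complex (A ** B) = mat_complex A ** mat_complex B"
  by (simp add: mat_complex_def vec_eq_iff matrix_matrix_mult_def)

lemma mat_complex_one [simp]: "mat_complex (mat 1) = mat 1"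
  and mat_cnj_complex [simp]: "mat_cnj (mat_complex B) = mat_complex B"
  by (simp_all add: mat_complex_def mat_cnj_def vec_eq_iff mat_def)

lemma mat_complex_inj: "mat_complex A = mat_complex B \<Longrightarrow> A = B"
  by (simp add: mat_complex_def vec_eq_iff)

lemma mat_cnj_fixed: "mat_cnj A = A \<Longrightarrow> A = mat_complex (\<chi> i j. Re (A $ i $ j))"
  by (simp add: mat_complex_def mat_cnj_def vec_eq_iff complex_eq_iff)

lemma mat_complex_apply: "mat_complex A *v vec_complex x = vec_complex (A *v x)"
  by (simp add: mat_complex_def vec_complex_def vec_eq_iff matrix_vector_mult_def)

lemma vcnj_complex [simp]: "vcnj (vec_complex x) = vec_complex x"
  by (simp add: vcnj_def vec_complex_def vec_eq_iff)

lemma vec_complex_inj: "vec_complex x = vec_complex y \<Longrightarrow> x = y"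
  by (simp add: vec_complex_def vec_eq_iff)

lemma vec_complex_split: "z = vec_complex (vec_Re z) + \<i> *s vec_complex (vec_Im z)"
  by (simp add: vec_complex_def vec_Re_def vec_Im_def vec_eq_iff complex_eq_iff)

lemma vec_Re_Im_simps [simp]:
  "vec_Re (x + y) = vec_Re x + vec_Re y" "vec_Im (x + y) = vec_Im x + vec_Im y"
  "vec_Re (vcnj x) = vec_Re x" "vec_Im (vcnj x) = - vec_Im x"
  "vec_Re (vec_complex r) = r" "vec_Im (vec_complex r) = 0"
  "vec_Re 0 = 0" "vec_Im 0 = 0" "vec_Re (- x) = - vec_Re x" "vec_Im (- x) = - vec_Im x"
  by (simp_all add: vec_Re_def vec_Im_def vcnj_def vec_complex_def vec_eq_iff)

lemma vec_Re_Im_smult: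
  "vec_Re (a *s x) = Re a *\<^sub>R vec_Re x - Im a *\<^sub>R vec_Im x"
  "vec_Im (a *s x) = Re a *\<^sub>R vec_Im x + Im a *\<^sub>R vec_Re x"
  by (simp_all add: vec_Re_def vec_Im_def vec_eq_iff)

lemma matrix_works_complex:
  fixes f :: "complex^'n \<Rightarrow> complex^'m"
  assumes "\<And>x y. f (x + y) = f x + f y" "\<And>a x. f (a *s x) = a *s f x"
  shows "matrix f *v x = f x"
proof (rule matrix_works)
  show "Vector_Spaces.linear (*s) (*s) f"
    unfolding Vector_Spaces.linear_iff by (simp add: assms vec.vector_space_axioms)
qed

lemma mat_cnj_matrix_inv:
  assumes "invertible A" shows "matrix_inv (mat_cnj A) = mat_cnj (matrix_inv A)" "invertible (mat_cnj A)"
proof -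
  have "mat_cnj A ** mat_cnj (matrix_inv A) = mat 1"
    by (simp add: mat_cnj_mult[symmetric] matrix_inv_right[OF assms])
  then show "matrix_inv (mat_cnj A) = mat_cnj (matrix_inv A)" "invertible (mat_cnj A)"
    by (rule matrix_inv_unique)+
qed

lemma trace_csm: "trace (csm a A) = a * trace A"
  by (simp add: trace_def csm_def sum_distrib_left)

lemma csm_mult: "csm a A ** B = csm a (A ** B)" "A ** csm a B = csm a (A ** B)"
  by (simp_all add: csm_def matrix_matrix_mult_def vec_eq_iff sum_distrib_left mult_ac)

lemma trace_mat_cnj: "trace (mat_cnj A) = cnj (trace A)"
  by (simp add: trace_def mat_cnj_def)

context graded_lie
begin

section \<open>The complexified bracket and its Killing form\<close>

abbreviation cb :: "complex^'n \<Rightarrow> complex^'n \<Rightarrow> complex^'n" where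
  "cb \<equiv> br_complex br"

lemma cb_Re: "vec_Re (cb z w) = br (vec_Re z) (vec_Re w) - br (vec_Im z) (vec_Im w)"
  and cb_Im: "vec_Im (cb z w) = br (vec_Re z) (vec_Im w) + br (vec_Im z) (vec_Re w)"
  by (simp_all add: br_complex_def vec_Re_def vec_Im_def vec_eq_iff)

lemma cvec_eq_iff: "x = y \<longleftrightarrow> vec_Re x = vec_Re y \<and> vec_Im x = vec_Im y"
  by (auto simp: vec_Re_def vec_Im_def vec_eq_iff complex_eq_iff)

lemma cb_add_left: "cb (x + y) z = cb x z + cb y z"
  and cb_add_right: "cb x (y + z) = cb x y + cb x z"
  and cb_smult_left: "cb (a *s x) y = a *s cb x y"
  and cb_smult_right: "cb x (a *s y) = a *s cb x y"
  by (simp_all add: cvec_eq_iff cb_Re cb_Im vec_Re_Im_smult br_simps algebra_simps)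

lemma cb_skew: "cb x y = - cb y x"
  using br_skew[of "vec_Re x"] br_skew[of "vec_Im x"]
  by (simp add: cvec_eq_iff cb_Re cb_Im)

lemma cb_leibniz: "cb x (cb y z) = cb (cb x y) z + cb y (cb x z)"
  by (simp add: cvec_eq_iff cb_Re cb_Im br_simps
      br_leibniz[of "vec_Re x"] br_leibniz[of "vec_Im x"] algebra_simps)

lemma cb_real: "cb (vec_complex x) (vec_complex y) = vec_complex (br x y)"
  by (simp add: cvec_eq_iff cb_Re cb_Im br_simps)

lemma cb_cnj: "cb (vcnj x) (vcnj y) = vcnj (cb x y)"
  by (simp add: cvec_eq_iff cb_Re cb_Im br_simps)

lemma cb_scaleR: "cb (r *\<^sub>R x) y = r *\<^sub>R cb x y" "cb x (r *\<^sub>R y) = r *\<^sub>R cb x y"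
  by (simp_all add: scaleR_eq_smult cb_smult_left cb_smult_right)

lemma cb_minus: "cb (- x) y = - cb x y" "cb x (- y) = - cb x y"
  using cb_scaleR(1)[of "-1" x y] cb_scaleR(2)[of x "-1" y] by simp_all

lemma cb_zero [simp]: "cb 0 y = 0" "cb x 0 = 0"
  using cb_scaleR(1)[of 0 0 y] cb_scaleR(2)[of x 0 0] by simp_all

lemma cb_diff: "cb (x - x') y = cb x y - cb x' y" "cb x (y - y') = cb x y - cb x y'"
  using cb_add_left[of x "- x'"] cb_add_right[of x y "- y'"] by (simp_all add: cb_minus)

definition adc :: "complex^'n \<Rightarrow> complex^'n^'n" where
  "adc x = matrix (cb x)"

lemma adc_apply [simp]: "adc x *v y = cb x y"
  unfolding adc_def by (rule matrix_works_complex) (simp_all add: cb_add_right cb_smult_right)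

lemma adc_add: "adc (x + y) = adc x + adc y"
  and adc_smult: "adc (a *s x) = csm a (adc x)"
  by (simp_all add: matrix_eq matrix_vector_mult_add_rdistrib cb_add_left cb_smult_left csm_apply)

lemma adc_br: "adc (cb x y) = adc x ** adc y - adc y ** adc x"
  by (simp add: matrix_eq matrix_vector_mult_diff_rdistrib matrix_vector_mul_assoc[symmetric]
      cb_leibniz[of x y])

lemma adc_real: "adc (vec_complex x) = mat_complex (adm x)"
proof (rule matrix_eq[THEN iffD2], rule allI)
  fix z
  have "adc (vec_complex x) *v z = vec_complex (br x (vec_Re z)) + \<i> *s vec_complex (br x (vec_Im z))"
    by (simp add: cvec_eq_iff cb_Re cb_Im br_simps vec_Re_Im_smult)
  also have "\<dots> = mat_complex (adm x) *v (vec_complex (vec_Re z) + \<i> *s vec_complex (vec_Im z))"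
    by (simp add: matrix_vector_right_distrib vector_scalar_commute mat_complex_apply)
  finally show "adc (vec_complex x) *v z = mat_complex (adm x) *v z"
    using vec_complex_split[of z] by simp
qed

lemma ad_complex_eq: "ad_complex br x = adc (vec_complex x)"
  by (simp add: adc_real ad_complex_def adm_def)

lemma adc_cnj: "adc (vcnj x) = mat_cnj (adc x)"
proof (rule matrix_eq[THEN iffD2], rule allI)
  fix z
  have "adc (vcnj x) *v z = vcnj (cb x (vcnj z))" using cb_cnj[of x "vcnj z"] by simp
  also have "\<dots> = mat_cnj (adc x) *v z" using vcnj_mult[of "adc x" "vcnj z"] by simp
  finally show "adc (vcnj x) *v z = mat_cnj (adc x) *v z" .
qed

lemma cb_center:
  assumes "\<And>y. cb x y = 0" shows "x = 0"
proof -
  have "vec_Re (cb x (vec_complex y)) = 0" "vec_Im (cb x (vec_complex y)) = 0" for y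
    using assms by simp_all
  then have "br (vec_Re x) y = 0" "br (vec_Im x) y = 0" for y
    by (simp_all add: cb_Re cb_Im br_simps)
  then have "vec_Re x = 0" "vec_Im x = 0" by (auto intro: center_trivial)
  then show ?thesis by (simp add: cvec_eq_iff)
qed

lemma adc_inj: assumes "adc x = adc y" shows "x = y"
proof -
  have "cb (x - y) z = 0" for z
    using assms adc_apply[of x z] adc_apply[of y z] by (simp add: cb_diff)
  then have "x - y = 0" by (rule cb_center)
  then show ?thesis by simp
qed

definition killc :: "complex^'n \<Rightarrow> complex^'n \<Rightarrow> complex" where
  "killc x y = trace (adc x ** adc y)"

lemma killc_sym: "killc x y = killc y x"
  unfolding killc_def by (rule trace_mul_sym)

lemma killc_add: "killc (x + y) z = killc x z + killc y z" "killc z (x + y) = killc z x + killc z y"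
  by (simp_all add: killc_def adc_add matrix_add_ldistrib matrix_add_rdistrib' trace_add)

lemma killc_smult: "killc (a *s x) z = a * killc x z" "killc z (a *s x) = a * killc z x"
  by (simp_all add: killc_def adc_smult csm_mult trace_csm)

lemma killc_scaleR: "killc (r *\<^sub>R x) z = of_real r * killc x z" "killc z (r *\<^sub>R x) = of_real r * killc z x"
  by (simp_all add: scaleR_eq_smult killc_smult)

lemma killc_minus: "killc (- x) z = - killc x z" "killc z (- x) = - killc z x"
  using killc_scaleR(1)[of "-1" x z] killc_scaleR(2)[of z "-1" x] by simp_all

lemma killc_invariant: "killc (cb x y) z = killc x (cb y z)"
proof -
  have "trace (adc y ** adc x ** adc z) = trace (adc x ** adc z ** adc y)"
    using trace_mul_sym[of "adc y" "adc x ** adc z"] by (simp add: matrix_mul_assoc)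
  then show ?thesis
    by (simp add: killc_def adc_br matrix_diff_ldistrib matrix_diff_rdistrib trace_sub matrix_mul_assoc)
qed

lemma killc_cnj: "killc (vcnj x) (vcnj y) = cnj (killc x y)"
  by (simp add: killc_def adc_cnj mat_cnj_mult[symmetric] trace_mat_cnj)

lemma killc_real: "killc (vec_complex x) (vec_complex y) = of_real (killing x y)"
  by (simp add: killc_def killing_def adc_real mat_complex_mult[symmetric])
    (simp add: trace_def mat_complex_def)

lemma lie_Aut_apply: "A \<in> lie_Aut br \<Longrightarrow> A *v cb x y = cb (A *v x) (A *v y)"
  by (simp add: lie_Aut_def)

lemma adc_Aut:
  assumes A: "A \<in> lie_Aut br" shows "A ** adc x = adc (A *v x) ** A"
  by (simp add: matrix_eq matrix_vector_mul_assoc[symmetric] lie_Aut_apply[OF A])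

lemma killc_Aut:
  assumes A: "A \<in> lie_Aut br" shows "killc (A *v x) (A *v y) = killc x y"
proof -
  have i: "invertible A" using A by (simp add: lie_Aut_def)
  have c: "adc (A *v x) = A ** adc x ** matrix_inv A" for x
    by (simp add: adc_Aut[OF A] matrix_mul_assoc[symmetric] matrix_inv_right[OF i])
  have "killc (A *v x) (A *v y) = trace (A ** (adc x ** (matrix_inv A ** A) ** adc y ** matrix_inv A))"
    by (simp add: killc_def c matrix_mul_assoc)
  also have "\<dots> = trace ((adc x ** (matrix_inv A ** A) ** adc y ** matrix_inv A) ** A)"
    by (rule trace_mul_sym)
  also have "\<dots> = trace (adc x ** (matrix_inv A ** A) ** adc y ** (matrix_inv A ** A))"
    by (simp only: matrix_mul_assoc)
  finally show ?thesis by (simp add: matrix_inv_left[OF i] killc_def)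
qed

definition derivc :: "complex^'n^'n \<Rightarrow> bool" where
  "derivc D \<longleftrightarrow> (\<forall>x y. D *v cb x y = cb (D *v x) y + cb x (D *v y))"

lemma derivc_adc: "derivc (adc x)"
  by (simp add: derivc_def cb_leibniz[of x])

text \<open>Evaluated on real vectors, the real and imaginary parts of \<open>D\<close> are
  derivations of the real Lie algebra, hence inner.\<close>

lemma derivc_inner:
  assumes D: "derivc D" obtains y where "D = adc y"
proof -
  define R where "R = ((\<chi> i j. Re (D $ i $ j)) :: real^'n^'n)"
  define I where "I = ((\<chi> i j. Im (D $ i $ j)) :: real^'n^'n)"
  have D_eq: "D = mat_complex R + csm \<i> (mat_complex I)"
    by (simp add: R_def I_def mat_complex_def csm_def vec_eq_iff complex_eq_iff)
  have app: "vec_Re (D *v vec_complex x) = R *v x" "vec_Im (D *v vec_complex x) = I *v x" for x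
    by (simp_all add: D_eq matrix_vector_mult_add_rdistrib csm_apply mat_complex_apply vec_Re_Im_smult)
  have e: "D *v vec_complex (br x y) = cb (D *v vec_complex x) (vec_complex y) + cb (vec_complex x) (D *v vec_complex y)" for x y
    using D cb_real[of x y] unfolding derivc_def by metis
  have "derivation R" unfolding derivation_def
  proof (intro allI)
    fix x y
    show "R *v br x y = br (R *v x) y + br x (R *v y)"
      using arg_cong[OF e[of x y], of vec_Re] by (simp add: app cb_Re br_simps)
  qed
  then obtain a where a: "R = adm a" by (rule derivation_inner)
  have "derivation I" unfolding derivation_def
  proof (intro allI)
    fix x y
    show "I *v br x y = br (I *v x) y + br x (I *v y)"
      using arg_cong[OF e[of x y], of vec_Im] by (simp add: app cb_Im br_simps)
  qed
  then obtain b where b: "I = adm b" by (rule derivation_inner)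
  have "D = adc (vec_complex a + \<i> *s vec_complex b)"
    by (simp add: D_eq a b adc_add adc_smult adc_real)
  then show ?thesis by (rule that)
qed

subsection \<open>The automorphism groups\<close>

lemma matrix_group_Aut: "matrix_group (lie_Aut br)"
proof
  show "mat 1 \<in> lie_Aut br" using matrix_inv_unique(2)[of "mat 1" "mat 1"] by (simp add: lie_Aut_def)
  fix A B assume A: "A \<in> lie_Aut br"
  have i: "invertible A" using A by (simp add: lie_Aut_def)
  show "invertible A" by (rule i)
  show "matrix_inv A \<in> lie_Aut br"
    unfolding lie_Aut_def
  proof (intro CollectI conjI allI)
    show "invertible (matrix_inv A)" by (rule invertible_matrix_inv[OF i])
    fix x y
    have "A *v cb (matrix_inv A *v x) (matrix_inv A *v y) = cb x y"
      by (simp add: lie_Aut_apply[OF A] matrix_vector_cancel[OF i])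
    then show "matrix_inv A *v cb x y = cb (matrix_inv A *v x) (matrix_inv A *v y)"
      using matrix_vector_cancel(1)[OF i, of "cb (matrix_inv A *v x) (matrix_inv A *v y)"] by simp
  qed
  assume B: "B \<in> lie_Aut br"
  show "A ** B \<in> lie_Aut br"
    using A B by (simp add: lie_Aut_def invertible_mult matrix_vector_mul_assoc[symmetric])
qed

lemma lie_Aut_cnj:
  assumes A: "A \<in> lie_Aut br" shows "mat_cnj A \<in> lie_Aut br"
  unfolding lie_Aut_def
proof (intro CollectI conjI allI)
  show "invertible (mat_cnj A)" using A mat_cnj_matrix_inv(2) by (auto simp: lie_Aut_def)
  fix x y
  have e: "mat_cnj A *v z = vcnj (A *v vcnj z)" for z by (simp add: vcnj_mult)
  show "mat_cnj A *v cb x y = cb (mat_cnj A *v x) (mat_cnj A *v y)"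
    unfolding e cb_cnj[of "A *v vcnj x" "A *v vcnj y"] lie_Aut_apply[OF A, symmetric] cb_cnj ..
qed

lemma lie_Aut_real:
  assumes "invertible t" "\<And>x y. t *v br x y = br (t *v x) (t *v y)"
  shows "mat_complex t \<in> lie_Aut br"
  unfolding lie_Aut_def
proof (intro CollectI conjI allI)
  have "mat_complex t ** mat_complex (matrix_inv t) = mat 1"
    by (simp add: mat_complex_mult[symmetric] matrix_inv_right[OF assms(1)])
  then show "invertible (mat_complex t)" by (rule matrix_inv_unique)
  fix x y
  have tz: "vec_Re (mat_complex t *v z) = t *v vec_Re z" "vec_Im (mat_complex t *v z) = t *v vec_Im z" for z
  proof -
    have "mat_complex t *v z = vec_complex (t *v vec_Re z) + \<i> *s vec_complex (t *v vec_Im z)"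
      by (subst vec_complex_split[of z])
        (simp add: matrix_vector_right_distrib vector_scalar_commute mat_complex_apply)
    then show "vec_Re (mat_complex t *v z) = t *v vec_Re z" "vec_Im (mat_complex t *v z) = t *v vec_Im z"
      by (simp_all add: vec_Re_Im_smult)
  qed
  show "mat_complex t *v cb x y = cb (mat_complex t *v x) (mat_complex t *v y)"
    by (simp add: cvec_eq_iff tz cb_Re cb_Im assms(2)[symmetric] matrix_vector_mult_diff_distrib
        matrix_vector_right_distrib)
qed

abbreviation hC :: "int \<Rightarrow> (complex^'n) set" where
  "hC i \<equiv> complexify (h i)"

lemma hC_subspace: "subspace (hC i)"
  using h_subspace[of i]
  by (auto simp: subspace_def complexify_def scaleR_eq_smult vec_Re_Im_smult)

lemma hC_smult: "x \<in> hC i \<Longrightarrow> a *s x \<in> hC i"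
  using h_subspace[of i]
  by (auto simp: complexify_def vec_Re_Im_smult subspace_diff subspace_add subspace_scale)

lemma hC_cnj: "x \<in> hC i \<Longrightarrow> vcnj x \<in> hC i"
  using h_subspace[of i] by (auto simp: complexify_def subspace_neg)

lemma hC_cb: "x \<in> hC i \<Longrightarrow> y \<in> hC j \<Longrightarrow> cb x y \<in> hC (i + j)"
  using h_subspace[of "i + j"] h_br[of _ i _ j]
  by (auto simp: complexify_def cb_Re cb_Im subspace_diff subspace_add)

lemma hC_real: "vec_complex x \<in> hC i \<longleftrightarrow> x \<in> h i"
  using h_subspace[of i] by (auto simp: complexify_def subspace_0)

lemma graded_AutI:
  assumes "A \<in> lie_Aut br" "\<And>i x. x \<in> hC i \<Longrightarrow> A *v x \<in> hC i" "\<And>i x. x \<in> hC i \<Longrightarrow> matrix_inv A *v x \<in> hC i"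
  shows "A \<in> graded_Aut br h"
proof -
  have i: "invertible A" using assms(1) by (simp add: lie_Aut_def)
  have "(\<lambda>x. A *v x) ` hC i = hC i" for i
  proof (intro equalityI subsetI)
    fix x assume x: "x \<in> hC i"
    show "x \<in> (\<lambda>x. A *v x) ` hC i"
      by (rule image_eqI[of _ _ "matrix_inv A *v x"]) (simp_all add: matrix_vector_cancel[OF i] assms(3) x)
  qed (auto simp: assms(2))
  then show ?thesis using assms(1) by (simp add: graded_Aut_def)
qed

lemma graded_AutD:
  assumes "A \<in> graded_Aut br h"
  shows "A \<in> lie_Aut br" "x \<in> hC i \<Longrightarrow> A *v x \<in> hC i" "x \<in> hC i \<Longrightarrow> matrix_inv A *v x \<in> hC i"
proof -
  show a: "A \<in> lie_Aut br" using assms by (simp add: graded_Aut_def)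
  have im: "(\<lambda>x. A *v x) ` hC i = hC i" using assms by (simp add: graded_Aut_def)
  show "x \<in> hC i \<Longrightarrow> A *v x \<in> hC i" using im by blast
  assume "x \<in> hC i"
  then obtain y where y: "y \<in> hC i" "x = A *v y" using im by blast
  have "invertible A" using a by (simp add: lie_Aut_def)
  then show "matrix_inv A *v x \<in> hC i" using y by (simp add: matrix_vector_cancel)
qed

lemma matrix_group_graded: "matrix_group (graded_Aut br h)"
proof -
  interpret Aut: matrix_group "lie_Aut br" by (rule matrix_group_Aut)
  show ?thesis
  proof
    show "mat 1 \<in> graded_Aut br h" by (simp add: graded_Aut_def Aut.one_mem)
    fix A B assume A: "A \<in> graded_Aut br h"
    note A' = graded_AutD[OF A]
    show i: "invertible A" using Aut.invertible_mem A'(1) by simp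
    show "matrix_inv A \<in> graded_Aut br h"
      by (rule graded_AutI) (simp_all add: A' Aut.inv_mem matrix_inv_inv[OF i])
    assume B: "B \<in> graded_Aut br h"
    note B' = graded_AutD[OF B]
    have "invertible B" using Aut.invertible_mem B'(1) by simp
    then show "A ** B \<in> graded_Aut br h"
      by (intro graded_AutI)
        (simp_all add: A' B' Aut.mult_mem i matrix_inv_mult matrix_vector_mul_assoc[symmetric])
  qed
qed

text \<open>The bracket of eigenvectors for \<open>l\<close> and \<open>k\<close> is an eigenvector
  for \<open>l + k\<close>, and the exponential turns the sum into a product. The identity is
  extended from eigenvectors in one variable at a time.\<close>

lemma mexp_Aut:
  assumes L: "rdiag L" and D: "derivc L"
  shows "mexp L s \<in> lie_Aut br"
proof -
  let ?E = "mexp L s"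
  have lin: "linear (cb x)" "linear (\<lambda>x. cb x y)" for x y
    by (auto intro!: linearI simp: cb_add_left cb_add_right cb_scaleR)
  have 1: "?E *v cb x y = cb (?E *v x) (?E *v y)" if x: "L *v x = l *\<^sub>R x" and y: "L *v y = k *\<^sub>R y" for x y l k
  proof -
    have "L *v cb x y = (l + k) *\<^sub>R cb x y"
      using D x y by (simp add: derivc_def cb_scaleR algebra_simps)
    from mexp_apply[OF L this, of s] show ?thesis
      by (simp add: mexp_apply[OF L x] mexp_apply[OF L y] cb_smult_left cb_smult_right vector_smult_assoc
          exp_add algebra_simps)
  qed
  have 2: "?E *v cb x y = cb (?E *v x) (?E *v y)" if x: "L *v x = l *\<^sub>R x" for x y l
    by (rule rdiag_eqI[OF L, of "\<lambda>y. ?E *v cb x y" "\<lambda>y. cb (?E *v x) (?E *v y)"])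
      (use 1[OF x] linear_compose[OF lin(1)[of x] matrix_vector_mul_linear[of ?E]]
        linear_compose[OF matrix_vector_mul_linear[of ?E] lin(1)[of "?E *v x"]] in \<open>simp_all add: o_def\<close>)
  have "?E *v cb x y = cb (?E *v x) (?E *v y)" for x y
    by (rule rdiag_eqI[OF L, of "\<lambda>x. ?E *v cb x y" "\<lambda>x. cb (?E *v x) (?E *v y)"])
      (use 2 linear_compose[OF lin(2)[of y] matrix_vector_mul_linear[of ?E]]
        linear_compose[OF matrix_vector_mul_linear[of ?E] lin(2)[of "?E *v y"]] in \<open>simp_all add: o_def\<close>)
  then show ?thesis using mexp_inverse(3)[OF L] by (simp add: lie_Aut_def)
qed

lemma mexp_path:
  assumes L: "rdiag L" and M: "\<And>s. mexp L s \<in> M" and one: "mat 1 \<in> M"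
  shows "mexp L s \<in> identity_component M"
proof -
  have "mexp L (s * of_real 1) \<in> identity_component M"
    by (rule identity_component_path[where \<gamma>="\<lambda>t. mexp L (s * of_real t)"])
      (simp_all add: continuous_on_mexp[OF L] M mexp_0[OF L] identity_component_one[OF one])
  then show ?thesis by simp
qed

text \<open>The converse of \<open>mexp_Aut\<close>: eigenvalues of an automorphism multiply under
  the bracket, so their logarithms add. Zero vectors are treated apart because they carry no
  positive eigenvalue.\<close>

lemma log_derivc:
  assumes P: "P \<in> lie_Aut br" and diag: "rdiag P"
    and pos: "\<And>l x. P *v x = l *\<^sub>R x \<Longrightarrow> x \<noteq> 0 \<Longrightarrow> 0 < l"
    and L: "\<And>l x. P *v x = l *\<^sub>R x \<Longrightarrow> L *v x = ln l *\<^sub>R x"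
  shows "derivc L"
proof -
  have lin: "linear (cb x)" "linear (\<lambda>x. cb x y)" for x y
    by (auto intro!: linearI simp: cb_add_left cb_add_right cb_scaleR)
  have 1: "L *v cb x y = cb (L *v x) y + cb x (L *v y)"
    if x: "P *v x = l *\<^sub>R x" and y: "P *v y = k *\<^sub>R y" for x y l k
  proof (cases "x = 0 \<or> y = 0")
    case True then show ?thesis by auto
  next
    case False
    have "P *v cb x y = (l * k) *\<^sub>R cb x y"
      by (simp add: lie_Aut_apply[OF P] x y cb_scaleR)
    from L[OF this] show ?thesis
      using False pos[OF x] pos[OF y] by (simp add: L[OF x] L[OF y] cb_scaleR ln_mult algebra_simps)
  qed
  have 2: "L *v cb x y = cb (L *v x) y + cb x (L *v y)" if x: "P *v x = l *\<^sub>R x" for x y l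
    by (rule rdiag_eqI[OF diag, of "\<lambda>y. L *v cb x y" "\<lambda>y. cb (L *v x) y + cb x (L *v y)"])
      (use 1[OF x] linear_compose[OF lin(1)[of x] matrix_vector_mul_linear[of L]]
        linear_compose_add[OF lin(1)[of "L *v x"] linear_compose[OF matrix_vector_mul_linear[of L] lin(1)[of x]]]
        in \<open>simp_all add: o_def\<close>)
  have "L *v cb x y = cb (L *v x) y + cb x (L *v y)" for x y
    by (rule rdiag_eqI[OF diag, of "\<lambda>x. L *v cb x y" "\<lambda>x. cb (L *v x) y + cb x (L *v y)"])
      (use 2 linear_compose[OF lin(2)[of y] matrix_vector_mul_linear[of L]]
        linear_compose_add[OF linear_compose[OF matrix_vector_mul_linear[of L] lin(2)[of y]] lin(2)[of "L *v y"]]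
        in \<open>simp_all add: o_def\<close>)
  then show ?thesis by (simp add: derivc_def)
qed

end

section \<open>Compact real structures\<close>

lemma pos_def_coercive:
  fixes \<beta> :: "'a::euclidean_space \<Rightarrow> 'a \<Rightarrow> real"
  assumes \<beta>: "bilinear \<beta>" and pos: "\<And>x. x \<noteq> 0 \<Longrightarrow> 0 < \<beta> x x"
  obtains c where "0 < c" "\<And>x. c * (norm x)\<^sup>2 \<le> \<beta> x x"
proof -
  have bbb: "bounded_bilinear \<beta>" using \<beta> by (simp add: bilinear_conv_bounded_bilinear)
  have cont: "continuous_on (sphere 0 1) (\<lambda>x. \<beta> x x)"
    by (rule bounded_bilinear.continuous_on[OF bbb continuous_on_id continuous_on_id])
  obtain b :: 'a where "norm b = 1" using vector_choose_size[of 1] by auto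
  then have ne: "sphere (0::'a) 1 \<noteq> {}" by auto
  obtain a where a: "a \<in> sphere 0 1" "\<forall>x\<in>sphere 0 1. \<beta> a a \<le> \<beta> x x"
    using continuous_attains_inf[OF compact_sphere ne cont] by auto
  have a0: "a \<noteq> 0" using a(1) by auto
  have "\<beta> a a * (norm x)\<^sup>2 \<le> \<beta> x x" for x
  proof (cases "x = 0")
    case True then show ?thesis by (simp add: bilinear_lzero[OF \<beta>])
  next
    case False
    have "\<beta> a a \<le> \<beta> ((1 / norm x) *\<^sub>R x) ((1 / norm x) *\<^sub>R x)" using a(2) False by simp
    then have "\<beta> a a \<le> \<beta> x x / (norm x)\<^sup>2"
      by (simp add: bilinear_lmul[OF \<beta>] bilinear_rmul[OF \<beta>] power2_eq_square)
    then show ?thesis using False by (simp add: field_simps)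
  qed
  then show ?thesis using that pos[OF a0] by blast
qed

lemma bounded_linear_matrix_apply: "bounded_linear (\<lambda>A::complex^'n^'m. A *v v)"
  unfolding linear_conv_bounded_linear[symmetric]
  by (auto intro!: linearI simp: matrix_vector_mult_add_rdistrib)
    (simp add: vec_eq_iff matrix_vector_mult_def scaleR_sum_right)

context graded_lie
begin

definition sg :: "complex^'n^'n \<Rightarrow> complex^'n \<Rightarrow> complex^'n" where
  "sg S z = S *v vcnj z"

text \<open>A real structure is an antilinear involution \<open>sg S\<close> of the complexified Lie algebra; it is
  compact if the Killing form is negative definite on its fixed points.\<close>

definition rstruct :: "complex^'n^'n \<Rightarrow> bool" where
  "rstruct S \<longleftrightarrow> S \<in> lie_Aut br \<and> S ** mat_cnj S = mat 1"

definition cstruct :: "complex^'n^'n \<Rightarrow> bool" where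
  "cstruct S \<longleftrightarrow> rstruct S \<and> (\<forall>z. z \<noteq> 0 \<longrightarrow> Re (killc z (sg S z)) < 0)"

text \<open>For a compact structure, the real part of the associated positive definite Hermitian
  form.\<close>

definition hform :: "complex^'n^'n \<Rightarrow> complex^'n \<Rightarrow> complex^'n \<Rightarrow> real" where
  "hform S x y = - Re (killc x (sg S y))"

definition graded_struct :: "complex^'n^'n \<Rightarrow> bool" where
  "graded_struct S \<longleftrightarrow> (\<forall>i x. x \<in> hC i \<longrightarrow> sg S x \<in> hC (- i))"

lemma sg_add: "sg S (x + y) = sg S x + sg S y"
  and sg_smult: "sg S (a *s x) = cnj a *s sg S x"
  and sg_scaleR: "sg S (r *\<^sub>R x) = r *\<^sub>R sg S x"
  and sg_zero [simp]: "sg S 0 = 0"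
  by (simp_all add: sg_def vcnj_add vcnj_smult vcnj_scaleR matrix_vector_right_distrib
      vector_scalar_commute matrix_vector_scaleR)

lemma sg_minus: "sg S (- x) = - sg S x"
  using sg_scaleR[of S "-1" x] by simp

lemma linear_sg: "linear (sg S)"
  by (auto intro!: linearI simp: sg_add sg_scaleR)

lemma sg_sg_mult: "sg S (sg S' z) = (S ** mat_cnj S') *v z"
  by (simp add: sg_def vcnj_mult matrix_vector_mul_assoc)

lemma sg_sg: "rstruct S \<Longrightarrow> sg S (sg S z) = z"
  by (simp add: sg_sg_mult rstruct_def)

lemma sg_cb: "rstruct S \<Longrightarrow> sg S (cb x y) = cb (sg S x) (sg S y)"
  by (simp add: sg_def rstruct_def cb_cnj[symmetric] lie_Aut_apply)

lemma killc_sg: "rstruct S \<Longrightarrow> killc (sg S x) (sg S y) = cnj (killc x y)"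
  by (simp add: sg_def rstruct_def killc_Aut killc_cnj)

lemma rstructI:
  assumes "S \<in> lie_Aut br" "\<And>z. sg S (sg S z) = z" shows "rstruct S"
  using assms by (simp add: rstruct_def matrix_eq sg_sg_mult[symmetric])

lemma killc_zero [simp]: "killc x 0 = 0" "killc 0 x = 0"
  using killc_scaleR(1)[of 0 0 x] killc_scaleR(2)[of x 0 0] by simp_all

lemma hform_bilinear: "bilinear (hform S)"
  by (subst bilinear_def)
    (auto intro!: linearI simp: hform_def killc_add killc_scaleR sg_add sg_scaleR)

lemma hform_sym: assumes "rstruct S" shows "hform S x y = hform S y x"
proof -
  have "killc x (sg S y) = killc (sg S (sg S x)) (sg S y)" by (simp add: sg_sg[OF assms])
  also have "\<dots> = cnj (killc (sg S x) y)" by (rule killc_sg[OF assms])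
  finally show ?thesis by (simp add: hform_def killc_sym[of y])
qed

lemma hform_pos: "cstruct S \<Longrightarrow> x \<noteq> 0 \<Longrightarrow> 0 < hform S x x"
  by (simp add: cstruct_def hform_def)

lemma cstruct_rstruct: "cstruct S \<Longrightarrow> rstruct S"
  by (simp add: cstruct_def)

definition selfadj :: "complex^'n^'n \<Rightarrow> complex^'n^'n \<Rightarrow> bool" where
  "selfadj S A \<longleftrightarrow> (\<forall>x y. hform S (A *v x) y = hform S x (A *v y))"

lemma selfadj_spectral:
  assumes S: "cstruct S" and A: "selfadj S A" and W: "subspace W" and inv: "\<And>x. x \<in> W \<Longrightarrow> A *v x \<in> W"
  shows "W \<subseteq> span {x \<in> W. \<exists>l. A *v x = l *\<^sub>R x}"
  by (rule selfadjoint_spectral[OF hform_bilinear[of S] hform_sym[OF cstruct_rstruct[OF S]]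
        hform_pos[OF S] matrix_vector_mul_linear _ W])
    (use A inv in \<open>simp_all add: selfadj_def\<close>)

lemma selfadj_rdiag:
  assumes "cstruct S" "selfadj S A" shows "rdiag A"
  using selfadj_spectral[OF assms subspace_UNIV] unfolding rdiag_def by auto

text \<open>These \<open>z\<close> are the imaginary multiples of the fixed points of
  \<open>sg S\<close>. They are the source of real-diagonalisable derivations, hence of all
  exponentials used below.\<close>

lemma selfadj_adc:
  assumes S: "rstruct S" and z: "sg S z = - z" shows "selfadj S (adc z)"
  unfolding selfadj_def
proof (intro allI)
  fix x y
  have "killc (cb z x) (sg S y) = - killc (cb x z) (sg S y)"
    using cb_skew[of z x] by (simp add: killc_minus)
  also have "\<dots> = - killc x (cb z (sg S y))" by (simp add: killc_invariant)
  also have "cb z (sg S y) = - sg S (cb z y)" by (simp add: sg_cb[OF S] z cb_minus)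
  finally show "hform S (adc z *v x) y = hform S x (adc z *v y)"
    by (simp add: hform_def killc_minus)
qed

text \<open>The composite of two real structures is the matrix that expresses one form through the
  other; symmetry of both forms makes it self-adjoint.\<close>

lemma selfadj_product:
  assumes S: "rstruct S" and S': "rstruct S'"
  shows "selfadj S (S ** mat_cnj S')"
    and "hform S x ((S ** mat_cnj S') *v y) = hform S' x y"
proof -
  show 2: "hform S x ((S ** mat_cnj S') *v y) = hform S' x y" for x y
    by (simp add: hform_def sg_sg_mult[symmetric] sg_sg[OF S])
  show "selfadj S (S ** mat_cnj S')"
    unfolding selfadj_def
  proof (intro allI)
    fix x y
    have "hform S ((S ** mat_cnj S') *v x) y = hform S y ((S ** mat_cnj S') *v x)"
      by (rule hform_sym[OF S])
    also have "\<dots> = hform S' y x" by (rule 2)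
    also have "\<dots> = hform S' x y" by (rule hform_sym[OF S'])
    finally show "hform S ((S ** mat_cnj S') *v x) y = hform S x ((S ** mat_cnj S') *v y)"
      by (simp add: 2)
  qed
qed

lemma product_Aut:
  assumes "rstruct S" "rstruct S'" shows "S ** mat_cnj S' \<in> lie_Aut br"
  using assms matrix_group.mult_mem[OF matrix_group_Aut] lie_Aut_cnj by (simp add: rstruct_def)

lemma product_positive:
  assumes S: "cstruct S" and S': "cstruct S'" and x: "(S ** mat_cnj S') *v x = l *\<^sub>R x" "x \<noteq> 0"
  shows "0 < l"
proof -
  have "hform S x (l *\<^sub>R x) = hform S' x x"
    using selfadj_product(2)[of S S' x x] S S' x(1) by (simp add: cstruct_def)
  then have "l * hform S x x = hform S' x x" by (simp add: bilinear_rmul[OF hform_bilinear])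
  then show ?thesis
    using hform_pos[OF S x(2)] hform_pos[OF S' x(2)] by (metis zero_less_mult_pos2)
qed

lemma mexp_graded:
  assumes L: "rdiag L" and D: "derivc L" and W: "\<And>i. hC i \<subseteq> span {x \<in> hC i. \<exists>l. L *v x = l *\<^sub>R x}"
  shows "mexp L s \<in> graded_Aut br h"
proof (rule graded_AutI)
  show "mexp L s \<in> lie_Aut br" by (rule mexp_Aut[OF L D])
  have p: "mexp L s *v x \<in> hC i" if "x \<in> hC i" for i x s
    by (rule mexp_preserves[OF L hC_subspace hC_smult W that])
  show "mexp L s *v x \<in> hC i" if "x \<in> hC i" for i x by (rule p[OF that])
  show "matrix_inv (mexp L s) *v x \<in> hC i" if "x \<in> hC i" for i x
    unfolding mexp_inverse(2)[OF L] by (rule p[OF that])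
qed

lemma mexp_grading_group:
  assumes "rdiag L" "derivc L" "\<And>i. hC i \<subseteq> span {x \<in> hC i. \<exists>l. L *v x = l *\<^sub>R x}"
  shows "mexp L s \<in> grading_group br h"
  unfolding grading_group_def
  by (rule mexp_path[OF assms(1) mexp_graded[OF assms] matrix_group.one_mem[OF matrix_group_graded]])

lemma mexp_adjoint_group:
  assumes "rdiag L" "derivc L" shows "mexp L s \<in> adjoint_group br"
  unfolding adjoint_group_def
  by (rule mexp_path[OF assms(1) mexp_Aut[OF assms] matrix_group.one_mem[OF matrix_group_Aut]])

lemma base_cstruct:
  obtains t where "cstruct (mat_complex t)" "graded_struct (mat_complex t)"
proof -
  obtain t :: "real^'n^'n" where t: "t ** t = mat 1"
    "\<And>x y. t *v br x y = br (t *v x) (t *v y)"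
    "\<And>i x. x \<in> h i \<Longrightarrow> t *v x \<in> h (- i)"
    "\<And>x. x \<noteq> 0 \<Longrightarrow> killing x (t *v x) < 0"
    by (rule graded_cartan_involution) blast
  let ?S = "mat_complex t"
  have sg: "sg ?S z = vec_complex (t *v vec_Re z) + (- \<i>) *s vec_complex (t *v vec_Im z)" for z
  proof -
    have "vcnj z = vec_complex (vec_Re z) + (- \<i>) *s vec_complex (vec_Im z)"
      by (simp add: vcnj_def vec_complex_def vec_Re_def vec_Im_def vec_eq_iff complex_eq_iff)
    then show ?thesis
      unfolding sg_def by (simp only: matrix_vector_right_distrib vector_scalar_commute mat_complex_apply)
  qed
  have "?S \<in> lie_Aut br" by (rule lie_Aut_real[OF matrix_inv_unique(2)[OF t(1)] t(2)])
  then have rs: "rstruct ?S" by (simp add: rstruct_def mat_complex_mult[symmetric] t(1))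
  have "Re (killc z (sg ?S z)) < 0" if "z \<noteq> 0" for z
  proof -
    let ?x = "vec_Re z" and ?y = "vec_Im z"
    have "killc z (sg ?S z) = killc (vec_complex ?x + \<i> *s vec_complex ?y) (sg ?S z)"
      using vec_complex_split[of z] by simp
    \<comment> \<open>The mixed terms come with a factor \<open>\<i>\<close>, so the real part is
      the sum of two values of the negative definite form \<open>killing x (t *v x)\<close>.\<close>
    also have "\<dots> = (of_real (killing ?x (t *v ?x)) + (- \<i>) * of_real (killing ?x (t *v ?y)))
        + \<i> * (of_real (killing ?y (t *v ?x)) + (- \<i>) * of_real (killing ?y (t *v ?y)))"
      unfolding sg by (simp only: killc_add killc_smult killc_real distrib_left, simp add: algebra_simps)
    finally have "Re (killc z (sg ?S z)) = killing ?x (t *v ?x) + killing ?y (t *v ?y)"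
      by simp
    moreover have "?x \<noteq> 0 \<or> ?y \<noteq> 0" using that by (simp add: cvec_eq_iff)
    moreover have "killing x (t *v x) \<le> 0" for x
    proof (cases "x = 0")
      case True
      have "killing 0 y = 0" for y using linear_0[OF linear_trace_adm[of "adm y"]] unfolding killing_sym[of 0] by (simp add: killing_def)
      then show ?thesis using True by simp
    qed (use t(4)[of x] in simp)
    ultimately show ?thesis using t(4)[of ?x] t(4)[of ?y] by (smt (verit))
  qed
  then have "cstruct ?S" using rs by (simp add: cstruct_def)
  moreover have "graded_struct ?S"
    unfolding graded_struct_def
  proof (intro allI impI)
    fix i x assume "x \<in> hC i"
    then have "vec_Re x \<in> h i" "vec_Im x \<in> h i" by (simp_all add: complexify_def)
    then have "t *v vec_Re x \<in> h (- i)" "t *v vec_Im x \<in> h (- i)" by (simp_all add: t(3))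
    then show "sg ?S x \<in> hC (- i)"
      unfolding sg by (intro subspace_add[OF hC_subspace] hC_smult) (simp_all add: hC_real)
  qed
  ultimately show ?thesis by (rule that)
qed

lemma rstruct_left: "rstruct S \<Longrightarrow> mat_cnj S ** S = mat 1"
  by (simp add: rstruct_def matrix_left_right_inverse)

lemma graded_product:
  assumes "graded_struct S" "graded_struct S'" "x \<in> hC i"
  shows "(S ** mat_cnj S') *v x \<in> hC i"
proof -
  have "sg S (sg S' x) \<in> hC (- (- i))"
    using assms unfolding graded_struct_def by blast
  then show ?thesis by (simp add: sg_sg_mult)
qed

section \<open>Uniqueness of the structure adapted to a vector\<close>

text \<open>With \<open>P = \<sigma> \<circ> \<sigma>'\<close> and \<open>L = log P\<close>, both \<open>L T \<bottom> T\<close> and \<open>L T \<bottom> P T\<close>, so \<open>L (P - 1)\<close>, which is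
  positive semidefinite, vanishes on \<open>T\<close>; then the powers of \<open>P\<close> fix \<open>T\<close>.\<close>

lemma adapted_struct_unique:
  assumes S: "cstruct S" "graded_struct S" "cb T (sg S T) = 0"
    and S': "cstruct S'" "graded_struct S'" "cb T (sg S' T) = 0"
    and fin: "finite {A \<in> grading_group br h. A *v T = T}"
  shows "S = S'"
proof -
  define P where "P = S ** mat_cnj S'"
  note rs = cstruct_rstruct[OF S(1)] and rs' = cstruct_rstruct[OF S'(1)]
  have PA: "P \<in> lie_Aut br" unfolding P_def by (rule product_Aut[OF rs rs'])
  have sa: "selfadj S P" unfolding P_def by (rule selfadj_product(1)[OF rs rs'])
  have diag: "rdiag P" by (rule selfadj_rdiag[OF S(1) sa])
  have pos: "0 < l" if "P *v x = l *\<^sub>R x" "x \<noteq> 0" for l x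
    using product_positive[OF S(1) S'(1)] that unfolding P_def by blast
  obtain L where L': "rdiag L" "mexp L 1 = P" "\<forall>l x. P *v x = l *\<^sub>R x \<longrightarrow> L *v x = ln l *\<^sub>R x"
  proof -
    have "\<exists>L. rdiag L \<and> mexp L 1 = P \<and> (\<forall>l x. P *v x = l *\<^sub>R x \<longrightarrow> L *v x = ln l *\<^sub>R x)"
      by (rule rdiag_log[OF diag]) (use pos in auto)
    then show ?thesis using that by (elim exE conjE)
  qed
  note L = L'(1,2) L'(3)[rule_format]
  have D: "derivc L" by (rule log_derivc[OF PA diag _ L(3)]) (use pos in auto)
  have W: "hC i \<subseteq> span {x \<in> hC i. \<exists>l. L *v x = l *\<^sub>R x}" for i
  proof -
    have "hC i \<subseteq> span {x \<in> hC i. \<exists>l. P *v x = l *\<^sub>R x}"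
      by (rule selfadj_spectral[OF S(1) sa hC_subspace])
        (use graded_product[OF S(2) S'(2)] in \<open>simp add: P_def\<close>)
    also have "\<dots> \<subseteq> span {x \<in> hC i. \<exists>l. L *v x = l *\<^sub>R x}"
      by (rule span_mono) (use L(3) in auto)
    finally show ?thesis .
  qed
  obtain y where y: "L = adc y" by (rule derivc_inner[OF D])
  \<comment> \<open>Writing \<open>L = ad y\<close> and moving it across by invariance leaves the
    factor \<open>cb T (sg S T)\<close>, which is 0. For \<open>z2\<close> the form of
    \<open>S\<close> against \<open>P T\<close> is the form of \<open>S'\<close> against
    \<open>T\<close>.\<close>
  have z1: "hform S (L *v T) T = 0"
    by (simp add: hform_def y killc_invariant S(3))
  have z2: "hform S (L *v T) (P *v T) = 0"
    unfolding P_def selfadj_product(2)[OF rs rs']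
    by (simp add: hform_def y killc_invariant S'(3))
  let ?\<Lambda> = "eigvals P"
  let ?T = "\<lambda>k. eigproj P k *v T"
  have fL: "finite ?\<Lambda>" by (rule finite_eigvals[OF diag])
  have PT: "P *v ?T k = k *\<^sub>R ?T k" for k by (rule eigproj_eigenvector[OF diag])
  have LT: "L *v ?T k = ln k *\<^sub>R ?T k" for k by (rule L(3)[OF PT])
  have sumT: "(\<Sum>k\<in>?\<Lambda>. ?T k) = T" by (rule sum_eigproj[OF diag])
  have Lsum: "L *v T = (\<Sum>k\<in>?\<Lambda>. ln k *\<^sub>R ?T k)"
    using linear_sum[OF matrix_vector_mul_linear[of L], of ?T ?\<Lambda>] by (simp add: sumT LT)
  have Psum: "P *v T - T = (\<Sum>k\<in>?\<Lambda>. (k - 1) *\<^sub>R ?T k)"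
    using linear_sum[OF matrix_vector_mul_linear[of P], of ?T ?\<Lambda>]
    by (simp add: sumT PT scaleR_diff_left sum_subtractf)
  note bs = bilinear_lmul[OF hform_bilinear] bilinear_rmul[OF hform_bilinear]
  have orth: "hform S (?T j) (?T k) = 0" if "j \<noteq> k" for j k
  proof -
    have "hform S (P *v ?T j) (?T k) = hform S (?T j) (P *v ?T k)" using sa by (simp add: selfadj_def)
    then have "(j - k) * hform S (?T j) (?T k) = 0" by (simp add: PT bs algebra_simps)
    then show ?thesis using that by simp
  qed
  \<comment> \<open>Eigenvectors of \<open>P\<close> for different eigenvalues are orthogonal, so
    only terms \<open>ln j * (j - 1)\<close> times a squared norm survive; these are nonnegative,
    and positive for \<open>j \<noteq> 1\<close> with nonzero component.\<close>
  have "hform S (L *v T) (P *v T - T) = (\<Sum>j\<in>?\<Lambda>. \<Sum>k\<in>?\<Lambda>. ln j * (k - 1) * hform S (?T j) (?T k))"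
  proof -
    have l1: "linear (\<lambda>a. hform S a b)" and l2: "linear (hform S b)" for b
      using hform_bilinear[of S] by (simp_all add: bilinear_def)
    have "hform S (L *v T) (P *v T - T) = (\<Sum>j\<in>?\<Lambda>. hform S (ln j *\<^sub>R ?T j) (P *v T - T))"
      unfolding Lsum by (rule linear_sum[OF l1])
    also have "\<dots> = (\<Sum>j\<in>?\<Lambda>. \<Sum>k\<in>?\<Lambda>. hform S (ln j *\<^sub>R ?T j) ((k - 1) *\<^sub>R ?T k))"
      unfolding Psum by (intro sum.cong refl linear_sum[OF l2])
    finally show ?thesis by (simp add: bs mult_ac)
  qed
  also have "\<dots> = (\<Sum>j\<in>?\<Lambda>. ln j * (j - 1) * hform S (?T j) (?T j))"
  proof (rule sum.cong[OF refl])
    fix j assume j: "j \<in> ?\<Lambda>"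
    have "(\<Sum>k\<in>?\<Lambda>. ln j * (k - 1) * hform S (?T j) (?T k))
        = (\<Sum>k\<in>?\<Lambda>. if k = j then ln j * (j - 1) * hform S (?T j) (?T j) else 0)"
      by (rule sum.cong[OF refl]) (use orth in auto)
    then show "(\<Sum>k\<in>?\<Lambda>. ln j * (k - 1) * hform S (?T j) (?T k)) = ln j * (j - 1) * hform S (?T j) (?T j)"
      using j fL by simp
  qed
  finally have sum0: "(\<Sum>j\<in>?\<Lambda>. ln j * (j - 1) * hform S (?T j) (?T j)) = 0"
    using z1 z2 by (simp add: bilinear_rsub[OF hform_bilinear])
  have lnpos: "0 < ln j * (j - 1)" if "0 < j" "j \<noteq> 1" for j :: real
    using that by (cases "j < 1") (auto simp: zero_less_mult_iff)
  have posj: "0 < j" if "j \<in> ?\<Lambda>" for j using that pos by (auto simp: eigvals_def)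
  have nn: "0 \<le> ln j * (j - 1) * hform S (?T j) (?T j)" if "j \<in> ?\<Lambda>" for j
  proof (cases "j = 1 \<or> ?T j = 0")
    case True then show ?thesis by (auto simp: bilinear_lzero[OF hform_bilinear])
  next
    case False then show ?thesis using lnpos[OF posj[OF that]] hform_pos[OF S(1), of "?T j"] by simp
  qed
  have "ln j *\<^sub>R ?T j = 0" if j: "j \<in> ?\<Lambda>" for j
  proof (rule ccontr)
    assume "ln j *\<^sub>R ?T j \<noteq> 0"
    then have ne: "j \<noteq> 1" "?T j \<noteq> 0" by auto
    have "ln j * (j - 1) * hform S (?T j) (?T j) = 0"
      using sum_nonneg_0[OF fL nn sum0 j] .
    moreover have "0 < ln j * (j - 1) * hform S (?T j) (?T j)"
      using lnpos[OF posj[OF j] ne(1)] hform_pos[OF S(1) ne(2)] by (rule mult_pos_pos)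
    ultimately show False by linarith
  qed
  then have "L *v T = 0" unfolding Lsum by (rule sum.neutral[OF ballI])
  then have LT0: "L *v T = 0 *\<^sub>R T" by simp
  have fixT: "mexp L s \<in> {A \<in> grading_group br h. A *v T = T}" for s
    using mexp_grading_group[OF L(1) D W] mexp_apply[OF L(1) LT0, of s] by simp
  \<comment> \<open>All \<open>exp (s L)\<close> fix \<open>T\<close>, so finiteness of the
    stabiliser makes two of them equal at distinct real times; their quotient is the identity, and
    real eigenvalues then force \<open>L = 0\<close>.\<close>
  have "L = 0"
  proof -
    have "range (\<lambda>t::real. mexp L (of_real t)) \<subseteq> {A \<in> grading_group br h. A *v T = T}" using fixT by auto
    then have "finite (range (\<lambda>t::real. mexp L (of_real t)))" using fin by (rule finite_subset)
    then have "\<not> inj (\<lambda>t::real. mexp L (of_real t))"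
      using finite_imageD[of "\<lambda>t::real. mexp L (of_real t)" UNIV] infinite_UNIV_char_0 by blast
    then obtain a b :: real where ab: "a \<noteq> b" "mexp L (of_real a) = mexp L (of_real b)"
      unfolding inj_def by auto
    have "mexp L (of_real (a - b)) = mexp L (of_real a) ** mexp L (- of_real b)"
      using mexp_add[OF L(1), of "of_real a" "- of_real b"] by simp
    also have "\<dots> = mat 1" unfolding ab(2) by (rule mexp_inverse(1)[OF L(1)])
    finally show ?thesis by (rule mexp_eq_one_imp_zero[OF L(1), rotated]) (use ab(1) in simp)
  qed
  then have "L *v x = 0 *\<^sub>R x" for x by simp
  then have "mexp L 1 *v x = x" for x using mexp_apply[OF L(1), of x 0 1] by simp
  then have "P = mat 1" using L(2) by (simp add: matrix_eq)
  then have "S ** mat_cnj S' ** S' = S'" by (simp add: P_def)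
  then show ?thesis by (simp add: matrix_mul_assoc[symmetric] rstruct_left[OF rs'])
qed

lemma sg_conj:
  assumes "invertible g"
  shows "sg (matrix_inv g ** S ** mat_cnj g) x = matrix_inv g *v sg S (g *v x)"
  by (simp add: sg_def vcnj_mult matrix_vector_mul_assoc matrix_mul_assoc)

lemma cstruct_conj:
  assumes S: "cstruct S" and g: "g \<in> lie_Aut br"
  shows "cstruct (matrix_inv g ** S ** mat_cnj g)"
proof -
  interpret Aut: matrix_group "lie_Aut br" by (rule matrix_group_Aut)
  have ig: "invertible g" by (rule Aut.invertible_mem[OF g])
  note rs = cstruct_rstruct[OF S]
  let ?S = "matrix_inv g ** S ** mat_cnj g"
  note sgc = sg_conj[OF ig, of S]
  have "rstruct ?S"
  proof (rule rstructI)
    show "?S \<in> lie_Aut br" using rs g by (auto simp: rstruct_def intro!: Aut.mult_mem Aut.inv_mem lie_Aut_cnj)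
    show "sg ?S (sg ?S z) = z" for z
      by (simp add: sgc matrix_vector_cancel[OF ig] sg_sg[OF rs])
  qed
  moreover have "Re (killc z (sg ?S z)) < 0" if "z \<noteq> 0" for z
  proof -
    have "killc z (sg ?S z) = killc (g *v z) (sg S (g *v z))"
      using killc_Aut[OF g, of z "sg ?S z"] by (simp add: sgc matrix_vector_cancel[OF ig])
    moreover have "g *v z \<noteq> 0" using that matrix_vector_cancel(1)[OF ig, of z] by auto
    ultimately show ?thesis using S by (simp add: cstruct_def)
  qed
  ultimately show ?thesis by (simp add: cstruct_def)
qed

lemma graded_struct_conj:
  assumes S: "graded_struct S" and g: "g \<in> graded_Aut br h"
  shows "graded_struct (matrix_inv g ** S ** mat_cnj g)"
proof -
  have ig: "invertible g" using matrix_group.invertible_mem[OF matrix_group_graded g] .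
  show ?thesis
    using S graded_AutD(2,3)[OF g] unfolding graded_struct_def sg_conj[OF ig] by simp
qed

lemma cstruct_cnj:
  assumes S: "cstruct S" shows "cstruct (mat_cnj S)"
proof -
  note rs = cstruct_rstruct[OF S]
  have sgc: "sg (mat_cnj S) z = vcnj (sg S (vcnj z))" for z by (simp add: sg_def vcnj_mult)
  have "rstruct (mat_cnj S)"
    using rs by (intro rstructI) (simp_all add: rstruct_def lie_Aut_cnj sgc sg_sg[OF rs])
  moreover have "Re (killc z (sg (mat_cnj S) z)) < 0" if "z \<noteq> 0" for z
  proof -
    have "killc z (sg (mat_cnj S) z) = cnj (killc (vcnj z) (sg S (vcnj z)))"
      using killc_cnj[of "vcnj z" "sg S (vcnj z)"] by (simp add: sgc)
    moreover have "vcnj z \<noteq> 0" using that by (metis vcnj_vcnj vcnj_zero)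
    ultimately show ?thesis using S by (simp add: cstruct_def)
  qed
  ultimately show ?thesis by (simp add: cstruct_def)
qed

lemma graded_struct_cnj: "graded_struct S \<Longrightarrow> graded_struct (mat_cnj S)"
proof -
  have sgc: "sg (mat_cnj S) z = vcnj (sg S (vcnj z))" for z by (simp add: sg_def vcnj_mult)
  assume "graded_struct S"
  then show ?thesis unfolding graded_struct_def sgc by (simp add: hC_cnj)
qed

lemma grading_group_graded: "A \<in> grading_group br h \<Longrightarrow> A \<in> graded_Aut br h"
  unfolding grading_group_def using identity_component_subset by blast

lemma matrix_group_grading: "matrix_group (grading_group br h)"
  unfolding grading_group_def by (rule matrix_group.matrix_group_idc[OF matrix_group_graded])

lemma matrix_group_adjoint: "matrix_group (adjoint_group br)"
  unfolding adjoint_group_def by (rule matrix_group.matrix_group_idc[OF matrix_group_Aut])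

lemma adjoint_group_Aut: "A \<in> adjoint_group br \<Longrightarrow> A \<in> lie_Aut br"
  unfolding adjoint_group_def using identity_component_subset by blast

section \<open>Existence of the structure adapted to a stable vector\<close>

lemma stable_orbit_closed:
  assumes "stable_vector br h v"
  shows "closed {A *v v | A. A \<in> grading_group br h}"
proof -
  let ?O = "{A *v v | A. A \<in> grading_group br h}"
  have "closedin (subtopology (zariski vec_coords) (hC 1)) ?O" using assms by (simp add: stable_vector_def)
  then obtain Z where Z: "closedin (zariski vec_coords) Z" "?O = Z \<inter> hC 1"
    by (auto simp: closedin_subtopology)
  have "closed Z" by (rule closedin_zariski_imp_closed[OF continuous_on_vec_coords Z(1)])
  moreover have "closed (hC 1)" by (rule closed_subspace[OF hC_subspace])
  ultimately show ?thesis unfolding Z(2) by (rule closed_Int)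
qed

text \<open>Kempf--Ness: a vector of minimal norm in the closed orbit commutes with its conjugate.\<close>

lemma adapted_struct_exists:
  assumes T: "stable_vector br h T"
  obtains S where "cstruct S" "graded_struct S" "cb T (sg S T) = 0"
proof -
  obtain t where t: "cstruct (mat_complex t)" "graded_struct (mat_complex t)"
    by (rule base_cstruct)
  define S where "S = mat_complex t"
  have S: "cstruct S" "graded_struct S" using t by (simp_all add: S_def)
  note rs = cstruct_rstruct[OF S(1)]
  interpret G: matrix_group "grading_group br h" by (rule matrix_group_grading)
  let ?O = "{A *v T | A. A \<in> grading_group br h}"
  let ?f = "\<lambda>x. hform S x x"
  have bbb: "bounded_bilinear (hform S)" using hform_bilinear[of S] by (simp add: bilinear_conv_bounded_bilinear)
  obtain c where c: "0 < c" "\<And>x. c * (norm x)\<^sup>2 \<le> hform S x x"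
    by (rule pos_def_coercive[OF hform_bilinear[of S] hform_pos[OF S(1)]]) auto
  have TO: "T \<in> ?O" using G.one_mem by force
  \<comment> \<open>Coercivity of the form puts every orbit point no longer than \<open>T\<close>
    into this ball, so a minimum over the compact set \<open>?K\<close> is a minimum over the whole
    orbit.\<close>
  let ?K = "?O \<inter> cball 0 (sqrt (?f T / c))"
  have inK: "x \<in> ?K" if "x \<in> ?O" "?f x \<le> ?f T" for x
  proof -
    have "c * (norm x)\<^sup>2 \<le> ?f T" using c(2)[of x] that(2) by linarith
    then have "(norm x)\<^sup>2 \<le> ?f T / c" using c(1) by (simp add: field_simps)
    then show ?thesis using that(1) by (simp add: real_le_rsqrt)
  qed
  have comp: "compact ?K" using stable_orbit_closed[OF T] by (intro closed_Int_compact compact_cball)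
  have TK: "T \<in> ?K" by (rule inK[OF TO]) simp
  then have ne: "?K \<noteq> {}" by blast
  have cont: "continuous_on ?K ?f"
    by (rule bounded_bilinear.continuous_on[OF bbb continuous_on_id continuous_on_id])
  obtain v where v: "v \<in> ?K" "\<forall>x\<in>?K. ?f v \<le> ?f x"
    using continuous_attains_inf[OF comp ne cont] by (elim bexE)
  have min: "?f v \<le> ?f x" if "x \<in> ?O" for x
  proof (cases "?f x \<le> ?f T")
    case True then show ?thesis using v(2) inK[OF that] by simp
  next
    case False
    moreover have "?f v \<le> ?f T" using v(2) TK by simp
    ultimately show ?thesis by linarith
  qed
  obtain g where g: "g \<in> grading_group br h" "v = g *v T" using v(1) by blast
  have gg: "g \<in> graded_Aut br h" by (rule grading_group_graded[OF g(1)])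
  have gA: "g \<in> lie_Aut br" by (rule graded_AutD(1)[OF gg])
  have ig: "invertible g" by (rule G.invertible_mem[OF g(1)])
  have TC: "T \<in> hC 1" using T by (simp add: stable_vector_def)
  have vC: "v \<in> hC 1" unfolding g(2) by (rule graded_AutD(2)[OF gg TC])
  \<comment> \<open>The direction in which to vary \<open>v\<close>: \<open>z\<close> has degree 0
    and \<open>sg S z = - z\<close>, so \<open>exp (t ad z)\<close> lies in the grading group. The
    derivative of the squared norm along it is \<open>- 2 * hform S z z\<close>, and minimality
    gives \<open>z = 0\<close>.\<close>
  define z where "z = cb v (sg S v)"
  have zC: "z \<in> hC 0"
  proof -
    have "sg S v \<in> hC (- 1)" using S(2) vC by (simp add: graded_struct_def)
    then show ?thesis using hC_cb[OF vC, of "sg S v" "-1"] by (simp add: z_def)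
  qed
  have sz: "sg S z = - z" unfolding z_def sg_cb[OF rs] sg_sg[OF rs] by (rule cb_skew)
  let ?L = "adc z"
  have sa: "selfadj S ?L" by (rule selfadj_adc[OF rs sz])
  have L: "rdiag ?L" by (rule selfadj_rdiag[OF S(1) sa])
  have W: "hC i \<subseteq> span {x \<in> hC i. \<exists>l. ?L *v x = l *\<^sub>R x}" for i
  proof (rule selfadj_spectral[OF S(1) sa hC_subspace])
    fix x assume "x \<in> hC i"
    then show "?L *v x \<in> hC i" using hC_cb[OF zC, of x i] by simp
  qed
  have E: "mexp ?L s \<in> grading_group br h" for s
    by (rule mexp_grading_group[OF L derivc_adc W])
  have EO: "mexp ?L s *v v \<in> ?O" for s
    unfolding g(2) matrix_vector_mul_assoc using G.mult_mem[OF E g(1)] by blast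
  let ?p = "\<lambda>t::real. mexp ?L (1 * of_real t) *v v"
  have dp: "(?p has_vector_derivative csm 1 ?L *v v) (at 0)"
    by (rule bounded_linear.has_vector_derivative[OF bounded_linear_matrix_apply mexp_has_vector_derivative[OF L]])
  have p0: "?p 0 = v" by (simp add: mexp_0[OF L])
  have "((\<lambda>t. ?f (?p t)) has_vector_derivative
      hform S (?p 0) (csm 1 ?L *v v) + hform S (csm 1 ?L *v v) (?p 0)) (at 0)"
    by (rule bounded_bilinear.has_vector_derivative[OF bbb dp dp])
  then have "((\<lambda>t. ?f (?p t)) has_real_derivative 2 * hform S (cb z v) v) (at 0)"
    unfolding p0 hform_sym[OF rs, of v]
    by (simp add: has_real_derivative_iff_has_vector_derivative csm_apply)
  then have "2 * hform S (cb z v) v = 0"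
  proof (rule DERIV_local_min[of _ _ _ 1])
    show "\<forall>y. \<bar>0 - y\<bar> < 1 \<longrightarrow> ?f (?p 0) \<le> ?f (?p y)" unfolding p0 using min[OF EO] by simp
  qed simp
  moreover have "hform S (cb z v) v = - hform S z z"
    by (simp add: hform_def killc_invariant z_def[symmetric] sz killc_minus)
  ultimately have "hform S z z = 0" by simp
  then have z0: "z = 0" using hform_pos[OF S(1), of z] by (cases "z = 0") auto
  \<comment> \<open>The condition \<open>[v, \<sigma> v] = 0\<close> at \<open>v = g T\<close> is
    pulled back to \<open>T\<close> by replacing the structure with its conjugate under
    \<open>g\<close>.\<close>
  let ?S = "matrix_inv g ** S ** mat_cnj g"
  have "cb T (sg ?S T) = matrix_inv g *v cb v (sg S v)"
  proof -
    have iA: "matrix_inv g \<in> lie_Aut br" by (rule matrix_group.inv_mem[OF matrix_group_Aut gA])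
    show ?thesis
      unfolding lie_Aut_apply[OF iA] sg_conj[OF ig] g(2) by (simp add: matrix_vector_cancel[OF ig])
  qed
  then have "cb T (sg ?S T) = 0" using z0 by (simp add: z_def)
  then show ?thesis
    by (rule that[OF cstruct_conj[OF S(1) gA] graded_struct_conj[OF S(2) gg]])
qed

text \<open>Complex conjugation fixes a real vector \<open>T\<close>, so by uniqueness it fixes the structure adapted to \<open>T\<close>.\<close>

lemma real_adapted_struct_exists:
  assumes T: "stable_vector br h (vec_complex T)"
  obtains t where "cstruct (mat_complex t)" "graded_struct (mat_complex t)" "br T (t *v T) = 0"
proof -
  let ?T = "vec_complex T"
  obtain S where S: "cstruct S" "graded_struct S" "cb ?T (sg S ?T) = 0"
    by (rule adapted_struct_exists[OF T])
  have "sg (mat_cnj S) ?T = vcnj (sg S ?T)" by (simp add: sg_def vcnj_mult)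
  then have "cb ?T (sg (mat_cnj S) ?T) = vcnj (cb ?T (sg S ?T))"
    using cb_cnj[of ?T "sg S ?T"] by simp
  then have 0: "cb ?T (sg (mat_cnj S) ?T) = 0" using S(3) by simp
  have "mat_cnj S = S"
    by (rule adapted_struct_unique[OF cstruct_cnj[OF S(1)] graded_struct_cnj[OF S(2)] 0 S])
      (use T in \<open>simp add: stable_vector_def\<close>)
  then obtain t where t: "S = mat_complex t" using mat_cnj_fixed by blast
  have "vec_complex (br T (t *v T)) = 0"
    using S(3) by (simp add: t sg_def mat_complex_apply cb_real)
  then have "br T (t *v T) = 0" by (simp add: vec_complex_def vec_eq_iff)
  then show ?thesis using that S(1,2) t by simp
qed

end

section \<open>From real structures to Cartan involutions\<close>

lemma norm_vec_le_sum: "norm (x::'a::real_normed_vector^'n) \<le> (\<Sum>i\<in>UNIV. norm (x $ i))"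
  unfolding norm_vec_def by (rule L2_set_le_sum) simp

lemma tendsto_mat_cnj [tendsto_intros]:
  "(f \<longlongrightarrow> A) F \<Longrightarrow> ((\<lambda>x. mat_cnj (f x)) \<longlongrightarrow> mat_cnj A) F"
  unfolding mat_cnj_def by (intro tendsto_vec_lambda tendsto_cnj tendsto_vec_nth)

context graded_lie
begin

lemma tendsto_cb:
  assumes "(f \<longlongrightarrow> x) F" "(g \<longlongrightarrow> y) F" shows "((\<lambda>a. cb (f a) (g a)) \<longlongrightarrow> cb x y) F"
proof -
  have "bilinear cb"
    by (subst bilinear_def) (auto intro!: linearI simp: cb_add_left cb_add_right cb_scaleR)
  then have "bounded_bilinear cb" by (simp add: bilinear_conv_bounded_bilinear)
  then show ?thesis using assms by (rule bounded_bilinear.tendsto)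
qed

lemma lie_Aut_closed:
  assumes "\<And>n::nat. f n \<in> lie_Aut br" "f \<longlonglongrightarrow> A" "det A \<noteq> 0"
  shows "A \<in> lie_Aut br"
proof -
  have "A *v cb x y = cb (A *v x) (A *v y)" for x y
  proof (rule LIMSEQ_unique)
    show "(\<lambda>n. f n *v cb x y) \<longlonglongrightarrow> A *v cb x y"
      by (intro tendsto_matrix_vector_mult assms tendsto_const)
    have "(\<lambda>n. cb (f n *v x) (f n *v y)) \<longlonglongrightarrow> cb (A *v x) (A *v y)"
      by (intro tendsto_cb tendsto_matrix_vector_mult assms tendsto_const)
    then show "(\<lambda>n. f n *v cb x y) \<longlonglongrightarrow> cb (A *v x) (A *v y)"
      using lie_Aut_apply[OF assms(1)] by simp
  qed
  then show ?thesis using assms(3) by (simp add: lie_Aut_def invertible_det_nz)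
qed

lemma graded_Aut_closed:
  assumes "\<And>n::nat. f n \<in> graded_Aut br h" "f \<longlonglongrightarrow> A" "det A \<noteq> 0"
  shows "A \<in> graded_Aut br h"
proof (rule graded_AutI)
  show "A \<in> lie_Aut br" by (rule lie_Aut_closed[OF graded_AutD(1)[OF assms(1)] assms(2,3)])
  fix i x assume x: "x \<in> hC i"
  have cl: "closed (hC i)" by (rule closed_subspace[OF hC_subspace])
  show "A *v x \<in> hC i"
  proof (rule closed_sequentially[OF cl])
    show "f n *v x \<in> hC i" for n by (rule graded_AutD(2)[OF assms(1) x])
    show "(\<lambda>n. f n *v x) \<longlonglongrightarrow> A *v x" by (intro tendsto_matrix_vector_mult assms tendsto_const)
  qed
  show "matrix_inv A *v x \<in> hC i"
  proof (rule closed_sequentially[OF cl])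
    show "matrix_inv (f n) *v x \<in> hC i" for n by (rule graded_AutD(3)[OF assms(1) x])
    show "(\<lambda>n. matrix_inv (f n) *v x) \<longlonglongrightarrow> matrix_inv A *v x"
      by (intro tendsto_matrix_vector_mult tendsto_matrix_inv assms tendsto_const)
  qed
qed

definition conj_inv :: "real^'n^'n \<Rightarrow> (complex^'n^'n) set \<Rightarrow> complex^'n^'n \<Rightarrow> complex^'n^'n" where
  "conj_inv t M = restrict (\<lambda>A. mat_complex t ** A ** mat_complex t) M"

lemma real_struct_square: "rstruct (mat_complex t) \<Longrightarrow> mat_complex t ** mat_complex t = mat 1"
  by (simp add: rstruct_def)

text \<open>As \<open>t\<close> squares to 1, the equation reads
  \<open>S ** mat_cnj A = A ** S\<close>. The compact group in the definition of a Cartan involution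
  is thereby the centraliser of the real structure.\<close>

lemma fixed_iff_commute:
  assumes S: "rstruct (mat_complex t)"
  shows "mat_complex t ** A ** mat_complex t = mat_cnj A
    \<longleftrightarrow> (\<forall>x. sg (mat_complex t) (A *v x) = A *v sg (mat_complex t) x)" (is "?l \<longleftrightarrow> ?r")
proof -
  let ?S = "mat_complex t"
  note SS = real_struct_square[OF S]
  have e: "sg ?S (A *v x) = (?S ** mat_cnj A) *v vcnj x" "A *v sg ?S x = (A ** ?S) *v vcnj x" for x
    by (simp_all add: sg_def vcnj_mult matrix_vector_mul_assoc)
  have "?r \<longleftrightarrow> (\<forall>z. (?S ** mat_cnj A) *v z = (A ** ?S) *v z)"
    unfolding e by (metis vcnj_vcnj)
  also have "\<dots> \<longleftrightarrow> ?S ** mat_cnj A = A ** ?S" by (simp add: matrix_eq)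
  also have "\<dots> \<longleftrightarrow> ?l"
  proof
    assume "?S ** mat_cnj A = A ** ?S"
    then have "?S ** (A ** ?S) = ?S ** ?S ** mat_cnj A" by (simp add: matrix_mul_assoc[symmetric])
    then show ?l by (simp add: SS matrix_mul_assoc)
  next
    assume l: ?l
    have "?S ** mat_cnj A = ?S ** ?S ** A ** ?S" unfolding l[symmetric] by (simp add: matrix_mul_assoc)
    then show "?S ** mat_cnj A = A ** ?S" by (simp add: SS)
  qed
  finally show ?thesis by simp
qed

lemma hform_commute:
  assumes A: "A \<in> lie_Aut br" and c: "\<And>x. sg S (A *v x) = A *v sg S x"
  shows "hform S (A *v x) (A *v y) = hform S x y"
  by (simp add: hform_def c killc_Aut[OF A])

lemma hform_isometry_bound:
  assumes S: "cstruct S"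
  obtains b where "\<And>A :: complex^'n^'n. (\<And>x. hform S (A *v x) (A *v x) = hform S x x) \<Longrightarrow> norm A \<le> b"
proof -
  obtain c where c: "0 < c" "\<And>x. c * (norm x)\<^sup>2 \<le> hform S x x"
    by (rule pos_def_coercive[OF hform_bilinear[of S] hform_pos[OF S]]) auto
  define b where "b = (\<Sum>i\<in>(UNIV::'n set). \<Sum>j\<in>(UNIV::'n set). sqrt (hform S (axis j 1) (axis j 1) / c))"
  have "norm A \<le> b" if A: "\<And>x. hform S (A *v x) (A *v x) = hform S x x" for A :: "complex^'n^'n"
  proof -
    have "norm (A $ i $ j) \<le> sqrt (hform S (axis j 1) (axis j 1) / c)" for i j
    proof -
      have "A $ i $ j = (A *v axis j 1) $ i"
        by (simp add: matrix_vector_mult_def axis_def if_distrib cong: if_cong)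
      then have "norm (A $ i $ j) \<le> norm (A *v axis j 1)" by (simp add: Finite_Cartesian_Product.norm_nth_le)
      also have "\<dots> \<le> sqrt (hform S (axis j 1) (axis j 1) / c)"
        using c(2)[of "A *v axis j 1"] c(1) by (intro real_le_rsqrt) (simp add: A field_simps)
      finally show ?thesis .
    qed
    moreover have "norm A \<le> (\<Sum>i\<in>UNIV. \<Sum>j\<in>UNIV. norm (A $ i $ j))"
      by (rule order_trans[OF norm_vec_le_sum]) (intro sum_mono norm_vec_le_sum)
    ultimately show ?thesis
      unfolding b_def by (meson order_trans sum_mono)
  qed
  then show ?thesis by (rule that)
qed

lemma hform_isometry_det:
  assumes S: "cstruct S" and A: "\<And>x. hform S (A *v x) (A *v x) = hform S x x"
  shows "det A \<noteq> 0"
proof -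
  have "x = 0" if "A *v x = 0" for x
  proof (rule ccontr)
    assume "x \<noteq> 0"
    then have "0 < hform S x x" by (rule hform_pos[OF S])
    then show False using A[of x] that by (simp add: bilinear_lzero[OF hform_bilinear])
  qed
  then have "\<exists>B. B ** A = mat 1" unfolding matrix_left_invertible_ker by blast
  then show ?thesis by (metis invertible_det_nz invertible_left_inverse)
qed

text \<open>Automorphisms commuting with the structure are isometries of \<open>hform\<close>, hence
  bounded. A limit of isometries is an isometry and so invertible, which makes the closedness
  hypothesis on \<open>M1\<close> applicable.\<close>

lemma compact_fixed_group:
  assumes S: "cstruct (mat_complex t)" and M1: "M1 \<subseteq> lie_Aut br"
    and cl: "\<And>f A. (\<And>n::nat. f n \<in> M1) \<Longrightarrow> f \<longlonglongrightarrow> A \<Longrightarrow> det A \<noteq> 0 \<Longrightarrow> A \<in> M1"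
  shows "compact {A \<in> identity_component M1. mat_complex t ** A ** mat_complex t = mat_cnj A}"
    (is "compact ?K")
proof -
  let ?S = "mat_complex t"
  note rs = cstruct_rstruct[OF S]
  have iso: "hform ?S (A *v x) (A *v x) = hform ?S x x" if "A \<in> ?K" for A x
  proof -
    have "A \<in> lie_Aut br" using that M1 identity_component_subset by blast
    then show ?thesis
      by (rule hform_commute) (use that fixed_iff_commute[OF rs, of A] in simp)
  qed
  obtain b where b: "\<And>A. (\<And>x. hform ?S (A *v x) (A *v x) = hform ?S x x) \<Longrightarrow> norm A \<le> b"
    by (rule hform_isometry_bound[OF S]) blast
  have "bounded ?K" by (rule boundedI[of _ b]) (rule b, rule iso)
  moreover have "closed ?K"
    unfolding closed_sequential_limits
  proof (intro allI impI, elim conjE)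
    fix f A assume f: "\<forall>n. f n \<in> ?K" and lim: "f \<longlonglongrightarrow> A"
    obtain Z where Z: "closed Z" "identity_component M1 = Z \<inter> M1" by (rule identity_component_closed)
    have "A \<in> Z" by (rule closed_sequentially[OF Z(1) _ lim]) (use f Z(2) in auto)
    have bbb: "bounded_bilinear (hform ?S)" using hform_bilinear[of ?S] by (simp add: bilinear_conv_bounded_bilinear)
    have "hform ?S (A *v x) (A *v x) = hform ?S x x" for x
    proof (rule LIMSEQ_unique)
      show "(\<lambda>n. hform ?S (f n *v x) (f n *v x)) \<longlonglongrightarrow> hform ?S (A *v x) (A *v x)"
        by (intro bounded_bilinear.tendsto[OF bbb] tendsto_matrix_vector_mult lim tendsto_const)
      show "(\<lambda>n. hform ?S (f n *v x) (f n *v x)) \<longlonglongrightarrow> hform ?S x x"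
        using f iso by simp
    qed
    then have det: "det A \<noteq> 0" by (rule hform_isometry_det[OF S])
    have "A \<in> M1" by (rule cl[OF _ lim det]) (use f identity_component_subset in blast)
    moreover have "?S ** A ** ?S = mat_cnj A"
    proof (rule LIMSEQ_unique)
      show "(\<lambda>n. ?S ** f n ** ?S) \<longlonglongrightarrow> ?S ** A ** ?S"
        by (intro tendsto_matrix_mult lim tendsto_const)
      have "(\<lambda>n. mat_cnj (f n)) \<longlonglongrightarrow> mat_cnj A" by (rule tendsto_mat_cnj[OF lim])
      then show "(\<lambda>n. ?S ** f n ** ?S) \<longlonglongrightarrow> mat_cnj A" using f by simp
    qed
    ultimately show "A \<in> ?K" using \<open>A \<in> Z\<close> Z(2) by simp
  qed
  ultimately show ?thesis by (simp add: compact_eq_bounded_closed)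
qed

text \<open>Polar decomposition: \<open>A\<close> is joined to \<open>A (A\<^sup>* A)\<^sup>-\<^sup>1\<^sup>/\<^sup>2\<close> inside the group.\<close>

lemma polar_path:
  assumes S: "cstruct (mat_complex t)" and A: "A \<in> lie_Aut br"
    and P_def: "P = mat_complex t ** mat_cnj (matrix_inv A) ** mat_complex t ** A"
  obtains L where "rdiag L" "derivc L" "\<And>l x. P *v x = l *\<^sub>R x \<Longrightarrow> L *v x = ln l *\<^sub>R x"
    "mat_complex t ** (A ** mexp L (- 1 / 2)) ** mat_complex t = mat_cnj (A ** mexp L (- 1 / 2))"
    "selfadj (mat_complex t) P"
proof -
  let ?S = "mat_complex t"
  note rs = cstruct_rstruct[OF S]
  interpret Aut: matrix_group "lie_Aut br" by (rule matrix_group_Aut)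
  have iA: "invertible A" by (rule Aut.invertible_mem[OF A])
  have SA: "?S \<in> lie_Aut br" using rs by (simp add: rstruct_def)
  have invA: "matrix_inv A \<in> lie_Aut br" by (rule Aut.inv_mem[OF A])
  have PA: "P \<in> lie_Aut br" unfolding P_def by (intro Aut.mult_mem SA A lie_Aut_cnj invA)
  have Px: "P *v x = sg ?S (matrix_inv A *v sg ?S (A *v x))" for x
    by (simp add: P_def sg_def vcnj_mult mat_cnj_mult matrix_vector_mul_assoc matrix_mul_assoc)
  \<comment> \<open>So \<open>P\<close> is the adjoint of \<open>A\<close>, with respect to
    \<open>hform\<close>, composed with \<open>A\<close>: self-adjoint with positive
    eigenvalues.\<close>
  have hP: "hform ?S (P *v x) y = hform ?S (A *v x) (A *v y)" for x y
  proof -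
    have "killc (P *v x) (sg ?S y) = cnj (killc (matrix_inv A *v sg ?S (A *v x)) y)"
      unfolding Px by (rule killc_sg[OF rs])
    also have "killc (matrix_inv A *v sg ?S (A *v x)) y = killc (sg ?S (A *v x)) (A *v y)"
      using killc_Aut[OF A, of "matrix_inv A *v sg ?S (A *v x)" y] by (simp add: matrix_vector_cancel[OF iA])
    finally have "hform ?S (P *v x) y = hform ?S (A *v y) (A *v x)"
      by (simp add: hform_def killc_sym[of _ "A *v y"])
    then show ?thesis by (simp add: hform_sym[OF rs, of "A *v y"])
  qed
  have sa: "selfadj ?S P" unfolding selfadj_def
    using hP hform_sym[OF rs] by metis
  have diag: "rdiag P" by (rule selfadj_rdiag[OF S sa])
  have pos: "0 < l" if x: "P *v x = l *\<^sub>R x" "x \<noteq> 0" for l x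
  proof -
    have "A *v x \<noteq> 0" using x(2) matrix_vector_cancel(1)[OF iA, of x] by auto
    then have "0 < hform ?S (P *v x) x" unfolding hP by (rule hform_pos[OF S])
    then have "0 < l * hform ?S x x" unfolding x(1) by (simp add: bilinear_lmul[OF hform_bilinear])
    then show ?thesis using hform_pos[OF S x(2)] by (simp add: zero_less_mult_iff)
  qed
  have "\<exists>L. rdiag L \<and> mexp L 1 = P \<and> (\<forall>l x. P *v x = l *\<^sub>R x \<longrightarrow> L *v x = ln l *\<^sub>R x)"
    by (rule rdiag_log[OF diag]) (use pos in auto)
  then obtain L where L': "rdiag L" "mexp L 1 = P" "\<forall>l x. P *v x = l *\<^sub>R x \<longrightarrow> L *v x = ln l *\<^sub>R x"
    by (elim exE conjE)
  note L = L'(1,2) L'(3)[rule_format]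
  have D: "derivc L" by (rule log_derivc[OF PA diag _ L(3)]) (use pos in auto)
  have PsP: "P *v sg ?S (P *v x) = sg ?S x" for x
    by (simp add: Px sg_sg[OF rs] matrix_vector_cancel[OF iA])
  \<comment> \<open>From \<open>P \<sigma> P = \<sigma>\<close> the structure takes the eigenvalue
    \<open>exp l\<close> of \<open>P\<close> to \<open>exp (- l)\<close>.\<close>
  have Lsg: "L *v sg ?S x = ((- 1) * l) *\<^sub>R sg ?S x" if x: "L *v x = l *\<^sub>R x" for l x
  proof -
    have "P *v x = exp l *\<^sub>R x"
      using mexp_apply[OF L(1) x, of 1] L(2) by (simp add: exp_of_real scaleR_eq_smult)
    then have "P *v (exp l *\<^sub>R sg ?S x) = sg ?S x" using PsP[of x] by (simp add: sg_scaleR)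
    then have "exp l *\<^sub>R (P *v sg ?S x) = sg ?S x" by (simp add: matrix_vector_scaleR)
    then have "exp (- l) *\<^sub>R (exp l *\<^sub>R (P *v sg ?S x)) = exp (- l) *\<^sub>R sg ?S x" by simp
    then have "P *v sg ?S x = exp (- l) *\<^sub>R sg ?S x" by (simp add: exp_minus)
    from L(3)[OF this] show ?thesis by simp
  qed
  have sgE: "sg ?S (mexp L (1 / 2) *v x) = mexp L (- 1 / 2) *v sg ?S x" for x
    using mexp_intertwine[OF L(1) L(1) linear_sg[of ?S] Lsg, of "- 1 / 2" x] by (simp add: sg_smult)
  let ?k = "A ** mexp L (- 1 / 2)"
  \<comment> \<open>The definition of \<open>P\<close> says
    \<open>A \<sigma> P = \<sigma> A\<close>, and moving the inverse square root of \<open>P\<close>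
    past \<open>\<sigma>\<close> turns it into the square root.\<close>
  have "sg ?S (?k *v x) = ?k *v sg ?S x" for x
  proof -
    let ?y = "mexp L (- 1 / 2) *v x"
    have half: "mexp L (1 / 2) = P ** mexp L (- 1 / 2)"
      using mexp_add[OF L(1), of 1 "- 1 / 2"] by (simp add: L(2))
    have "?k *v sg ?S x = A *v sg ?S (mexp L (1 / 2) *v x)"
      by (simp add: sgE matrix_vector_mul_assoc)
    also have "mexp L (1 / 2) *v x = P *v ?y" unfolding half by (simp add: matrix_vector_mul_assoc)
    also have "A *v sg ?S (P *v ?y) = sg ?S (A *v ?y)"
      by (simp add: Px sg_sg[OF rs] matrix_vector_cancel[OF iA])
    finally show ?thesis by (simp add: matrix_vector_mul_assoc)
  qed
  then have "?S ** ?k ** ?S = mat_cnj ?k" using fixed_iff_commute[OF rs, of ?k] by simp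
  then show ?thesis using that[OF L(1) D L(3) _ sa] by simp
qed

text \<open>Stated for an abstract group so as to serve both the full and the graded automorphisms.
  The hypothesis \<open>ex\<close> asks that powers of positive elements stay in the group; the
  polar path then brings each component to the compact group.\<close>

lemma conj_inv_cartan:
  assumes S: "cstruct (mat_complex t)" and M1: "M1 \<subseteq> lie_Aut br" and grp: "matrix_group M1"
    and cl: "\<And>f A. (\<And>n::nat. f n \<in> M1) \<Longrightarrow> f \<longlonglongrightarrow> A \<Longrightarrow> det A \<noteq> 0 \<Longrightarrow> A \<in> M1"
    and conj: "\<And>A. A \<in> M1 \<Longrightarrow> mat_complex t ** A ** mat_complex t \<in> M1"
    and cnj: "\<And>A. A \<in> M1 \<Longrightarrow> mat_cnj A \<in> M1"
    and ex: "\<And>P L s. P \<in> M1 \<Longrightarrow> selfadj (mat_complex t) P \<Longrightarrow> rdiag L \<Longrightarrow> derivc L \<Longrightarrow>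
        (\<forall>l x. P *v x = l *\<^sub>R x \<longrightarrow> L *v x = ln l *\<^sub>R x) \<Longrightarrow> mexp L s \<in> M1"
  shows "conj_inv t (identity_component M1) \<in> cartan_involutions (identity_component M1)"
proof -
  let ?S = "mat_complex t" and ?M = "identity_component M1"
  note rs = cstruct_rstruct[OF S]
  note SS = real_struct_square[OF rs]
  interpret M1: matrix_group M1 by (rule grp)
  interpret M: matrix_group ?M by (rule M1.matrix_group_idc)
  have app: "conj_inv t ?M A = ?S ** A ** ?S" if "A \<in> ?M" for A using that by (simp add: conj_inv_def)
  have mem: "?S ** A ** ?S \<in> ?M" if "A \<in> ?M" for A
    by (rule identity_component_map[OF continuous_map_zariski_conjugation conj M.one_mem _ that])
      (simp_all add: SS M.one_mem)
  have "alg_involution ?M (conj_inv t ?M)"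
    unfolding alg_involution_def
  proof (intro conjI ballI)
    show "conj_inv t ?M \<in> ?M \<rightarrow>\<^sub>E ?M" using mem by (auto simp: conj_inv_def)
    show "regular_over_reals ?M (conj_inv t ?M)"
      unfolding regular_over_reals_def
    proof (intro allI)
      fix i j
      have "(\<lambda>A. (?S ** A ** ?S) $ i $ j) \<in> poly_funs \<real> mat_coords"
        by (rule poly_funs_conjugation) (simp_all add: mat_complex_def)
      then show "\<exists>p\<in>poly_funs \<real> mat_coords. \<exists>k::nat. \<forall>A\<in>?M. conj_inv t ?M A $ i $ j = p A / det A ^ k"
        by (rule bexI[rotated]) (intro exI[of _ 0], simp add: app)
    qed
    fix A assume A: "A \<in> ?M"
    show "conj_inv t ?M (conj_inv t ?M A) = A"
    proof -
      have "?S ** (?S ** A ** ?S) ** ?S = (?S ** ?S) ** A ** (?S ** ?S)" by (simp only: matrix_mul_assoc)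
      then show ?thesis using A mem[OF A] by (simp add: app SS)
    qed
    fix B assume B: "B \<in> ?M"
    have "(?S ** A ** ?S) ** (?S ** B ** ?S) = ?S ** A ** (?S ** ?S) ** B ** ?S" by (simp only: matrix_mul_assoc)
    then show "conj_inv t ?M (A ** B) = conj_inv t ?M A ** conj_inv t ?M B"
      using A B M.mult_mem[OF A B] by (simp add: app SS matrix_mul_assoc)
  qed
  moreover have K: "{A \<in> ?M. conj_inv t ?M A = mat_cnj A} = {A \<in> ?M. ?S ** A ** ?S = mat_cnj A}"
    using app by auto
  have "compact {A \<in> ?M. conj_inv t ?M A = mat_cnj A}"
    unfolding K by (rule compact_fixed_group[OF S M1 cl])
  moreover have "C \<inter> {A \<in> ?M. conj_inv t ?M A = mat_cnj A} \<noteq> {}" if C: "C \<in> components ?M" for C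
  proof -
    obtain A where A: "A \<in> C" using in_components_nonempty[OF C] by blast
    have AM: "A \<in> ?M" using A in_components_subset[OF C] by blast
    then have AM1: "A \<in> M1" using identity_component_subset by blast
    define P where "P = ?S ** mat_cnj (matrix_inv A) ** ?S ** A"
    have PM: "P \<in> M1" unfolding P_def by (intro M1.mult_mem conj cnj M1.inv_mem AM1)
    obtain L where L: "rdiag L" "derivc L" "\<forall>l x. P *v x = l *\<^sub>R x \<longrightarrow> L *v x = ln l *\<^sub>R x"
      "?S ** (A ** mexp L (- 1 / 2)) ** ?S = mat_cnj (A ** mexp L (- 1 / 2))" "selfadj ?S P"
      by (rule polar_path[OF S _ P_def]) (use AM1 M1 in auto)
    have E: "mexp L s \<in> ?M" for s
      by (rule mexp_path[OF L(1) ex[OF PM L(5,1,2,3)] M1.one_mem])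
    \<comment> \<open>This path runs from \<open>A\<close> at \<open>r = 0\<close> to the fixed
      polar factor at \<open>r = 1\<close>. It stays in the Zariski identity component and is
      Euclidean connected, hence stays in \<open>C\<close>.\<close>
    let ?g = "\<lambda>r::real. A ** mexp L ((- 1 / 2) * of_real r)"
    have gM: "?g r \<in> ?M" for r by (rule M.mult_mem[OF AM E])
    have cont: "continuous_on UNIV ?g"
      using continuous_on_mexp[OF L(1), of "- 1 / 2"] unfolding continuous_on_def
      by (auto intro!: tendsto_matrix_mult)
    have "connected (range ?g)" by (rule connected_continuous_image[OF cont connected_UNIV])
    moreover have "A \<in> range ?g" by (rule range_eqI[of _ _ 0]) (simp add: mexp_0[OF L(1)])
    ultimately have "range ?g \<subseteq> C"
      using components_maximal[OF C, of "range ?g"] gM A by blast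
    then have "?g 1 \<in> C" by blast
    moreover have "?g 1 \<in> {A \<in> ?M. conj_inv t ?M A = mat_cnj A}" unfolding K using gM[of 1] L(4) by simp
    ultimately show ?thesis by blast
  qed
  ultimately show ?thesis by (simp add: cartan_involutions_def)
qed

lemma conj_inv_cartan_adjoint:
  assumes S: "cstruct (mat_complex t)"
  shows "conj_inv t (adjoint_group br) \<in> cartan_involutions (adjoint_group br)"
  unfolding adjoint_group_def
proof (rule conj_inv_cartan[OF S order_refl matrix_group_Aut lie_Aut_closed])
  have "mat_complex t \<in> lie_Aut br" using S by (simp add: cstruct_def rstruct_def)
  then show "mat_complex t ** A ** mat_complex t \<in> lie_Aut br" if "A \<in> lie_Aut br" for A
    using that by (intro matrix_group.mult_mem[OF matrix_group_Aut])
qed (simp_all add: lie_Aut_cnj mexp_Aut)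

lemma graded_Aut_cnj:
  assumes A: "A \<in> graded_Aut br h" shows "mat_cnj A \<in> graded_Aut br h"
proof (rule graded_AutI)
  have iA: "invertible A" by (rule matrix_group.invertible_mem[OF matrix_group_graded A])
  show "mat_cnj A \<in> lie_Aut br" by (rule lie_Aut_cnj[OF graded_AutD(1)[OF A]])
  fix i x assume x: "x \<in> hC i"
  have e: "mat_cnj B *v x = vcnj (B *v vcnj x)" for B :: "complex^'n^'n" by (simp add: vcnj_mult)
  show "mat_cnj A *v x \<in> hC i" unfolding e by (intro hC_cnj graded_AutD(2)[OF A] x)
  show "matrix_inv (mat_cnj A) *v x \<in> hC i"
    unfolding mat_cnj_matrix_inv(1)[OF iA] e by (intro hC_cnj graded_AutD(3)[OF A] x)
qed

lemma conj_inv_cartan_grading: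
  assumes S: "cstruct (mat_complex t)" and gr: "graded_struct (mat_complex t)"
  shows "conj_inv t (grading_group br h) \<in> cartan_involutions (grading_group br h)"
  unfolding grading_group_def
proof (rule conj_inv_cartan[OF S _ matrix_group_graded graded_Aut_closed])
  let ?S = "mat_complex t"
  interpret Aut: matrix_group "lie_Aut br" by (rule matrix_group_Aut)
  have SA: "?S \<in> lie_Aut br" using S by (simp add: cstruct_def rstruct_def)
  have SS: "?S ** ?S = mat 1" by (rule real_struct_square[OF cstruct_rstruct[OF S]])
  have invS: "invertible ?S" "matrix_inv ?S = ?S" using matrix_inv_unique[OF SS] by simp_all
  show "graded_Aut br h \<subseteq> lie_Aut br" using graded_AutD(1) by blast
  have Sh: "?S *v x \<in> hC (- i)" if "x \<in> hC i" for x i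
    using gr hC_cnj[OF that] unfolding graded_struct_def sg_def by (metis vcnj_vcnj)
  show "?S ** A ** ?S \<in> graded_Aut br h" if A: "A \<in> graded_Aut br h" for A
  proof (rule graded_AutI)
    have iA: "invertible A" by (rule matrix_group.invertible_mem[OF matrix_group_graded A])
    show "?S ** A ** ?S \<in> lie_Aut br" using graded_AutD(1)[OF A] SA by (intro Aut.mult_mem)
    fix i x assume x: "x \<in> hC i"
    have 1: "?S *v (A *v (?S *v x)) \<in> hC (- (- i))" by (intro Sh graded_AutD(2)[OF A] x)
    then show "(?S ** A ** ?S) *v x \<in> hC i" by (simp add: matrix_vector_mul_assoc[symmetric])
    have "?S *v (matrix_inv A *v (?S *v x)) \<in> hC (- (- i))" by (intro Sh graded_AutD(3)[OF A] x)
    moreover have "matrix_inv (?S ** A ** ?S) = ?S ** matrix_inv A ** ?S"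
      by (simp add: matrix_inv_mult invS iA invertible_mult matrix_mul_assoc)
    ultimately show "matrix_inv (?S ** A ** ?S) *v x \<in> hC i" by (simp add: matrix_vector_mul_assoc[symmetric])
  qed
  show "mat_cnj A \<in> graded_Aut br h" if "A \<in> graded_Aut br h" for A by (rule graded_Aut_cnj[OF that])
  fix P L s assume P: "P \<in> graded_Aut br h" and sa: "selfadj ?S P" and L: "rdiag L" "derivc L"
    and PL: "\<forall>l x. P *v x = l *\<^sub>R x \<longrightarrow> L *v x = ln l *\<^sub>R x"
  show "mexp L s \<in> graded_Aut br h"
  proof (rule mexp_graded[OF L])
    fix i
    have "hC i \<subseteq> span {x \<in> hC i. \<exists>l. P *v x = l *\<^sub>R x}"
      by (rule selfadj_spectral[OF S sa hC_subspace graded_AutD(2)[OF P]])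
    also have "\<dots> \<subseteq> span {x \<in> hC i. \<exists>l. L *v x = l *\<^sub>R x}"
      by (rule span_mono) (use PL in auto)
    finally show "hC i \<subseteq> span {x \<in> hC i. \<exists>l. L *v x = l *\<^sub>R x}" .
  qed
qed

end

section \<open>From Cartan involutions to real structures\<close>

lemma has_derivative_vecI:
  fixes f :: "'b::real_normed_vector \<Rightarrow> 'a::euclidean_space^'n"
  assumes "\<And>i. ((\<lambda>x. f x $ i) has_derivative (\<lambda>x. f' x $ i)) (at a within S)"
  shows "(f has_derivative f') (at a within S)"
proof (rule has_derivative_componentwise_within[THEN iffD2], rule ballI)
  fix b :: "'a^'n" assume "b \<in> Basis"
  then obtain i c where b: "b = axis i c" by (auto simp: Basis_vec_def)
  have "((\<lambda>x. f x $ i \<bullet> c) has_derivative (\<lambda>x. f' x $ i \<bullet> c)) (at a within S)"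
    by (rule bounded_linear.has_derivative[OF bounded_linear_inner_left assms])
  then show "((\<lambda>x. f x \<bullet> b) has_derivative (\<lambda>x. f' x \<bullet> b)) (at a within S)"
    by (simp only: b inner_axis)
qed

lemma poly_funs_det: "det \<in> poly_funs \<real> (mat_coords :: (complex^'n^'n \<Rightarrow> complex) set)"
proof -
  have 1: "(\<lambda>A::complex^'n^'n. \<Prod>i\<in>UNIV. A $ i $ p i) \<in> poly_funs \<real> mat_coords" for p
    by (rule poly_funs_prod[OF finite _ poly_funs_coord]) simp
  have 2: "(\<lambda>_. of_int (sign p)) \<in> poly_funs \<real> (mat_coords :: (complex^'n^'n \<Rightarrow> complex) set)" for p :: "'n \<Rightarrow> 'n"
    by (rule poly_funs.const) simp
  have "(\<lambda>A::complex^'n^'n. \<Sum>p\<in>{p. p permutes UNIV}. of_int (sign p) * (\<Prod>i\<in>UNIV. A $ i $ p i)) \<in> poly_funs \<real> mat_coords"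
    by (rule poly_funs_sum[OF _ _ poly_funs.mult[OF 2 1]]) (simp_all add: finite_permutations)
  then show ?thesis unfolding det_def by simp
qed

lemma poly_funs_power: "1 \<in> K \<Longrightarrow> p \<in> poly_funs K X \<Longrightarrow> (\<lambda>a. p a ^ k) \<in> poly_funs K X"
  by (induction k) (simp_all add: poly_funs.const poly_funs.mult)

text \<open>The derivative at 1 of a polynomial with real coefficients is complex linear and
  commutes with conjugation. Reality of the value at 1 is included so that the product rule
  preserves these properties.\<close>

definition real_hol_deriv ::
    "(complex^'n^'n \<Rightarrow> complex) \<Rightarrow> (complex^'n^'n \<Rightarrow> complex) \<Rightarrow> bool" where
  "real_hol_deriv p D \<longleftrightarrow> p (mat 1) \<in> \<real> \<and> (p has_derivative D) (at (mat 1))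
     \<and> (\<forall>A. D (csm \<i> A) = \<i> * D A) \<and> (\<forall>A. D (mat_cnj A) = cnj (D A))"

lemma poly_funs_real_hol_deriv:
  assumes "p \<in> poly_funs \<real> mat_coords"
  shows "\<exists>D. real_hol_deriv p D"
  using assms
proof induction
  case (const c)
  then have "real_hol_deriv (\<lambda>_. c) (\<lambda>_. 0)" by (simp add: real_hol_deriv_def)
  then show ?case by blast
next
  case (coord f)
  then obtain i j where f: "f = (\<lambda>A. A $ i $ j)" by (auto simp: mat_coords_def)
  have "bounded_linear (\<lambda>A::complex^'a^'a. A $ i $ j)"
    by (rule bounded_linear_compose[OF bounded_linear_vec_nth bounded_linear_vec_nth])
  then have "real_hol_deriv f f"
    by (simp add: real_hol_deriv_def f bounded_linear_imp_has_derivative csm_def mat_cnj_def mat_def)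
  then show ?case by blast
next
  case (add f g)
  then obtain D E where "real_hol_deriv f D" "real_hol_deriv g E" by blast
  then have "real_hol_deriv (\<lambda>a. f a + g a) (\<lambda>A. D A + E A)"
    by (simp add: real_hol_deriv_def has_derivative_add distrib_left)
  then show ?case by blast
next
  case (mult f g)
  then obtain D E where "real_hol_deriv f D" "real_hol_deriv g E" by blast
  note DE = this[unfolded real_hol_deriv_def]
  have d: "((\<lambda>a. f a * g a) has_derivative (\<lambda>A. f (mat 1) * E A + D A * g (mat 1))) (at (mat 1))"
    by (rule has_derivative_mult) (use DE in simp_all)
  have "real_hol_deriv (\<lambda>a. f a * g a) (\<lambda>A. f (mat 1) * E A + D A * g (mat 1))"
    unfolding real_hol_deriv_def using DE by (intro conjI d) (simp_all add: algebra_simps Reals_cnj_iff)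
  then show ?case by blast
qed

text \<open>A derivative within \<open>M\<close> is not determined off the tangent space. The one
  produced here comes from the rational expressions on the ambient space, so its symmetries hold for
  all matrices.\<close>

lemma regular_has_derivative:
  fixes M :: "(complex^'n^'n) set"
  assumes r: "regular_over_reals M \<theta>" and one: "mat 1 \<in> M"
  shows "\<exists>D. (\<theta> has_derivative D) (at (mat 1) within M)
    \<and> (\<forall>A. D (csm \<i> A) = csm \<i> (D A)) \<and> (\<forall>A. D (mat_cnj A) = mat_cnj (D A))"
proof -
  have "\<exists>D. ((\<lambda>A. \<theta> A $ i $ j) has_derivative D) (at (mat 1) within M)
      \<and> (\<forall>A. D (csm \<i> A) = \<i> * D A) \<and> (\<forall>A. D (mat_cnj A) = cnj (D A))" for i j
  proof -
    obtain p k where p: "p \<in> poly_funs \<real> mat_coords" "\<forall>A\<in>M. \<theta> A $ i $ j = p A / det A ^ k"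
      using r unfolding regular_over_reals_def by blast
    obtain D where D: "real_hol_deriv p D" using poly_funs_real_hol_deriv[OF p(1)] by blast
    have "(\<lambda>A::complex^'n^'n. det A ^ k) \<in> poly_funs \<real> mat_coords" by (rule poly_funs_power[OF _ poly_funs_det]) simp
    then obtain E where E: "real_hol_deriv (\<lambda>A::complex^'n^'n. det A ^ k) E" using poly_funs_real_hol_deriv by blast
    let ?F = "\<lambda>A::complex^'n^'n. (D A * det (mat 1 :: complex^'n^'n) ^ k - p (mat 1) * E A)
        / (det (mat 1 :: complex^'n^'n) ^ k * det (mat 1 :: complex^'n^'n) ^ k)"
    have "((\<lambda>A. p A / det A ^ k) has_derivative ?F) (at (mat 1))"
    proof (rule has_derivative_divide')
      show "(p has_derivative D) (at (mat 1))" using D by (simp only: real_hol_deriv_def)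
      show "((\<lambda>A. det A ^ k) has_derivative E) (at (mat 1))" using E by (simp only: real_hol_deriv_def)
    qed simp
    then have "((\<lambda>A. p A / det A ^ k) has_derivative ?F) (at (mat 1) within M)"
      by (rule has_derivative_at_withinI)
    then have "((\<lambda>A. \<theta> A $ i $ j) has_derivative ?F) (at (mat 1) within M)"
      by (rule has_derivative_transform[OF one, rotated]) (use p(2) in simp)
    moreover have "?F (csm \<i> A) = \<i> * ?F A" "?F (mat_cnj A) = cnj (?F A)" for A
      using D E by (simp_all add: real_hol_deriv_def algebra_simps Reals_cnj_iff)
    ultimately show ?thesis by (intro exI[of _ ?F] conjI allI)
  qed
  note ex = this
  define D where "D i j = (SOME D. ((\<lambda>A. \<theta> A $ i $ j) has_derivative D) (at (mat 1) within M)
      \<and> (\<forall>A. D (csm \<i> A) = \<i> * D A) \<and> (\<forall>A. D (mat_cnj A) = cnj (D A)))" for i j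
  have D': "((\<lambda>A. \<theta> A $ i $ j) has_derivative D i j) (at (mat 1) within M)
      \<and> (\<forall>A. D i j (csm \<i> A) = \<i> * D i j A) \<and> (\<forall>A. D i j (mat_cnj A) = cnj (D i j A))" for i j
    unfolding D_def by (rule someI_ex[OF ex])
  then have D: "\<And>i j. ((\<lambda>A. \<theta> A $ i $ j) has_derivative D i j) (at (mat 1) within M)"
      "\<And>i j A. D i j (csm \<i> A) = \<i> * D i j A" "\<And>i j A. D i j (mat_cnj A) = cnj (D i j A)"
    by simp_all
  let ?D = "\<lambda>A. \<chi> i j. D i j A"
  have "(\<theta> has_derivative ?D) (at (mat 1) within M)"
    by (rule has_derivative_vecI, rule has_derivative_vecI) (simp add: D(1))
  moreover have "?D (csm \<i> A) = csm \<i> (?D A)" "?D (mat_cnj A) = mat_cnj (?D A)" for A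
    unfolding csm_def[of _ "?D A"] mat_cnj_def[of "?D A"] by (simp_all add: D vec_eq_iff)
  ultimately show ?thesis by (intro exI[of _ ?D] conjI allI)
qed

lemma has_vector_derivative_compose_within:
  assumes "(\<theta> has_derivative D) (at (\<gamma> 0) within M)" "\<And>t. \<gamma> t \<in> M" "(\<gamma> has_vector_derivative v) (at 0)"
  shows "((\<lambda>t::real. \<theta> (\<gamma> t)) has_vector_derivative D v) (at 0)"
proof -
  have bl: "bounded_linear D" using assms(1) by (rule has_derivative_bounded_linear)
  have "(\<theta> has_derivative D) (at (\<gamma> 0) within range \<gamma>)"
    by (rule has_derivative_subset[OF assms(1)]) (use assms(2) in auto)
  then have "((\<lambda>t. \<theta> (\<gamma> t)) has_derivative (\<lambda>t. D (t *\<^sub>R v))) (at 0)"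
    using has_derivative_in_compose[of \<gamma> "\<lambda>t. t *\<^sub>R v" 0 UNIV \<theta> D] assms(3)
    by (simp add: has_vector_derivative_def)
  then show ?thesis
    by (simp add: has_vector_derivative_def linear_scale[OF bounded_linear.linear[OF bl]])
qed

lemma csm_split: "csm a A = Re a *\<^sub>R A + Im a *\<^sub>R csm \<i> A"
  by (simp add: csm_def vec_eq_iff complex_eq_iff)

context graded_lie
begin

text \<open>Vectors in the \<open>- 1\<close> eigenspace of \<open>sg S\<close> span over the
  complex numbers; for a compact structure their \<open>ad\<close> is real-diagonalisable, so they
  have exponentials.\<close>

lemma selfadj_split:
  assumes S: "rstruct S"
  obtains Y Z where "x = Y + \<i> *s Z" "sg S Y = - Y" "sg S Z = - Z"
proof
  let ?Y = "(1/2) *s (x - sg S x)" and ?Z = "(- \<i> / 2) *s (x + sg S x)"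
  have sub: "sg S (a - b) = sg S a - sg S b" for a b using sg_add[of S a "- b"] by (simp add: sg_minus)
  show "x = ?Y + \<i> *s ?Z" by (simp add: vec_eq_iff field_simps)
  show "sg S ?Y = - ?Y" by (simp add: sg_smult sub sg_sg[OF S] vec_eq_iff field_simps)
  show "sg S ?Z = - ?Z" by (simp add: sg_smult sg_add sg_sg[OF S] sg_minus sub vec_eq_iff field_simps)
qed

lemma complex_linear_eqI:
  assumes S: "rstruct S"
    and f: "\<And>x y. f (x + y) = f x + f y" "\<And>a x. f (a *s x) = a *s f x"
    and g: "\<And>x y. g (x + y) = g x + g y" "\<And>a x. g (a *s x) = a *s g x"
    and eq: "\<And>Y. sg S Y = - Y \<Longrightarrow> f Y = g Y"
  shows "f x = g x"
proof -
  obtain Y Z where x: "x = Y + \<i> *s Z" and Y: "sg S Y = - Y" and Z: "sg S Z = - Z"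
    by (rule selfadj_split[OF S])
  show ?thesis unfolding x f g using eq[OF Y] eq[OF Z] by simp
qed

lemma selfadj_curve:
  assumes S: "cstruct S" and Y: "sg S Y = - Y"
  shows "rdiag (adc Y)" "mexp (adc Y) s \<in> adjoint_group br"
    "((\<lambda>t::real. mexp (adc Y) (c * of_real t)) has_vector_derivative csm c (adc Y)) (at 0)"
    "mexp (adc Y) (c * of_real 0) = mat 1"
proof -
  show L: "rdiag (adc Y)" by (rule selfadj_rdiag[OF S selfadj_adc[OF cstruct_rstruct[OF S] Y]])
  show "mexp (adc Y) s \<in> adjoint_group br" by (rule mexp_adjoint_group[OF L derivc_adc])
  show "((\<lambda>t::real. mexp (adc Y) (c * of_real t)) has_vector_derivative csm c (adc Y)) (at 0)"
    by (rule mexp_has_vector_derivative[OF L])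
  show "mexp (adc Y) (c * of_real 0) = mat 1" by (simp add: mexp_0[OF L])
qed

lemma tangent_derivative:
  assumes S: "cstruct S" and Y: "sg S Y = - Y"
    and D: "(\<theta> has_derivative D) (at (mat 1) within adjoint_group br)"
  shows "((\<lambda>t::real. \<theta> (mexp (adc Y) (c * of_real t))) has_vector_derivative D (csm c (adc Y))) (at 0)"
  by (rule has_vector_derivative_compose_within[where M="adjoint_group br"])
    (use D selfadj_curve[OF S Y] in simp_all)

text \<open>The curves \<open>exp (c r ad V)\<close> lie in the adjoint group, and
  \<open>c = 1\<close> and \<open>c = \<i>\<close> together reach every tangent vector
  \<open>adc x\<close>. Hence the description in \<open>induced_aut\<close> denotes.\<close>

lemma derivative_within_unique:
  assumes D: "(\<theta> has_derivative D) (at (mat 1) within adjoint_group br)"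
    and D': "(\<theta> has_derivative D') (at (mat 1) within adjoint_group br)"
  shows "D (adc x) = D' (adc x)"
proof -
  obtain t where t: "cstruct (mat_complex t)" by (rule base_cstruct)
  obtain Y Z where x: "x = Y + \<i> *s Z"
      and Y: "sg (mat_complex t) Y = - Y" and Z: "sg (mat_complex t) Z = - Z"
    by (rule selfadj_split[OF cstruct_rstruct[OF t]])
  have e: "D (csm c (adc V)) = D' (csm c (adc V))" if V: "sg (mat_complex t) V = - V" for c V
    by (rule vector_derivative_unique_at[OF tangent_derivative[OF t V D] tangent_derivative[OF t V D']])
  have lin: "linear D" "linear D'"
    using has_derivative_bounded_linear[OF D] has_derivative_bounded_linear[OF D'] by (simp_all add: bounded_linear.linear)
  have one: "csm 1 A = A" for A :: "complex^'n^'n" by (simp add: csm_def vec_eq_iff)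
  show ?thesis
    using e[OF Y, of 1] e[OF Z, of \<i>] by (simp add: x adc_add adc_smult linear_add[OF lin(1)] linear_add[OF lin(2)] one)
qed

lemma induced_aut_eq:
  assumes D: "(\<theta> has_derivative D) (at (mat 1) within adjoint_group br)"
    and y: "D (adc (vec_complex x)) = adc (vec_complex y)"
  shows "induced_aut br \<theta> x = y"
  unfolding induced_aut_def ad_complex_eq
proof (rule the_equality)
  show "\<exists>D. (\<theta> has_derivative D) (at (mat 1) within adjoint_group br) \<and> D (adc (vec_complex x)) = adc (vec_complex y)"
    using D y by blast
  fix y' assume "\<exists>D. (\<theta> has_derivative D) (at (mat 1) within adjoint_group br) \<and> D (adc (vec_complex x)) = adc (vec_complex y')"
  then obtain D' where D': "(\<theta> has_derivative D') (at (mat 1) within adjoint_group br)"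
      "D' (adc (vec_complex x)) = adc (vec_complex y')" by blast
  have "adc (vec_complex y') = adc (vec_complex y)"
    using derivative_within_unique[OF D D'(1), of "vec_complex x"] D'(2) y by simp
  then show "y' = y" by (intro vec_complex_inj adc_inj)
qed

lemma induced_aut_conj_inv:
  assumes S: "rstruct (mat_complex t)"
  shows "induced_aut br (conj_inv t (adjoint_group br)) x = t *v x"
proof (rule induced_aut_eq)
  let ?S = "mat_complex t"
  have "linear (\<lambda>A. ?S ** A ** ?S)"
    by (auto intro!: linearI simp: matrix_add_ldistrib matrix_add_rdistrib' matrix_scaleR_left matrix_scaleR_right)
  then have "bounded_linear (\<lambda>A. ?S ** A ** ?S)" by (simp add: linear_conv_bounded_linear)
  then have "((\<lambda>A. ?S ** A ** ?S) has_derivative (\<lambda>A. ?S ** A ** ?S)) (at (mat 1) within adjoint_group br)"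
    by (rule bounded_linear_imp_has_derivative)
  then show "(conj_inv t (adjoint_group br) has_derivative (\<lambda>A. ?S ** A ** ?S)) (at (mat 1) within adjoint_group br)"
    by (rule has_derivative_transform[OF matrix_group.one_mem[OF matrix_group_adjoint], rotated])
      (simp add: conj_inv_def)
  have SA: "?S \<in> lie_Aut br" using S by (simp add: rstruct_def)
  show "?S ** adc (vec_complex x) ** ?S = adc (vec_complex (t *v x))"
    by (simp add: adc_Aut[OF SA] matrix_mul_assoc[symmetric] real_struct_square[OF S] mat_complex_apply)
qed

text \<open>With \<open>\<sigma>\<close> the given structure and \<open>\<sigma>0\<close> a compact
  one, a suitable conjugate \<open>\<sigma>1\<close> of \<open>\<sigma>0\<close> commutes with
  \<open>\<sigma>\<close>. If the involution \<open>R = \<sigma>1 \<sigma>\<close> had a nonzero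
  \<open>- 1\<close> eigenvector, there would be one fixed by \<open>\<sigma>\<close>, and its
  exponentials would be unbounded in the fixed group. So
  \<open>\<sigma> = \<sigma>1\<close>.\<close>

lemma bounded_fixed_imp_cstruct:
  assumes S: "rstruct (mat_complex t)"
    and bdd: "bounded {A \<in> adjoint_group br. mat_complex t ** A ** mat_complex t = mat_cnj A}"
  shows "cstruct (mat_complex t)"
proof -
  let ?S = "mat_complex t"
  obtain t0 where t0: "cstruct (mat_complex t0)" by (rule base_cstruct)
  define S0 where "S0 = mat_complex t0"
  have S0: "cstruct S0" using t0 by (simp add: S0_def)
  note rs0 = cstruct_rstruct[OF S0]
  define N where "N = S0 ** mat_cnj ?S"
  have Nx: "N *v x = sg S0 (sg ?S x)" for x by (simp add: N_def sg_sg_mult)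
  have NA: "N \<in> lie_Aut br" unfolding N_def by (rule product_Aut[OF rs0 S])
  have saN: "selfadj S0 N" unfolding N_def by (rule selfadj_product(1)[OF rs0 S])
  have Nnz: "N *v x \<noteq> 0" if "x \<noteq> 0" for x
  proof
    assume "N *v x = 0"
    then have "sg ?S (sg S0 (N *v x)) = 0" by simp
    then show False using that by (simp add: Nx sg_sg[OF rs0] sg_sg[OF S])
  qed
  define P where "P = N ** N"
  have Px: "P *v x = N *v (N *v x)" for x by (simp add: P_def matrix_vector_mul_assoc)
  have PA: "P \<in> lie_Aut br" unfolding P_def by (rule matrix_group.mult_mem[OF matrix_group_Aut NA NA])
  have saP: "selfadj S0 P" using saN by (simp add: selfadj_def Px)
  have diag: "rdiag P" by (rule selfadj_rdiag[OF S0 saP])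
  have pos: "0 < l" if x: "P *v x = l *\<^sub>R x" "x \<noteq> 0" for l x
  proof -
    have "hform S0 (P *v x) x = hform S0 (N *v x) (N *v x)" using saN by (simp add: selfadj_def Px)
    then have "0 < hform S0 (P *v x) x" using hform_pos[OF S0 Nnz[OF x(2)]] by simp
    then have "0 < l * hform S0 x x" unfolding x(1) by (simp add: bilinear_lmul[OF hform_bilinear])
    then show ?thesis using hform_pos[OF S0 x(2)] by (simp add: zero_less_mult_iff)
  qed
  have "\<exists>L. rdiag L \<and> mexp L 1 = P \<and> (\<forall>l x. P *v x = l *\<^sub>R x \<longrightarrow> L *v x = ln l *\<^sub>R x)"
    by (rule rdiag_log[OF diag]) (use pos in auto)
  then obtain L where L': "rdiag L" "mexp L 1 = P" "\<forall>l x. P *v x = l *\<^sub>R x \<longrightarrow> L *v x = ln l *\<^sub>R x"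
    by (elim exE conjE)
  note L = L'(1,2) L'(3)[rule_format]
  have D: "derivc L" by (rule log_derivc[OF PA diag _ L(3)]) (use pos in auto)
  have LP: "P *v x = exp l *\<^sub>R x" if "L *v x = l *\<^sub>R x" for l x
    using mexp_apply[OF L(1) that, of 1] L(2) by (simp add: exp_of_real scaleR_eq_smult)
  have anti: "L *v C x = ((- 1) * l) *\<^sub>R C x" if C: "\<And>r x. C (r *\<^sub>R x) = r *\<^sub>R C x"
      "\<And>x. P *v C (P *v x) = C x" and x: "L *v x = l *\<^sub>R x" for C :: "complex^'n \<Rightarrow> complex^'n" and l x
  proof -
    have "exp l *\<^sub>R (P *v C x) = C x" using C(2)[of x] by (simp add: LP[OF x] C(1) matrix_vector_scaleR)
    then have "exp (- l) *\<^sub>R (exp l *\<^sub>R (P *v C x)) = exp (- l) *\<^sub>R C x" by simp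
    then have "P *v C x = exp (- l) *\<^sub>R C x" by (simp add: exp_minus)
    from L(3)[OF this] show ?thesis by simp
  qed
  have PsP: "P *v sg ?S (P *v x) = sg ?S x" "P *v sg S0 (P *v x) = sg S0 x" for x
    by (simp_all add: Px Nx sg_sg[OF rs0] sg_sg[OF S])
  have Ls: "L *v sg ?S x = ((- 1) * l) *\<^sub>R sg ?S x" if "L *v x = l *\<^sub>R x" for l x
    by (rule anti[of "sg ?S", OF sg_scaleR PsP(1) that])
  have Ls0: "L *v sg S0 x = ((- 1) * l) *\<^sub>R sg S0 x" if "L *v x = l *\<^sub>R x" for l x
    by (rule anti[of "sg S0", OF sg_scaleR PsP(2) that])
  have sE0: "sg S0 (mexp L (- of_real r) *v x) = mexp L (of_real r) *v sg S0 x" for r x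
    using mexp_intertwine[OF L(1) L(1) linear_sg[of S0] Ls0, of r x] by (simp add: sg_smult)
  have LN: "L *v (N *v x) = (1 * l) *\<^sub>R (N *v x)" if x: "L *v x = l *\<^sub>R x" for l x
  proof -
    have "P *v (N *v x) = N *v (P *v x)" by (simp add: Px)
    then have "P *v (N *v x) = exp l *\<^sub>R (N *v x)" by (simp add: LP[OF x] matrix_vector_scaleR)
    from L(3)[OF this] show ?thesis by simp
  qed
  have NE: "N *v (mexp L (of_real r) *v x) = mexp L (of_real r) *v (N *v x)" for r x
    using mexp_intertwine[OF L(1) L(1) matrix_vector_mul_linear[of N] LN, of r x]
    by (simp add: vector_scalar_commute)
  \<comment> \<open>Since \<open>\<sigma>0\<close> reverses the flow of \<open>L\<close>,
    conjugation by a quarter power of \<open>P\<close> turns \<open>\<sigma>0\<close> into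
    \<open>exp (- L / 2) \<sigma>0\<close>. Then \<open>R = exp (- L / 2) N\<close> squares to 1,
    because \<open>P = N ** N\<close>.\<close>
  define g where "g = mexp L (1 / 4)"
  have gA: "g \<in> lie_Aut br" unfolding g_def by (rule mexp_Aut[OF L(1) D])
  have ig: "invertible g" "matrix_inv g = mexp L (- 1 / 4)"
    unfolding g_def using mexp_inverse(2,3)[OF L(1), of "1 / 4"] by simp_all
  define S1 where "S1 = matrix_inv g ** S0 ** mat_cnj g"
  have S1: "cstruct S1" unfolding S1_def by (rule cstruct_conj[OF S0 gA])
  note rs1 = cstruct_rstruct[OF S1]
  have s1: "sg S1 x = mexp L (- 1 / 2) *v sg S0 x" for x
  proof -
    have "sg S1 x = matrix_inv g *v sg S0 (g *v x)" unfolding S1_def by (rule sg_conj[OF ig(1)])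
    also have "\<dots> = mexp L (- 1 / 4) *v sg S0 (mexp L (1 / 4) *v x)" by (subst ig(2)) (simp add: g_def)
    also have "sg S0 (mexp L (1 / 4) *v x) = mexp L (- 1 / 4) *v sg S0 x"
      using sE0[of "- 1 / 4" x] by simp
    also have "mexp L (- 1 / 4) *v (mexp L (- 1 / 4) *v sg S0 x) = mexp L (- 1 / 2) *v sg S0 x"
      using mexp_add[OF L(1), of "- 1 / 4" "- 1 / 4"] by (simp add: matrix_vector_mul_assoc)
    finally show ?thesis .
  qed
  define R where "R x = sg S1 (sg ?S x)" for x
  have Rx: "R x = mexp L (- 1 / 2) *v (N *v x)" for x by (simp add: R_def s1 Nx)
  have RR: "R (R x) = x" for x
  proof -
    have "R (R x) = mexp L (- 1 / 2) *v (mexp L (- 1 / 2) *v (N *v (N *v x)))"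
      using NE[of "- 1 / 2" "N *v x"] by (simp add: Rx)
    also have "\<dots> = mexp L (- 1) *v (P *v x)"
      using mexp_add[OF L(1), of "- 1 / 2" "- 1 / 2"] by (simp add: Px matrix_vector_mul_assoc matrix_mul_assoc)
    also have "\<dots> = (mexp L (- 1) ** mexp L 1) *v x" by (simp add: L(2) matrix_vector_mul_assoc)
    also have "mexp L (- 1) ** mexp L 1 = mat 1" using mexp_inverse(1)[OF L(1), of "- 1"] by simp
    finally show ?thesis by simp
  qed
  have Rs: "R (sg ?S x) = sg ?S (R x)" for x
  proof -
    have "sg S1 (sg ?S (sg S1 x)) = sg ?S x"
      using RR[of "sg ?S x"] by (simp add: R_def sg_sg[OF S])
    then have "sg S1 (sg S1 (sg ?S (sg S1 x))) = sg S1 (sg ?S x)" by simp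
    then have "sg S1 (sg ?S x) = sg ?S (sg S1 x)" by (simp add: sg_sg[OF rs1])
    then show ?thesis by (simp add: R_def sg_sg[OF S])
  qed
  have Radd: "R (x + y) = R x + R y" and Rsm: "R (a *s x) = a *s R x" for x y a
    by (simp_all add: Rx matrix_vector_right_distrib vector_scalar_commute)
  \<comment> \<open>Such a \<open>y\<close> satisfies \<open>\<sigma>1 y = - y\<close>, so
    \<open>ad y\<close> has real eigenvalues; its exponentials commute with \<open>\<sigma>\<close>,
    and boundedness rules out nonzero eigenvalues.\<close>
  have zero: "y = 0" if y: "sg ?S y = y" "R y = - y" for y
  proof -
    have y1: "sg S1 y = - y" using y by (simp add: R_def)
    note curve = selfadj_curve[OF S1 y1]
    let ?L = "adc y"
    have "mexp ?L (of_real r) \<in> {A \<in> adjoint_group br. ?S ** A ** ?S = mat_cnj A}" for r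
    proof -
      have e: "?L *v sg ?S x = (1 * l) *\<^sub>R sg ?S x" if "?L *v x = l *\<^sub>R x" for l x
      proof -
        have "sg ?S (cb y x) = cb y (sg ?S x)" by (simp add: sg_cb[OF S] y(1))
        then show ?thesis using that by (simp add: sg_scaleR)
      qed
      have "sg ?S (mexp ?L (of_real r) *v x) = mexp ?L (of_real r) *v sg ?S x" for x
        using mexp_intertwine[OF curve(1) curve(1) linear_sg[of ?S] e, of r x] by (simp add: sg_smult)
      then have "?S ** mexp ?L (of_real r) ** ?S = mat_cnj (mexp ?L (of_real r))"
        using fixed_iff_commute[OF S] by blast
      then show ?thesis using curve(2) by simp
    qed
    then have "range (\<lambda>r::real. mexp ?L (of_real r)) \<subseteq> {A \<in> adjoint_group br. ?S ** A ** ?S = mat_cnj A}"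
      by blast
    then have bd: "bounded (range (\<lambda>r::real. mexp ?L (of_real r)))" by (rule bounded_subset[OF bdd])
    have "?L = 0"
    proof (rule rdiag_matrix_eqI[OF curve(1)])
      fix l x assume x: "?L *v x = l *\<^sub>R x"
      have "l = 0 \<or> x = 0"
      proof (rule ccontr)
        assume ne: "\<not> ?thesis"
        have "bounded ((\<lambda>A. A *v x) ` range (\<lambda>r::real. mexp ?L (of_real r)))"
          by (rule bounded_linear_image[OF bd bounded_linear_matrix_apply])
        then obtain b where b: "\<And>r::real. norm (mexp ?L (of_real r) *v x) \<le> b"
          unfolding bounded_iff by auto
        have "exp s * norm x \<le> b" for s
        proof -
          have "mexp ?L (of_real (s / l)) *v x = exp s *\<^sub>R x"
            using mexp_apply[OF curve(1) x, of "of_real (s / l)"] ne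
            by (simp add: exp_of_real[symmetric] scaleR_eq_smult)
          then show ?thesis using b[of "s / l"] by simp
        qed
        from this[of "b / norm x"] have "(1 + b / norm x) * norm x \<le> b"
          using exp_ge_add_one_self[of "b / norm x"] by (meson mult_right_mono norm_ge_zero order_trans)
        then have "norm x + b \<le> b" using ne by (simp add: field_simps)
        then show False using ne by simp
      qed
      then show "?L *v x = 0 *v x" using x by auto
    qed
    then have "adc y = adc 0" by (simp add: matrix_eq)
    then show "y = 0" by (rule adc_inj)
  qed
  \<comment> \<open>The vector \<open>w - R w\<close> is negated by \<open>R\<close>. Applying
    \<open>zero\<close> first to its sum with its image under \<open>\<sigma>\<close>, then to its
    product with \<open>\<i>\<close>, covers both eigenspaces of \<open>\<sigma>\<close>.\<close>
  have R1: "R w = w" for w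
  proof -
    define x where "x = w - R w"
    have Rdiff: "R (a - b) = R a - R b" for a b
      using Radd[of a "- b"] Rsm[of "- 1" b] by (simp add: vector_sneg_minus1[symmetric])
    have Rxx: "R x = - x" by (simp add: x_def Rdiff RR)
    have sub: "R (- a) = - R a" for a using Rdiff[of 0 a] Rdiff[of 0 0] by simp
    have "x + sg ?S x = 0"
      by (rule zero) (simp_all add: sg_add sg_sg[OF S] Radd Rs Rxx sg_minus add.commute)
    then have sx: "sg ?S x = - x" by (metis add.commute eq_neg_iff_add_eq_0)
    have "\<i> *s x = 0"
      by (rule zero) (simp_all add: sg_smult sx Rsm Rxx vec_eq_iff)
    then have "x = 0" by simp
    then show ?thesis by (simp add: x_def)
  qed
  have "?S = S1"
  proof -
    have "S1 ** mat_cnj ?S = mat 1" using R1 by (simp add: matrix_eq R_def sg_sg_mult)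
    then have "S1 ** mat_cnj ?S ** ?S = ?S" by simp
    then show ?thesis by (simp add: matrix_mul_assoc[symmetric] rstruct_left[OF S, simplified] real_struct_square[OF S])
  qed
  then show ?thesis using S1 by simp
qed


lemma derivc_add: "derivc D \<Longrightarrow> derivc E \<Longrightarrow> derivc (D + E)"
  by (simp add: derivc_def matrix_vector_mult_add_rdistrib cb_add_left cb_add_right)

lemma derivc_csm: "derivc D \<Longrightarrow> derivc (csm a D)"
  by (simp add: derivc_def csm_apply cb_smult_left cb_smult_right vec.scale_right_distrib)

lemma curve_derivc:
  assumes \<gamma>: "\<And>t::real. \<gamma> t \<in> lie_Aut br" and \<gamma>0: "\<gamma> 0 = mat 1"
    and d: "(\<gamma> has_vector_derivative E) (at 0)"
  shows "derivc E"
  unfolding derivc_def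
proof (intro allI)
  fix a b
  have "bilinear cb"
    by (subst bilinear_def) (auto intro!: linearI simp: cb_add_left cb_add_right cb_scaleR)
  then have bb: "bounded_bilinear cb" by (simp add: bilinear_conv_bounded_bilinear)
  have dv: "((\<lambda>t. \<gamma> t *v x) has_vector_derivative E *v x) (at 0)" for x
    by (rule bounded_linear.has_vector_derivative[OF bounded_linear_matrix_apply d])
  have "((\<lambda>t. cb (\<gamma> t *v a) (\<gamma> t *v b)) has_vector_derivative
      cb (\<gamma> 0 *v a) (E *v b) + cb (E *v a) (\<gamma> 0 *v b)) (at 0)"
    by (rule bounded_bilinear.has_vector_derivative[OF bb dv dv])
  then have "((\<lambda>t. \<gamma> t *v cb a b) has_vector_derivative cb a (E *v b) + cb (E *v a) b) (at 0)"
    by (simp add: lie_Aut_apply[OF \<gamma>] \<gamma>0)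
  from vector_derivative_unique_at[OF dv[of "cb a b"] this]
  show "E *v cb a b = cb (E *v a) b + cb a (E *v b)" by (simp add: add.commute)
qed

text \<open>The differential \<open>\<tau>\<close> of \<open>\<theta>\<close> satisfies \<open>\<tau> A = \<theta>(A) \<tau>\<close>: differentiate
  \<open>\<theta>(A e\<^sup>t\<^sup>Y A\<^sup>-\<^sup>1) = \<theta>(A) \<theta>(e\<^sup>t\<^sup>Y) \<theta>(A)\<^sup>-\<^sup>1\<close>. The curves \<open>e\<^sup>t\<^sup>Y\<close> with \<open>ad Y\<close> self-adjoint suffice, as such \<open>Y\<close>
  span the complexified Lie algebra.\<close>

lemma cartan_involution_conj:
  assumes th: "\<theta> \<in> cartan_involutions (adjoint_group br)"
  obtains t where "\<theta> = conj_inv t (adjoint_group br)" "cstruct (mat_complex t)"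
proof -
  let ?H = "adjoint_group br"
  interpret H: matrix_group ?H by (rule matrix_group_adjoint)
  have inv: "alg_involution ?H \<theta>" and comp: "compact {A \<in> ?H. \<theta> A = mat_cnj A}"
    using th by (simp_all add: cartan_involutions_def)
  have thH: "\<theta> \<in> ?H \<rightarrow>\<^sub>E ?H" and reg: "regular_over_reals ?H \<theta>"
    and th_mult: "\<And>A B. A \<in> ?H \<Longrightarrow> B \<in> ?H \<Longrightarrow> \<theta> (A ** B) = \<theta> A ** \<theta> B" and thth: "\<And>A. A \<in> ?H \<Longrightarrow> \<theta> (\<theta> A) = A"
    using inv by (auto simp: alg_involution_def)
  have mem: "\<theta> A \<in> ?H" if "A \<in> ?H" for A using thH that by (auto simp: PiE_def)
  have th1: "\<theta> (mat 1) = mat 1"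
  proof -
    have "\<theta> (mat 1) ** \<theta> (mat 1) = \<theta> (mat 1)" using th_mult[OF H.one_mem H.one_mem] by simp
    then have "matrix_inv (\<theta> (mat 1)) ** (\<theta> (mat 1) ** \<theta> (mat 1)) = matrix_inv (\<theta> (mat 1)) ** \<theta> (mat 1)" by simp
    moreover have "matrix_inv (\<theta> (mat 1)) ** \<theta> (mat 1) = mat 1"
      by (rule matrix_inv_left[OF H.invertible_mem[OF mem[OF H.one_mem]]])
    ultimately show ?thesis by (simp add: matrix_mul_assoc)
  qed
  obtain D where D: "(\<theta> has_derivative D) (at (mat 1) within ?H)"
      and Di: "\<forall>A. D (csm \<i> A) = csm \<i> (D A)" and Dc: "\<forall>A. D (mat_cnj A) = mat_cnj (D A)"
    using regular_has_derivative[OF reg H.one_mem] by (elim exE conjE)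
  have linD: "linear D" using has_derivative_bounded_linear[OF D] by (rule bounded_linear.linear)
  have Dcsm: "D (csm a A) = csm a (D A)" for a A
    unfolding csm_split[of a] by (simp add: linear_add[OF linD] linear_scale[OF linD] Di)
  obtain t0 where t0: "cstruct (mat_complex t0)" by (rule base_cstruct)
  define S0 where "S0 = mat_complex t0"
  have S0: "cstruct S0" using t0 by (simp add: S0_def)
  note rs0 = cstruct_rstruct[OF S0]
  have csm1: "csm 1 A = A" for A :: "complex^'n^'n" by (simp add: csm_def vec_eq_iff)
  have tang: "((\<lambda>r::real. \<theta> (mexp (adc Y) (1 * of_real r))) has_vector_derivative D (adc Y)) (at 0)"
    if "sg S0 Y = - Y" for Y
    using tangent_derivative[OF S0 that D, of 1] by (simp add: csm1)
  \<comment> \<open>The image under \<open>\<theta>\<close> of a one-parameter group is a curve of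
    automorphisms through 1, so its velocity is a derivation.\<close>
  have derY: "derivc (D (adc Y))" if Y: "sg S0 Y = - Y" for Y
  proof (rule curve_derivc[OF _ _ tang[OF Y]])
    show "\<theta> (mexp (adc Y) (1 * of_real r)) \<in> lie_Aut br" for r
      by (rule adjoint_group_Aut[OF mem[OF selfadj_curve(2)[OF S0 Y]]])
    show "\<theta> (mexp (adc Y) (1 * complex_of_real 0)) = mat 1"
      using selfadj_curve(4)[OF S0 Y, of 1] th1 by simp
  qed
  have "derivc (D (adc x))" for x
  proof -
    obtain Y Z where x: "x = Y + \<i> *s Z" and Y: "sg S0 Y = - Y" and Z: "sg S0 Z = - Z"
      by (rule selfadj_split[OF rs0])
    show ?thesis
      unfolding x adc_add adc_smult linear_add[OF linD] Dcsm
      by (intro derivc_add derivc_csm derY Y Z)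
  qed
  \<comment> \<open>Innerness of derivations turns the differential on matrices \<open>ad x\<close>
    into a map \<open>\<tau>\<close> on the Lie algebra itself.\<close>
  then have "\<exists>y. adc y = D (adc x)" for x using derivc_inner by metis
  then obtain \<tau> where \<tau>: "\<And>x. adc (\<tau> x) = D (adc x)" by metis
  have \<tau>_add: "\<tau> (x + y) = \<tau> x + \<tau> y" for x y
    by (rule adc_inj) (simp add: \<tau> adc_add linear_add[OF linD])
  have \<tau>_smult: "\<tau> (a *s x) = a *s \<tau> x" for a x
    by (rule adc_inj) (simp add: \<tau> adc_smult Dcsm)
  have \<tau>_cnj: "\<tau> (vcnj x) = vcnj (\<tau> x)" for x
    by (rule adc_inj) (simp add: \<tau> adc_cnj Dc)
  have th_\<tau>: "\<tau> (A *v x) = \<theta> A *v \<tau> x" if A: "A \<in> ?H" for A x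
  proof (rule complex_linear_eqI[OF rs0, of "\<lambda>x. \<tau> (A *v x)" "\<lambda>x. \<theta> A *v \<tau> x"])
    fix Y assume Y: "sg S0 Y = - Y"
    have iA: "invertible A" and AA: "A \<in> lie_Aut br" by (rule H.invertible_mem[OF A], rule adjoint_group_Aut[OF A])
    have B: "\<theta> A \<in> ?H" by (rule mem[OF A])
    have iB: "invertible (\<theta> A)" and BA: "\<theta> A \<in> lie_Aut br" by (rule H.invertible_mem[OF B], rule adjoint_group_Aut[OF B])
    let ?m = "\<lambda>r::real. mexp (adc Y) (1 * of_real r)"
    let ?g = "\<lambda>r. A ** ?m r ** matrix_inv A"
    have mH: "?m r \<in> ?H" for r by (rule selfadj_curve(2)[OF S0 Y])
    have m0: "?m 0 = mat 1" using selfadj_curve(4)[OF S0 Y, of 1] by simp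
    have gH: "?g r \<in> ?H" for r by (intro H.mult_mem H.inv_mem A mH)
    have g0: "?g 0 = mat 1" unfolding m0 by (simp add: matrix_inv_right[OF iA])
    have blc: "bounded_linear (\<lambda>X. B ** X ** C)" for B C :: "complex^'n^'n"
      unfolding linear_conv_bounded_linear[symmetric]
      by (auto intro!: linearI simp: matrix_add_ldistrib matrix_add_rdistrib' matrix_scaleR_left matrix_scaleR_right)
    have "(?m has_vector_derivative adc Y) (at 0)"
      using selfadj_curve(3)[OF S0 Y, of 1] by (simp add: csm1)
    then have dg: "(?g has_vector_derivative A ** adc Y ** matrix_inv A) (at 0)"
      by (rule bounded_linear.has_vector_derivative[OF blc])
    have "((\<lambda>r. \<theta> (?g r)) has_vector_derivative D (A ** adc Y ** matrix_inv A)) (at 0)"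
      by (rule has_vector_derivative_compose_within[where M="?H"]) (unfold g0, rule D, rule gH, rule dg)
    moreover have "\<theta> (?g r) = \<theta> A ** \<theta> (?m r) ** matrix_inv (\<theta> A)" for r
    proof -
      have "\<theta> (matrix_inv A) = matrix_inv (\<theta> A)"
      proof (rule matrix_inv_unique(1)[symmetric])
        have "\<theta> A ** \<theta> (matrix_inv A) = \<theta> (A ** matrix_inv A)" by (rule th_mult[symmetric, OF A H.inv_mem[OF A]])
        then show "\<theta> A ** \<theta> (matrix_inv A) = mat 1" by (simp add: matrix_inv_right[OF iA] th1)
      qed
      then show ?thesis by (simp add: th_mult A H.inv_mem H.mult_mem mH[simplified])
    qed
    moreover have "((\<lambda>r. \<theta> A ** \<theta> (?m r) ** matrix_inv (\<theta> A)) has_vector_derivative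
        \<theta> A ** D (adc Y) ** matrix_inv (\<theta> A)) (at 0)"
      by (rule bounded_linear.has_vector_derivative[OF blc tang[OF Y]])
    ultimately have e: "D (A ** adc Y ** matrix_inv A) = \<theta> A ** D (adc Y) ** matrix_inv (\<theta> A)"
      using vector_derivative_unique_at by simp
    have cj: "X ** adc z ** matrix_inv X = adc (X *v z)" if "X \<in> lie_Aut br" "invertible X" for X z
      by (simp add: adc_Aut[OF that(1)] matrix_mul_assoc[symmetric] matrix_inv_right[OF that(2)])
    show "\<tau> (A *v Y) = \<theta> A *v \<tau> Y"
      by (rule adc_inj) (use e in \<open>simp add: \<tau>[symmetric] cj AA iA BA iB\<close>)
  qed (simp_all add: matrix_vector_right_distrib vector_scalar_commute \<tau>_add \<tau>_smult)
  have \<tau>\<tau>: "\<tau> (\<tau> x) = x" for x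
  proof (rule complex_linear_eqI[OF rs0, of "\<lambda>x. \<tau> (\<tau> x)" "\<lambda>x. x"])
    fix Y assume Y: "sg S0 Y = - Y"
    let ?m = "\<lambda>r::real. mexp (adc Y) (1 * of_real r)"
    have mH: "?m r \<in> ?H" for r by (rule selfadj_curve(2)[OF S0 Y])
    have m0: "\<theta> (?m 0) = mat 1" using selfadj_curve(4)[OF S0 Y, of 1] th1 by simp
    have "((\<lambda>r. \<theta> (\<theta> (?m r))) has_vector_derivative D (D (adc Y))) (at 0)"
      by (rule has_vector_derivative_compose_within[where M="?H"]) (unfold m0, rule D, rule mem[OF mH], rule tang[OF Y])
    then have "(?m has_vector_derivative D (D (adc Y))) (at 0)" by (simp only: thth[OF mH])
    moreover have "(?m has_vector_derivative adc Y) (at 0)"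
      using selfadj_curve(3)[OF S0 Y, of 1] by (simp add: csm1)
    ultimately have "D (D (adc Y)) = adc Y" by (rule vector_derivative_unique_at)
    then show "\<tau> (\<tau> Y) = Y" by (intro adc_inj) (simp add: \<tau>)
  qed (simp_all add: \<tau>_add \<tau>_smult)
  \<comment> \<open>Differentiating
    \<open>\<tau> (exp (r ad Y) y) = \<theta> (exp (r ad Y)) (\<tau> y)\<close> at
    \<open>r = 0\<close> shows that \<open>\<tau>\<close> respects brackets.\<close>
  have \<tau>_cb: "\<tau> (cb x y) = cb (\<tau> x) (\<tau> y)" for x y
  proof (rule complex_linear_eqI[OF rs0, of "\<lambda>x. \<tau> (cb x y)" "\<lambda>x. cb (\<tau> x) (\<tau> y)"])
    fix Y assume Y: "sg S0 Y = - Y"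
    let ?m = "\<lambda>r::real. mexp (adc Y) (1 * of_real r)"
    have mH: "?m r \<in> ?H" for r by (rule selfadj_curve(2)[OF S0 Y])
    have "((\<lambda>r. \<theta> (?m r) *v \<tau> y) has_vector_derivative D (adc Y) *v \<tau> y) (at 0)"
      by (rule bounded_linear.has_vector_derivative[OF bounded_linear_matrix_apply tang[OF Y]])
    then have "((\<lambda>r. \<tau> (?m r *v y)) has_vector_derivative D (adc Y) *v \<tau> y) (at 0)"
      by (simp only: th_\<tau>[OF mH])
    moreover have "((\<lambda>r. \<tau> (?m r *v y)) has_vector_derivative \<tau> (adc Y *v y)) (at 0)"
    proof -
      have "linear \<tau>" by (auto intro!: linearI simp: \<tau>_add \<tau>_smult scaleR_eq_smult)
      then have "bounded_linear \<tau>" by (simp add: linear_conv_bounded_linear)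
      moreover have "((\<lambda>r. ?m r *v y) has_vector_derivative adc Y *v y) (at 0)"
        using bounded_linear.has_vector_derivative[OF bounded_linear_matrix_apply selfadj_curve(3)[OF S0 Y, of 1]]
        by (simp add: csm1)
      ultimately show ?thesis by (rule bounded_linear.has_vector_derivative)
    qed
    ultimately have "D (adc Y) *v \<tau> y = \<tau> (adc Y *v y)" by (rule vector_derivative_unique_at)
    then show "\<tau> (cb Y y) = cb (\<tau> Y) (\<tau> y)" by (simp add: \<tau>[symmetric])
  qed (simp_all add: cb_add_left cb_smult_left \<tau>_add \<tau>_smult)
  define S where "S = matrix \<tau>"
  have S: "S *v x = \<tau> x" for x unfolding S_def by (rule matrix_works_complex) (simp_all add: \<tau>_add \<tau>_smult)
  have SS: "S ** S = mat 1" by (simp add: matrix_eq matrix_vector_mul_assoc[symmetric] S \<tau>\<tau>)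
  have "mat_cnj S = S"
  proof (rule matrix_eq[THEN iffD2], rule allI)
    fix z
    have "mat_cnj S *v z = vcnj (S *v vcnj z)" by (simp add: vcnj_mult)
    then show "mat_cnj S *v z = S *v z" by (simp add: S \<tau>_cnj)
  qed
  then obtain t where t: "S = mat_complex t" using mat_cnj_fixed by blast
  have "S \<in> lie_Aut br" unfolding lie_Aut_def using matrix_inv_unique(2)[OF SS] by (simp add: S \<tau>_cb)
  then have rs: "rstruct (mat_complex t)" using SS by (simp add: rstruct_def t)
  have thA: "\<theta> A = S ** A ** S" if A: "A \<in> ?H" for A
  proof -
    have "\<theta> A ** S = S ** A"
      by (simp add: matrix_eq matrix_vector_mul_assoc[symmetric] S th_\<tau>[OF A])
    then have "\<theta> A ** S ** S = S ** A ** S" by simp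
    then show ?thesis by (simp add: matrix_mul_assoc[symmetric] SS)
  qed
  have "\<theta> = conj_inv t ?H"
  proof
    fix A
    show "\<theta> A = conj_inv t ?H A"
    proof (cases "A \<in> ?H")
      case True
      then have "conj_inv t ?H A = S ** A ** S" by (simp add: conj_inv_def t)
      then show ?thesis using thA[OF True] by (rule trans[OF _ sym, rotated])
    next
      case False
      then have "conj_inv t ?H A = undefined" by (simp add: conj_inv_def)
      then show ?thesis using PiE_arb[OF thH False] by simp
    qed
  qed
  \<comment> \<open>Algebra has given a real structure; compactness of the fixed group is what makes
    it a compact one.\<close>
  moreover have "cstruct (mat_complex t)"
  proof (rule bounded_fixed_imp_cstruct[OF rs])
    have "{A \<in> ?H. \<theta> A = mat_cnj A} = {A \<in> ?H. mat_complex t ** A ** mat_complex t = mat_cnj A}"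
      using thA by (auto simp: t)
    then show "bounded {A \<in> ?H. mat_complex t ** A ** mat_complex t = mat_cnj A}"
      using compact_imp_bounded[OF comp] by simp
  qed
  ultimately show ?thesis by (rule that)
qed

section \<open>Cartan involutions adapted to a vector, in terms of real matrices\<close>

definition adapted_matrix :: "real^'n \<Rightarrow> real^'n^'n \<Rightarrow> bool" where
  "adapted_matrix T t \<longleftrightarrow> cstruct (mat_complex t) \<and> graded_struct (mat_complex t) \<and> br T (t *v T) = 0"

lemma graded_struct_real:
  "graded_struct (mat_complex t) \<longleftrightarrow> (\<forall>i x. x \<in> h i \<longrightarrow> t *v x \<in> h (- i))"
proof
  assume g: "graded_struct (mat_complex t)"
  show "\<forall>i x. x \<in> h i \<longrightarrow> t *v x \<in> h (- i)"
  proof (intro allI impI)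
    fix i x assume "x \<in> h i"
    then have "sg (mat_complex t) (vec_complex x) \<in> hC (- i)" using g by (simp add: graded_struct_def hC_real)
    then show "t *v x \<in> h (- i)" by (simp add: sg_def mat_complex_apply hC_real)
  qed
next
  assume g: "\<forall>i x. x \<in> h i \<longrightarrow> t *v x \<in> h (- i)"
  show "graded_struct (mat_complex t)"
    unfolding graded_struct_def
  proof (intro allI impI)
    fix i x assume "x \<in> hC i"
    then have "vcnj x \<in> hC i" by (rule hC_cnj)
    then have "vec_Re (vcnj x) \<in> h i" "vec_Im (vcnj x) \<in> h i" by (simp_all only: complexify_def mem_Collect_eq)
    then have c: "vec_complex (t *v vec_Re (vcnj x)) \<in> hC (- i)" "vec_complex (t *v vec_Im (vcnj x)) \<in> hC (- i)"
      using g unfolding hC_real by blast+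
    have "sg (mat_complex t) x = mat_complex t *v (vec_complex (vec_Re (vcnj x)) + \<i> *s vec_complex (vec_Im (vcnj x)))"
      unfolding sg_def by (rule arg_cong[OF vec_complex_split])
    also have "\<dots> = vec_complex (t *v vec_Re (vcnj x)) + \<i> *s vec_complex (t *v vec_Im (vcnj x))"
      by (simp only: matrix_vector_right_distrib vector_scalar_commute mat_complex_apply)
    also have "\<dots> \<in> hC (- i)" by (rule subspace_add[OF hC_subspace c(1) hC_smult[OF c(2)]])
    finally show "sg (mat_complex t) x \<in> hC (- i)" .
  qed
qed

lemma adapted_involution_iff:
  "adapted_involution br h T \<theta> \<longleftrightarrow> (\<exists>t. adapted_matrix T t \<and> \<theta> = conj_inv t (adjoint_group br))"
proof
  assume a: "adapted_involution br h T \<theta>"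
  then obtain t where t: "\<theta> = conj_inv t (adjoint_group br)" "cstruct (mat_complex t)"
    using cartan_involution_conj[of \<theta>] unfolding adapted_involution_def by metis
  have ia: "induced_aut br \<theta> x = t *v x" for x
    unfolding t(1) by (rule induced_aut_conj_inv[OF cstruct_rstruct[OF t(2)]])
  have "adapted_matrix T t"
    using a t(2) unfolding adapted_matrix_def graded_struct_real adapted_involution_def
    by (auto simp: ia)
  then show "\<exists>t. adapted_matrix T t \<and> \<theta> = conj_inv t (adjoint_group br)" using t(1) by blast
next
  assume "\<exists>t. adapted_matrix T t \<and> \<theta> = conj_inv t (adjoint_group br)"
  then obtain t where t: "adapted_matrix T t" "\<theta> = conj_inv t (adjoint_group br)" by blast
  have c: "cstruct (mat_complex t)" using t(1) by (simp add: adapted_matrix_def)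
  have ia: "induced_aut br \<theta> x = t *v x" for x
    unfolding t(2) by (rule induced_aut_conj_inv[OF cstruct_rstruct[OF c]])
  show "adapted_involution br h T \<theta>"
    using t(1) conj_inv_cartan_adjoint[OF c]
    unfolding adapted_matrix_def graded_struct_real adapted_involution_def t(2)[symmetric]
    by (auto simp: ia)
qed

lemma adapted_matrix_unique:
  assumes T: "stable_vector br h (vec_complex T)" and "adapted_matrix T t" "adapted_matrix T t'"
  shows "t = t'"
proof -
  have z: "cb (vec_complex T) (sg (mat_complex t) (vec_complex T)) = 0" if "br T (t *v T) = 0" for t
  proof -
    have "cb (vec_complex T) (sg (mat_complex t) (vec_complex T)) = vec_complex (br T (t *v T))"
      by (simp add: sg_def mat_complex_apply cb_real)
    then show ?thesis using that by (simp add: vec_complex_def vec_eq_iff)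
  qed
  have "mat_complex t = mat_complex t'"
    by (rule adapted_struct_unique[of _ "vec_complex T"])
      (use assms z in \<open>simp_all add: adapted_matrix_def stable_vector_def\<close>)
  then show ?thesis by (rule mat_complex_inj)
qed

lemma adapted_matrix_exists:
  assumes "stable_vector br h (vec_complex T)"
  obtains t where "adapted_matrix T t"
  using real_adapted_struct_exists[OF assms] unfolding adapted_matrix_def by blast

text \<open>The inclusion of groups is Zariski continuous and fixes 1, so it maps one identity
  component into the other. This makes the restriction of an involution of the adjoint group to the
  grading group meaningful.\<close>

lemma grading_subset_adjoint: "A \<in> grading_group br h \<Longrightarrow> A \<in> adjoint_group br"
proof -
  assume "A \<in> grading_group br h"
  then have A: "A \<in> identity_component (graded_Aut br h)" by (simp add: grading_group_def)
  have one: "mat 1 \<in> identity_component (graded_Aut br h)" "mat 1 \<in> identity_component (lie_Aut br)"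
    by (rule identity_component_one[OF matrix_group.one_mem[OF matrix_group_graded]],
        rule identity_component_one[OF matrix_group.one_mem[OF matrix_group_Aut]])
  have "id A \<in> identity_component (lie_Aut br)"
    by (rule identity_component_map[OF continuous_map_id _ one(1) _ A])
      (simp_all add: graded_AutD(1) one(2))
  then have "id A \<in> adjoint_group br" by (simp add: adjoint_group_def)
  then show ?thesis by simp
qed

lemma reduction_map_eq:
  assumes T: "stable_vector br h (vec_complex T)" and t: "adapted_matrix T t"
  shows "reduction_map br h T = conj_inv t (grading_group br h)"
proof -
  have "(THE \<theta>. adapted_involution br h T \<theta>) = conj_inv t (adjoint_group br)"
  proof (rule the_equality)
    show "adapted_involution br h T (conj_inv t (adjoint_group br))"
      unfolding adapted_involution_iff using t by blast
    fix \<theta> assume "adapted_involution br h T \<theta>"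
    then obtain t' where t': "adapted_matrix T t'" "\<theta> = conj_inv t' (adjoint_group br)"
      unfolding adapted_involution_iff by blast
    show "\<theta> = conj_inv t (adjoint_group br)"
      unfolding t'(2) adapted_matrix_unique[OF T t'(1) t] ..
  qed
  then show ?thesis
    unfolding reduction_map_def by (auto simp: conj_inv_def restrict_def grading_subset_adjoint)
qed

section \<open>Equivariance under real points of the grading group\<close>

lemma stable_vector_translate:
  assumes T: "stable_vector br h v" and g: "g \<in> grading_group br h"
  shows "stable_vector br h (g *v v)"
proof -
  interpret G: matrix_group "grading_group br h" by (rule matrix_group_grading)
  have ig: "invertible g" by (rule G.invertible_mem[OF g])
  have orb: "{A *v (g *v v) | A. A \<in> grading_group br h} = {A *v v | A. A \<in> grading_group br h}"
  proof (intro equalityI subsetI)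
    fix x assume "x \<in> {A *v (g *v v) | A. A \<in> grading_group br h}"
    then obtain A where "A \<in> grading_group br h" "x = (A ** g) *v v" by (auto simp: matrix_vector_mul_assoc)
    then show "x \<in> {A *v v | A. A \<in> grading_group br h}" using G.mult_mem[OF _ g] by blast
  next
    fix x assume "x \<in> {A *v v | A. A \<in> grading_group br h}"
    then obtain A where A: "A \<in> grading_group br h" "x = A *v v" by blast
    have "x = (A ** matrix_inv g) *v (g *v v)"
      by (simp only: A(2) matrix_vector_mul_assoc[symmetric] matrix_vector_cancel(1)[OF ig])
    then show "x \<in> {A *v (g *v v) | A. A \<in> grading_group br h}" using G.mult_mem[OF A(1) G.inv_mem[OF g]] by blast
  qed
  have "{A \<in> grading_group br h. A *v (g *v v) = g *v v}
      \<subseteq> (\<lambda>B. g ** B ** matrix_inv g) ` {A \<in> grading_group br h. A *v v = v}"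
  proof
    fix A assume A: "A \<in> {A \<in> grading_group br h. A *v (g *v v) = g *v v}"
    let ?B = "matrix_inv g ** A ** g"
    have "?B \<in> grading_group br h" using A by (intro G.mult_mem G.inv_mem g) simp
    moreover have "?B *v v = v"
      using A by (simp add: matrix_vector_mul_assoc[symmetric] matrix_vector_cancel[OF ig])
    moreover have "A = g ** ?B ** matrix_inv g"
    proof -
      have "g ** ?B ** matrix_inv g = (g ** matrix_inv g) ** A ** (g ** matrix_inv g)" by (simp only: matrix_mul_assoc)
      then show ?thesis by (simp add: matrix_inv_right[OF ig])
    qed
    ultimately show "A \<in> (\<lambda>B. g ** B ** matrix_inv g) ` {A \<in> grading_group br h. A *v v = v}" by blast
  qed
  moreover have "finite ((\<lambda>B. g ** B ** matrix_inv g) ` {A \<in> grading_group br h. A *v v = v})"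
    using T by (simp add: stable_vector_def)
  ultimately have "finite {A \<in> grading_group br h. A *v (g *v v) = g *v v}" by (rule finite_subset)
  moreover have "g *v v \<in> hC 1"
    using T graded_AutD(2)[OF grading_group_graded[OF g]] by (simp add: stable_vector_def)
  ultimately show ?thesis using T unfolding stable_vector_def orb by simp
qed

lemma real_point_invertible:
  assumes "mat_complex g \<in> grading_group br h"
  shows "invertible g" "matrix_inv (mat_complex g) = mat_complex (matrix_inv g)"
proof -
  have i: "invertible (mat_complex g)" by (rule matrix_group.invertible_mem[OF matrix_group_grading assms])
  have "mat_cnj (matrix_inv (mat_complex g)) = matrix_inv (mat_complex g)"
    using mat_cnj_matrix_inv(1)[OF i] by simp
  then obtain b where b: "matrix_inv (mat_complex g) = mat_complex b" using mat_cnj_fixed by blast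
  have "mat_complex (g ** b) = mat_complex (mat 1)"
    unfolding mat_complex_mult b[symmetric] by (simp add: matrix_inv_right[OF i])
  then have gb: "g ** b = mat 1" by (rule mat_complex_inj)
  show "invertible g" by (rule matrix_inv_unique(2)[OF gb])
  show "matrix_inv (mat_complex g) = mat_complex (matrix_inv g)" by (simp add: b matrix_inv_unique(1)[OF gb])
qed

lemma adapted_matrix_translate:
  assumes t: "adapted_matrix T t" and g: "mat_complex g \<in> grading_group br h"
  shows "adapted_matrix (g *v T) (g ** t ** matrix_inv g)"
proof -
  interpret G: matrix_group "grading_group br h" by (rule matrix_group_grading)
  let ?c = "mat_complex g"
  note ig = real_point_invertible[OF g]
  have ic: "invertible ?c" by (rule G.invertible_mem[OF g])
  have cinv: "matrix_inv ?c \<in> grading_group br h" by (rule G.inv_mem[OF g])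
  \<comment> \<open>The conjugation lemmas for structures have the inverse on the left, so they are
    applied to the inverse of \<open>g\<close>; as \<open>g\<close> is real, \<open>mat_cnj\<close>
    leaves it unchanged.\<close>
  have e: "mat_complex (g ** t ** matrix_inv g) = matrix_inv (matrix_inv ?c) ** mat_complex t ** mat_cnj (matrix_inv ?c)"
    by (simp add: mat_complex_mult matrix_inv_inv[OF ic] ig(2)) (metis ic ig(2) matrix_inv_inv)?
  have "cstruct (mat_complex (g ** t ** matrix_inv g))"
    unfolding e using t graded_AutD(1)[OF grading_group_graded[OF cinv]]
    by (intro cstruct_conj) (simp_all add: adapted_matrix_def)
  moreover have "graded_struct (mat_complex (g ** t ** matrix_inv g))"
    unfolding e using t grading_group_graded[OF cinv]
    by (intro graded_struct_conj) (simp_all add: adapted_matrix_def)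
  moreover have "br (g *v T) ((g ** t ** matrix_inv g) *v (g *v T)) = 0"
  proof -
    have "g *v br x y = br (g *v x) (g *v y)" for x y
    proof (rule vec_complex_inj)
      show "vec_complex (g *v br x y) = vec_complex (br (g *v x) (g *v y))"
        using lie_Aut_apply[OF graded_AutD(1)[OF grading_group_graded[OF g]], of "vec_complex x" "vec_complex y"]
        by (simp add: cb_real mat_complex_apply)
    qed
    then have "br (g *v T) (g *v (t *v T)) = g *v br T (t *v T)" by simp
    then show ?thesis
      using t by (simp add: adapted_matrix_def matrix_vector_mul_assoc[symmetric] matrix_vector_cancel[OF ig(1)])
  qed
  ultimately show ?thesis by (simp add: adapted_matrix_def)
qed

lemma cartan_act_conj_inv:
  assumes g: "mat_complex g \<in> grading_group br h"
  shows "cartan_act (grading_group br h) g (conj_inv t (grading_group br h))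
    = conj_inv (g ** t ** matrix_inv g) (grading_group br h)"
proof -
  interpret G: matrix_group "grading_group br h" by (rule matrix_group_grading)
  have "matrix_inv (mat_complex g) ** A ** mat_complex g \<in> grading_group br h"
    if "A \<in> grading_group br h" for A
    using that by (intro G.mult_mem G.inv_mem g)
  then show ?thesis
    unfolding cartan_act_def Let_def conj_inv_def
    by (auto simp: restrict_def fun_eq_iff mat_complex_mult real_point_invertible(2)[OF g, symmetric] matrix_mul_assoc)
qed

end

theorem theorem2p5:
  fixes br :: "real^'n \<Rightarrow> real^'n \<Rightarrow> real^'n"
    and m :: nat
    and h :: "int \<Rightarrow> (real^'n) set"
  assumes "semisimple_lie_algebra br"
    and "0 < m"
    and "lie_grading br m h"
    and "stable_grading br h"
  shows "(\<forall>T\<in>real_stable_vectors br h. \<exists>!\<theta>. adapted_involution br h T \<theta>) \<and>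
         reduction_map br h \<in> real_stable_vectors br h \<rightarrow> cartan_involutions (grading_group br h) \<and>
         (\<forall>g\<in>real_points (grading_group br h). \<forall>T\<in>real_stable_vectors br h.
            g *v T \<in> real_stable_vectors br h \<and>
            reduction_map br h (g *v T) =
              cartan_act (grading_group br h) g (reduction_map br h T))"
proof -
  interpret graded_lie br m h using assms by unfold_locales
  have st: "stable_vector br h (vec_complex T)" "T \<in> h 1" if "T \<in> real_stable_vectors br h" for T
    using that by (simp_all add: real_stable_vectors_def)
  show ?thesis
  proof (intro conjI ballI)
    fix T assume T: "T \<in> real_stable_vectors br h"
    obtain t where t: "adapted_matrix T t" by (rule adapted_matrix_exists[OF st(1)[OF T]])
    show "\<exists>!\<theta>. adapted_involution br h T \<theta>"
    proof (rule ex1I)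
      show "adapted_involution br h T (conj_inv t (adjoint_group br))"
        unfolding adapted_involution_iff using t by blast
      fix \<theta> assume "adapted_involution br h T \<theta>"
      then obtain t' where t': "adapted_matrix T t'" "\<theta> = conj_inv t' (adjoint_group br)"
        unfolding adapted_involution_iff by blast
      show "\<theta> = conj_inv t (adjoint_group br)"
        unfolding t'(2) adapted_matrix_unique[OF st(1)[OF T] t'(1) t] ..
    qed
  next
    show "reduction_map br h \<in> real_stable_vectors br h \<rightarrow> cartan_involutions (grading_group br h)"
    proof
      fix T assume T: "T \<in> real_stable_vectors br h"
      obtain t where t: "adapted_matrix T t" by (rule adapted_matrix_exists[OF st(1)[OF T]])
      show "reduction_map br h T \<in> cartan_involutions (grading_group br h)"
        unfolding reduction_map_eq[OF st(1)[OF T] t]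
        using t by (intro conj_inv_cartan_grading) (simp_all add: adapted_matrix_def)
    qed
  next
    fix g T assume "g \<in> real_points (grading_group br h)" and T: "T \<in> real_stable_vectors br h"
    then have g: "mat_complex g \<in> grading_group br h" by (simp add: real_points_def)
    obtain t where t: "adapted_matrix T t" by (rule adapted_matrix_exists[OF st(1)[OF T]])
    have gT: "stable_vector br h (vec_complex (g *v T))"
      using stable_vector_translate[OF st(1)[OF T] g] by (simp add: mat_complex_apply)
    then have "g *v T \<in> h 1" by (simp add: stable_vector_def hC_real)
    then show "g *v T \<in> real_stable_vectors br h" using gT by (simp add: real_stable_vectors_def)
    \<comment> \<open>Equivariance is uniqueness at \<open>g *v T\<close>: the matrix
      \<open>g ** t ** matrix_inv g\<close> is adapted to it.\<close>
    show "reduction_map br h (g *v T) = cartan_act (grading_group br h) g (reduction_map br h T)"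
      unfolding reduction_map_eq[OF st(1)[OF T] t] reduction_map_eq[OF gT adapted_matrix_translate[OF t g]]
        cartan_act_conj_inv[OF g] ..
  qed
qed

end
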